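(* Let $\Omega=(0,\pi)^3$ and $X=L^2(\Omega;\mathbb{R}^2)$. There exist positive constants $k,a,b$ with $a\ge 1+b^{-1}\ge b$ such that the dissipative coupled reaction--diffusion system $$\partial_t u_1=\Delta u_1+k u_1(1-a u_1^2+u_2^2),\qquad \partial_t u_2=\Delta u_2+k u_2(1-b u_2^2-u_1^2)$$ in $\Omega$ with the homogeneous Neumann boundary condition on $\partial\Omega$ does not have a normally hyperbolic inertial manifold $\mathcal{M}\subset X$.
   Context: Setting. The system $\partial_t u_i=\Delta u_i+f_i(u_1,u_2)$, $i=1,2$, $f=(f_1,f_2):\mathbb{R}^2\to\mathbb{R}^2$, with Neumann boundary condition is regarded as an abstract semilinear parabolic equation $\partial_t u=-Au+F(u)$ in the real Hilbert space $X=L^2(\Omega;\mathbb{R}^2)$ with norm $\|\cdot\|$, where $Au=u-\Delta u$ (componentwise, with the Neumann condition; a positive definite self-adjoint operator with compact inverse), $F(u)=u+f(u)$ (nonlinearity exponent $\theta=0$), and $X^1=\mathcal{D}(A)$. The ODE $v_t=f(v)$ in $\mathbb{R}^2$ has a bounded positively invariant region (here the disks $|v|\le r$ with $r^2\ge 2/\min(a,b)$); as usual, $f$ is altered outside a large such region, with preservation of smoothness, so as to become globally Lipschitz and vanish for large $|v|$. The altered equation has the same final dynamics as $t\to+\infty$ as the original one. The equation generates a phase semiflow $\{\Phi_t\}_{t\ge0}$ on $X$, and it is dissipative: there is an absorbing ball in $X$. Differentiability of $F$ and $\Phi_t$ is understood in the weakened (generalized) Fr\'echet sense: in the increment $F(u+h)-F(u)$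 (respectively $\Phi_t(u+h)-\Phi_t(u)$) one takes $u,h\in X^1$. $\Phi_t'(u)$ denotes the derivative of $\Phi_t$ at $u$. The global attractor $\mathcal{A}$ is the union of all complete bounded trajectories. An inertial manifold is a smooth ($C^1$) finite-dimensional positively invariant surface $\mathcal{M}\subset X$ that contains $\mathcal{A}$ and attracts all trajectories $u(t)$ with exponential tracking as $t\to+\infty$ (each trajectory approaches some trajectory lying on $\mathcal{M}$ exponentially fast). An inertial manifold $\mathcal{M}\subset X$ is normally hyperbolic if there is a vector bundle splitting $\mathcal{T}_{\mathcal{M}}X=\mathcal{T}\mathcal{M}\oplus\mathcal{N}$ over $\mathcal{M}$, invariant with respect to the linearization $\{\Phi_t'\}$ of the semiflow, where $\mathcal{T}\mathcal{M}$ is the tangent bundle of $\mathcal{M}$, such that for all $u\in\mathcal{M}$ and $t\ge0$ $$\|\Phi_t'(u)h\|\ge M^{-1}e^{-\gamma_1 t}\|h\|\ \ (h\in\mathcal{T}_u\mathcal{M}),\qquad \|\Phi_t'(u)h\|\le M e^{-\gamma_2 t}\|h\|\ \ (h\in\mathcal{N}_u),$$ with constants $M>0$ and $0<\gamma_1<\gamma_2$ that may depend on $\mathcal{M}$ and on $u\in\mathcal{M}$. *)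

theory Defs
  imports "HOL-Analysis.Analysis"
begin

section \<open>The phase space \<open>X = L\<^sup>2(\<Omega>; \<real>\<^sup>2)\<close>, \<open>\<Omega> = (0,\<pi>)\<^sup>3\<close>\<close>

definition Omega :: "(real ^ 3) set"
  where "Omega = box 0 (\<chi> i. pi)"

definition square_integrable :: "(real ^ 3 \<Rightarrow> real ^ 2) \<Rightarrow> bool"
  where "square_integrable f \<longleftrightarrow>
    f \<in> borel_measurable (lebesgue_on Omega) \<and>
    integrable (lebesgue_on Omega) (\<lambda>x. (norm (f x))\<^sup>2)"

definition L2_eq :: "(real ^ 3 \<Rightarrow> real ^ 2) \<Rightarrow> (real ^ 3 \<Rightarrow> real ^ 2) \<Rightarrow> bool"
  where "L2_eq f g \<longleftrightarrow> square_integrable f \<and> square_integrable g \<and>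
    (AE x in lebesgue_on Omega. f x = g x)"

lemma square_integrable_0: "square_integrable (\<lambda>x. 0)"
  by (simp add: square_integrable_def)

lemma square_integrable_add:
  assumes f: "square_integrable f" and g: "square_integrable g"
  shows "square_integrable (\<lambda>x. f x + g x)"
proof -
  have m: "(\<lambda>x. f x + g x) \<in> borel_measurable (lebesgue_on Omega)"
    using f g by (auto simp: square_integrable_def intro: borel_measurable_add)
  have bd: "(norm (a + b))\<^sup>2 \<le> 2 * (norm a)\<^sup>2 + 2 * (norm b)\<^sup>2" for a b :: "real ^ 2"
  proof -
    have "(norm (a + b))\<^sup>2 \<le> (norm a + norm b)\<^sup>2"
      by (simp add: norm_triangle_ineq power_mono)
    also have "\<dots> \<le> 2 * (norm a)\<^sup>2 + 2 * (norm b)\<^sup>2"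
      using sum_squares_bound[of "norm a" "norm b"] by (simp add: power2_sum)
    finally show ?thesis .
  qed
  have "integrable (lebesgue_on Omega) (\<lambda>x. 2 * (norm (f x))\<^sup>2 + 2 * (norm (g x))\<^sup>2)"
    using f g by (simp add: square_integrable_def)
  then have "integrable (lebesgue_on Omega) (\<lambda>x. (norm (f x + g x))\<^sup>2)"
    using m bd by (elim Bochner_Integration.integrable_bound) auto
  with m show ?thesis
    by (simp add: square_integrable_def)
qed

lemma square_integrable_scaleR:
  assumes "square_integrable f"
  shows "square_integrable (\<lambda>x. c *\<^sub>R f x)"
  using assms by (auto simp: square_integrable_def power_mult_distrib)

lemma square_integrable_inner:
  assumes f: "square_integrable f" and g: "square_integrable g"
  shows "integrable (lebesgue_on Omega) (\<lambda>x. f x \<bullet> g x)"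
proof -
  have m: "(\<lambda>x. f x \<bullet> g x) \<in> borel_measurable (lebesgue_on Omega)"
    using f g by (auto simp: square_integrable_def intro: borel_measurable_inner)
  have bd: "\<bar>a \<bullet> b\<bar> \<le> (norm a)\<^sup>2 + (norm b)\<^sup>2" for a b :: "real ^ 2"
  proof -
    have "\<bar>a \<bullet> b\<bar> \<le> norm a * norm b"
      by (rule Cauchy_Schwarz_ineq2)
    also have "\<dots> \<le> (norm a)\<^sup>2 + (norm b)\<^sup>2"
      using sum_squares_bound[of "norm a" "norm b"] mult_nonneg_nonneg[OF norm_ge_zero norm_ge_zero, of a b]
      by linarith
    finally show ?thesis .
  qed
  have "integrable (lebesgue_on Omega) (\<lambda>x. (norm (f x))\<^sup>2 + (norm (g x))\<^sup>2)"
    using f g by (simp add: square_integrable_def)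
  then show ?thesis
    using m bd by (elim Bochner_Integration.integrable_bound) auto
qed

quotient_type L2 = "real ^ 3 \<Rightarrow> real ^ 2" / partial: L2_eq
proof (rule part_equivpI)
  show "\<exists>f. L2_eq f f"
    using square_integrable_0 by (auto simp: L2_eq_def)
  show "symp L2_eq"
    by (auto simp: L2_eq_def intro!: sympI)
  show "transp L2_eq"
  proof (rule transpI)
    fix f g h
    assume "L2_eq f g" "L2_eq g h"
    moreover from this have "AE x in lebesgue_on Omega. f x = h x"
      unfolding L2_eq_def by (auto elim: AE_mp)
    ultimately show "L2_eq f h"
      by (simp add: L2_eq_def)
  qed
qed

instantiation L2 :: real_inner
begin

lift_definition zero_L2 :: L2 is "\<lambda>x. 0"
  by (simp add: L2_eq_def square_integrable_0)

lift_definition plus_L2 :: "L2 \<Rightarrow> L2 \<Rightarrow> L2" is "\<lambda>f g x. f x + g x"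
  by (auto simp: L2_eq_def intro: square_integrable_add elim: AE_mp)

lift_definition scaleR_L2 :: "real \<Rightarrow> L2 \<Rightarrow> L2" is "\<lambda>c f x. c *\<^sub>R f x"
  by (auto simp: L2_eq_def intro: square_integrable_scaleR elim: AE_mp)

lift_definition inner_L2 :: "L2 \<Rightarrow> L2 \<Rightarrow> real"
  is "\<lambda>f g. LINT x|lebesgue_on Omega. f x \<bullet> g x"
proof -
  fix f f' g g'
  assume *: "L2_eq f f'" "L2_eq g g'"
  then have "integrable (lebesgue_on Omega) (\<lambda>x. f x \<bullet> g x)"
    "integrable (lebesgue_on Omega) (\<lambda>x. f' x \<bullet> g' x)"
    by (auto simp: L2_eq_def intro: square_integrable_inner)
  moreover have "AE x in lebesgue_on Omega. f x \<bullet> g x = f' x \<bullet> g' x"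
    using * unfolding L2_eq_def by (auto elim: AE_mp)
  ultimately show "(LINT x|lebesgue_on Omega. f x \<bullet> g x) = (LINT x|lebesgue_on Omega. f' x \<bullet> g' x)"
    by (intro integral_cong_AE) auto
qed

definition uminus_L2 :: "L2 \<Rightarrow> L2" where "uminus_L2 u = (- 1) *\<^sub>R u"
definition minus_L2 :: "L2 \<Rightarrow> L2 \<Rightarrow> L2" where "minus_L2 u v = u + (- v)"
definition norm_L2 :: "L2 \<Rightarrow> real" where "norm_L2 u = sqrt (u \<bullet> u)"
definition dist_L2 :: "L2 \<Rightarrow> L2 \<Rightarrow> real" where "dist_L2 u v = norm (u - v)"
definition sgn_L2 :: "L2 \<Rightarrow> L2" where "sgn_L2 u = inverse (norm u) *\<^sub>R u"
definition uniformity_L2 :: "(L2 \<times> L2) filter"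
  where "uniformity_L2 = (INF e\<in>{0<..}. principal {(x, y). dist x y < e})"
definition open_L2 :: "L2 set \<Rightarrow> bool"
  where "open_L2 U \<longleftrightarrow> (\<forall>x\<in>U. eventually (\<lambda>(x', y). x' = x \<longrightarrow> y \<in> U) uniformity)"

instance
proof
  fix u v w :: L2 and a b c :: real
  show "u + v + w = u + (v + w)"
    by transfer (auto simp: L2_eq_def add.assoc intro!: square_integrable_add)
  show "u + v = v + u"
    by transfer (auto simp: L2_eq_def add.commute intro!: square_integrable_add)
  show "0 + u = u"
    by transfer (auto simp: L2_eq_def)
  show "- u + u = 0"
    unfolding uminus_L2_def
    by transfer (auto simp: L2_eq_def square_integrable_0
        intro: square_integrable_add[OF square_integrable_scaleR[where c = "-1"], simplified])
  show "u - v = u + - v"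
    by (simp add: minus_L2_def)
  show "a *\<^sub>R (u + v) = a *\<^sub>R u + a *\<^sub>R v"
    by transfer (auto simp: L2_eq_def scaleR_add_right
        intro!: square_integrable_add square_integrable_scaleR)
  show "(a + b) *\<^sub>R u = a *\<^sub>R u + b *\<^sub>R u"
    by transfer (auto simp: L2_eq_def scaleR_add_left
        intro!: square_integrable_add square_integrable_scaleR)
  show "a *\<^sub>R b *\<^sub>R u = (a * b) *\<^sub>R u"
    by transfer (auto simp: L2_eq_def simp del: scaleR_scaleR
        intro!: square_integrable_scaleR, auto)
  show "1 *\<^sub>R u = u"
    by transfer (auto simp: L2_eq_def)
  show "dist u v = norm (u - v)"
    by (simp add: dist_L2_def)
  show "sgn u = inverse (norm u) *\<^sub>R u"
    by (simp add: sgn_L2_def)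
  show "uniformity = (INF e\<in>{0<..}. principal {(x, y). dist (x :: L2) y < e})"
    by (simp add: uniformity_L2_def)
  show "open U \<longleftrightarrow> (\<forall>x\<in>U. eventually (\<lambda>(x', y). x' = x \<longrightarrow> y \<in> U) uniformity)" for U :: "L2 set"
    by (simp add: open_L2_def)
  show "u \<bullet> v = v \<bullet> u"
    by transfer (simp add: inner_commute)
  show "(u + v) \<bullet> w = u \<bullet> w + v \<bullet> w"
    by transfer (simp add: L2_eq_def inner_add_left square_integrable_inner)
  show "(a *\<^sub>R u) \<bullet> v = a * (u \<bullet> v)"
    by transfer simp
  show "0 \<le> u \<bullet> u"
    by transfer simp
  show "u \<bullet> u = 0 \<longleftrightarrow> u = 0"
  proof transfer
    fix f
    assume "L2_eq f f"
    then have f: "square_integrable f" by (simp add: L2_eq_def)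
    have "(LINT x|lebesgue_on Omega. f x \<bullet> f x) = 0 \<longleftrightarrow>
        (AE x in lebesgue_on Omega. f x \<bullet> f x = 0)"
      by (rule integral_nonneg_eq_0_iff_AE) (auto intro: square_integrable_inner f)
    then show "(LINT x|lebesgue_on Omega. f x \<bullet> f x) = 0 \<longleftrightarrow> L2_eq f (\<lambda>x. 0)"
      by (simp add: L2_eq_def f square_integrable_0)
  qed
  show "norm u = sqrt (u \<bullet> u)"
    by (simp add: norm_L2_def)
qed

end


section \<open>The Neumann operator \<open>A u = u - \<Delta>u\<close>\<close>

primrec C_k :: "nat \<Rightarrow> ('a::euclidean_space \<Rightarrow> 'b::real_normed_vector) \<Rightarrow> bool" where
  "C_k 0 f \<longleftrightarrow> continuous_on UNIV f"
| "C_k (Suc m) f \<longleftrightarrow> f differentiable_on UNIV \<and>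
     (\<forall>v. C_k m (\<lambda>x. frechet_derivative f (at x) v))"

definition C_infinity :: "('a::euclidean_space \<Rightarrow> 'b::real_normed_vector) \<Rightarrow> bool"
  where "C_infinity f \<longleftrightarrow> (\<forall>m. C_k m f)"

definition test_function :: "(real ^ 3 \<Rightarrow> real) \<Rightarrow> bool"
  where "test_function \<psi> \<longleftrightarrow> C_infinity \<psi> \<and>
    (\<exists>K. compact K \<and> K \<subseteq> Omega \<and> (\<forall>x. x \<notin> K \<longrightarrow> \<psi> x = 0))"

definition weak_partial :: "3 \<Rightarrow> L2 \<Rightarrow> L2 \<Rightarrow> bool"
  where "weak_partial j u d \<longleftrightarrow> (\<forall>\<psi>. test_function \<psi> \<longrightarrow>
    (LINT x|lebesgue_on Omega. frechet_derivative \<psi> (at x) (axis j 1) *\<^sub>R rep_L2 u x) =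
    - (LINT x|lebesgue_on Omega. \<psi> x *\<^sub>R rep_L2 d x))"

text \<open>The self-adjoint Neumann operator is the one associated with the form
  \<open>(\<nabla>u, \<nabla>\<phi>) + (u, \<phi>)\<close> on \<open>H\<^sup>1(\<Omega>; \<real>\<^sup>2)\<close>: the boundary condition is the natural one and
  is encoded by letting \<open>\<phi>\<close> range over all of \<open>H\<^sup>1\<close>.  As \<open>H\<^sup>1\<close> is dense in \<open>X\<close>,
  \<open>w = A u\<close> is determined by \<open>u\<close>.\<close>

definition is_neumann :: "L2 \<Rightarrow> L2 \<Rightarrow> bool"
  where "is_neumann u w \<longleftrightarrow> (\<exists>du. (\<forall>j. weak_partial j u (du j)) \<and>
    (\<forall>\<phi> d\<phi>. (\<forall>j. weak_partial j \<phi> (d\<phi> j)) \<longrightarrow>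
      (\<Sum>j\<in>UNIV. du j \<bullet> d\<phi> j) + u \<bullet> \<phi> = w \<bullet> \<phi>))"

definition X1 :: "L2 set"
  where "X1 = {u. \<exists>w. is_neumann u w}"

definition A_op :: "L2 \<Rightarrow> L2"
  where "A_op u = (THE w. is_neumann u w)"


section \<open>The reaction term and the phase semiflow\<close>

definition reaction :: "real \<Rightarrow> real \<Rightarrow> real \<Rightarrow> real ^ 2 \<Rightarrow> real ^ 2"
  where "reaction k a b v = vector
    [k * v $ 1 * (1 - a * (v $ 1)\<^sup>2 + (v $ 2)\<^sup>2),
     k * v $ 2 * (1 - b * (v $ 2)\<^sup>2 - (v $ 1)\<^sup>2)]"

text \<open>The cubic term is altered outside a positively invariant disk.  It is either the reaction
  term \<open>g\<close> itself, or the full nonlinearity \<open>v + g v\<close> of the abstract equation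
  \<open>u\<^sub>t = - A u + F(u)\<close>, that vanishes for large \<open>|v|\<close>.  The second variant yields a dissipative
  equation; in the first one every large constant is an equilibrium of the Neumann problem.
  Both are admitted.\<close>

definition altered_reaction :: "real \<Rightarrow> real \<Rightarrow> real \<Rightarrow> (real ^ 2 \<Rightarrow> real ^ 2) \<Rightarrow> bool"
  where "altered_reaction k a b g \<longleftrightarrow>
    C_infinity g \<and> (\<exists>L. L-lipschitz_on UNIV g) \<and>
    (\<exists>r>0. r\<^sup>2 \<ge> 2 / min a b \<and> (\<forall>v. norm v \<le> r \<longrightarrow> g v = reaction k a b v)) \<and>
    (\<exists>r. (\<forall>v. norm v \<ge> r \<longrightarrow> g v = 0) \<or> (\<forall>v. norm v \<ge> r \<longrightarrow> v + g v = 0))"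

text \<open>For globally Lipschitz \<open>g\<close> the superposition below is square integrable and does not
  depend on the representative.\<close>

definition F_op :: "(real ^ 2 \<Rightarrow> real ^ 2) \<Rightarrow> L2 \<Rightarrow> L2"
  where "F_op g u = abs_L2 (\<lambda>x. rep_L2 u x + g (rep_L2 u x))"

definition is_solution :: "(real ^ 2 \<Rightarrow> real ^ 2) \<Rightarrow> L2 \<Rightarrow> (real \<Rightarrow> L2) \<Rightarrow> bool"
  where "is_solution g u0 u \<longleftrightarrow> continuous_on {0..} u \<and> u 0 = u0 \<and>
    (\<forall>t>0. u t \<in> X1 \<and> (u has_vector_derivative (- A_op (u t) + F_op g (u t))) (at t))"

definition phase_semiflow :: "(real ^ 2 \<Rightarrow> real ^ 2) \<Rightarrow> (real \<Rightarrow> L2 \<Rightarrow> L2) \<Rightarrow> bool"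
  where "phase_semiflow g \<Phi> \<longleftrightarrow> (\<forall>u0. is_solution g u0 (\<lambda>t. \<Phi> t u0))"

text \<open>The generalized Frechet derivative: a bounded operator on \<open>X\<close>, where the increments
  \<open>h\<close> are taken from \<open>X\<^sup>1\<close>, with the norm \<open>\<parallel>A h\<parallel>\<close> of \<open>X\<^sup>1\<close>.  As \<open>X\<^sup>1\<close> is dense
  in \<open>X\<close>, it is unique.  For a base point \<open>u\<close> in \<open>X\<^sup>1\<close> this is the usual definition; the
  same formula is used at points of a manifold \<open>M \<subseteq> X\<close> outside \<open>X\<^sup>1\<close>.\<close>

definition has_gen_derivative :: "(L2 \<Rightarrow> L2) \<Rightarrow> (L2 \<Rightarrow> L2) \<Rightarrow> L2 \<Rightarrow> bool"
  where "has_gen_derivative G D u \<longleftrightarrow> bounded_linear D \<and>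
    (\<forall>\<epsilon>>0. \<exists>\<delta>>0. \<forall>h\<in>X1. norm (A_op h) < \<delta> \<longrightarrow>
      norm (G (u + h) - G u - D h) \<le> \<epsilon> * norm (A_op h))"


section \<open>Inertial manifolds and normal hyperbolicity\<close>

definition global_attractor :: "(real \<Rightarrow> L2 \<Rightarrow> L2) \<Rightarrow> L2 set"
  where "global_attractor \<Phi> = \<Union> {range u | u :: real \<Rightarrow> L2.
    bounded (range u) \<and> (\<forall>t. \<forall>s\<ge>0. u (t + s) = \<Phi> s (u t))}"

text \<open>Local charts are \<open>C\<^sup>1\<close> immersions that are homeomorphisms onto relatively open subsets of
  \<open>M\<close>.  Their parameter domains are open in a subspace of dimension \<open>n\<close> of \<open>X\<close>, which
  stands in for \<open>\<real>\<^sup>n\<close> since \<open>n\<close> is not fixed in advance.\<close>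

definition C1_chart :: "nat \<Rightarrow> L2 set \<Rightarrow> L2 set \<Rightarrow> (L2 \<Rightarrow> L2) \<Rightarrow> bool"
  where "C1_chart n M V \<phi> \<longleftrightarrow> (\<exists>B \<phi>' \<psi>.
    finite B \<and> card B = n \<and> independent B \<and> openin (top_of_set (span B)) V \<and>
    openin (top_of_set M) (\<phi> ` V) \<and> homeomorphism V (\<phi> ` V) \<phi> \<psi> \<and>
    (\<forall>x\<in>V. (\<phi> has_derivative \<phi>' x) (at x within span B) \<and> inj_on (\<phi>' x) (span B)) \<and>
    (\<forall>h\<in>span B. continuous_on V (\<lambda>x. \<phi>' x h)))"

definition C1_manifold :: "nat \<Rightarrow> L2 set \<Rightarrow> bool"
  where "C1_manifold n M \<longleftrightarrow> (\<forall>u\<in>M. \<exists>V \<phi>. C1_chart n M V \<phi> \<and> u \<in> \<phi> ` V)"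

definition tangent_space :: "L2 set \<Rightarrow> L2 \<Rightarrow> L2 set"
  where "tangent_space M u = {h. \<exists>\<gamma>. \<exists>\<epsilon>>0. \<gamma> 0 = u \<and>
    (\<forall>s::real. \<bar>s\<bar> < \<epsilon> \<longrightarrow> \<gamma> s \<in> M) \<and> (\<gamma> has_vector_derivative h) (at 0)}"

definition inertial_manifold :: "(real \<Rightarrow> L2 \<Rightarrow> L2) \<Rightarrow> L2 set \<Rightarrow> bool"
  where "inertial_manifold \<Phi> M \<longleftrightarrow>
    (\<exists>n. C1_manifold n M) \<and>
    (\<forall>t\<ge>0. \<Phi> t ` M \<subseteq> M) \<and>
    global_attractor \<Phi> \<subseteq> M \<and>
    (\<forall>u. \<exists>v\<in>M. \<exists>C>0. \<exists>\<eta>>0. \<forall>t\<ge>0. norm (\<Phi> t u - \<Phi> t v) \<le> C * exp (- \<eta> * t))"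

text \<open>\<open>N\<close> is a complement of the tangent bundle, and the projections \<open>P u\<close> onto
  \<open>T\<^sub>u M\<close> along \<open>N u\<close> form a continuous bundle morphism of \<open>M \<times> X\<close>.\<close>

definition bundle_splitting :: "L2 set \<Rightarrow> (L2 \<Rightarrow> L2 set) \<Rightarrow> bool"
  where "bundle_splitting M N \<longleftrightarrow> (\<exists>P.
    (\<forall>u\<in>M. bounded_linear (P u) \<and> (\<forall>h. P u (P u h) = P u h) \<and>
      range (P u) = tangent_space M u \<and> {h. P u h = 0} = N u) \<and>
    continuous_on (M \<times> UNIV) (\<lambda>(u, h). P u h))"

definition normally_hyperbolic :: "(real \<Rightarrow> L2 \<Rightarrow> L2) \<Rightarrow> L2 set \<Rightarrow> bool"
  where "normally_hyperbolic \<Phi> M \<longleftrightarrow> (\<exists>N D.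
    bundle_splitting M N \<and>
    (\<forall>u\<in>M. \<forall>t\<ge>0. has_gen_derivative (\<Phi> t) (D t u) u \<and>
      D t u ` tangent_space M u \<subseteq> tangent_space M (\<Phi> t u) \<and> D t u ` N u \<subseteq> N (\<Phi> t u)) \<and>
    (\<forall>u\<in>M. \<exists>K>0. \<exists>\<gamma>\<^sub>1 \<gamma>\<^sub>2. 0 < \<gamma>\<^sub>1 \<and> \<gamma>\<^sub>1 < \<gamma>\<^sub>2 \<and> (\<forall>t\<ge>0.
      (\<forall>h\<in>tangent_space M u. norm (D t u h) \<ge> inverse K * exp (- \<gamma>\<^sub>1 * t) * norm h) \<and>
      (\<forall>h\<in>N u. norm (D t u h) \<le> K * exp (- \<gamma>\<^sub>2 * t) * norm h))))"

end

theory Submission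
  imports Defs "HOL-Real_Asymp.Real_Asymp"
begin

text \<open>Take \<open>k = 4\<close>, \<open>a = 2\<close>, \<open>b = 1\<close>.  Along a spatially homogeneous trajectory \<open>(p(t), 0)\<close> the
  linearized equation is diagonal in the Neumann modes.  An invariant splitting commutes with
  \<open>\<Phi>\<^sub>t'\<close>, so for a mode \<open>e\<close> the number \<open>(P(u(t)) e, e)\<close> is constant on the heteroclinic orbit
  that joins the equilibria \<open>0\<close> and \<open>(1 / sqrt 2, 0)\<close>, and by continuity of \<open>P\<close> it agrees at
  the two equilibria.  At an equilibrium each mode lies either in the tangent space or in \<open>N\<close>,
  depending on whether its growth rate is at least \<open>- \<gamma>\<^sub>1\<close>.  For the eigenvalue \<open>\<lambda>\<close> of \<open>- \<Delta>\<close>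
  the rates are \<open>4 - \<lambda>\<close> (twice) at \<open>0\<close>, but \<open>- 8 - \<lambda>\<close> and \<open>2 - \<lambda>\<close> at \<open>(1 / sqrt 2, 0)\<close>.
  If \<open>\<lambda>\<close> is the largest tangent eigenvalue at \<open>0\<close> and \<open>\<lambda>' > \<lambda>\<close> is any larger one, then the first
  mode of \<open>\<lambda>\<close> is tangent and the second mode of \<open>\<lambda>'\<close> is not, so that \<open>2 - \<lambda>' < - 8 - \<lambda>\<close>.
  Hence the spectrum has a gap longer than \<open>10\<close>.

  But the eigenvalues are the sums of three squares, and every positive \<open>M\<close> congruent to 3 modulo 8
  is a sum of three odd squares.  Indeed, the number of representations \<open>M = x\<^sup>2 + y\<^sup>2 + z\<^sup>2\<close> by odd
  positive integers equals that of representations \<open>M = x y + y z + z x\<close>, where \<open>x = y = 1\<close> is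
  possible: with either number as \<open>f\<close>, the sum of \<open>f(4 m - h\<^sup>2)\<close> over odd \<open>h > 0\<close> is the sum of
  divisors of \<open>m\<close> for all odd \<open>m\<close>, which determines \<open>f\<close> recursively.\<close>

section \<open>Sums of odd squares\<close>

text \<open>The constants come from the gap: at \<open>(1 / sqrt a, 0)\<close> the two rates are
  \<open>- 2 k - \<lambda>\<close> and \<open>k (1 - 1 / a) - \<lambda>\<close>, so a splitting
  needs a spectral gap longer than \<open>k (3 - 1 / a)\<close>. Numbers congruent to 3 modulo 8
  leave no gap longer than 8; \<open>k = 4\<close> and \<open>a = 2\<close> give 10, and
  \<open>b = 1\<close> satisfies \<open>a \<ge> 1 + 1 / b \<ge> b\<close>. The semiflow is an
  arbitrary family of solutions and \<open>D\<close> an arbitrary generalized derivative, so the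
  linearization has to be computed, not quoted: the ansatz \<open>p(t) + s c(t) e\<close> is
  compared with the trajectory by an energy estimate whose error is of order \<open>s^2\<close>.
  This fixes \<open>D\<close> on every Neumann mode, and completeness of the modes fixes it on
  \<open>X\<close>. Between the equilibria \<open>P(u(t)) e\<close> may contain modes other than
  \<open>e\<close>, so only the diagonal entry \<open>(P e, e)\<close> is followed. At an
  equilibrium \<open>P e\<close> is \<open>e\<close> or \<open>0\<close>, and there the entry
  decides which of the two holds. The arithmetic is by counting: parity-preserving bijections
  replace the theory of ternary quadratic forms.\<close>

definition odd_below :: "int \<Rightarrow> int set"
  where "odd_below N = {h. odd h \<and> 0 < h \<and> h\<^sup>2 < N}"

lemma int_le_square: "(x::int) \<le> x\<^sup>2"
proof (cases "1 \<le> x")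
  case True
  then show ?thesis using mult_right_mono[of 1 x x] by (simp add: power2_eq_square)
next
  case False
  then show ?thesis using zero_le_power2[of x] by linarith
qed

lemma finite_odd_below [simp]: "finite (odd_below N)"
proof (rule finite_subset)
  show "odd_below N \<subseteq> {0..N}"
  proof
    fix h assume "h \<in> odd_below N"
    then have "0 < h" "h * h < N" by (auto simp: odd_below_def power2_eq_square)
    moreover have "h * 1 \<le> h * h" using \<open>0 < h\<close> by (intro mult_left_mono) auto
    ultimately show "h \<in> {0..N}" unfolding atLeastAtMost_iff by linarith
  qed
qed simp

lemma odd_square_mod_8: "odd (h::int) \<Longrightarrow> h\<^sup>2 mod 8 = 1"
proof -
  assume "odd h"
  then obtain k where k: "h = 2 * k + 1" by (elim oddE)
  have "even (k * (k + 1))" by simp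
  then obtain l where l: "k * (k + 1) = 2 * l" by (elim evenE)
  have "h\<^sup>2 = 4 * (k * (k + 1)) + 1" unfolding k by (simp add: power2_eq_square algebra_simps)
  also have "\<dots> = 8 * l + 1" unfolding l by simp
  finally show ?thesis by simp
qed

text \<open>At \<open>N = M + 1\<close> the summand \<open>h = 1\<close> contains
  \<open>d M\<close>, and all others contain values of \<open>d\<close> at smaller positive
  arguments of the same residue class, because odd squares are 1 modulo 8. Strong induction
  therefore solves the recursion. Where the weight of \<open>h = 1\<close> vanishes, the value has
  to be known beforehand, which the second assumption permits.\<close>

lemma odd_square_recursion_unique:
  fixes d :: "int \<Rightarrow> int" and w :: "int \<Rightarrow> int \<Rightarrow> int"
  assumes rec: "\<And>N. N mod 8 = (r + 1) mod 8 \<Longrightarrow> 1 < N \<Longrightarrow> (\<Sum>h\<in>odd_below N. w N h * d (N - h\<^sup>2)) = 0"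
    and nz: "\<And>N. N mod 8 = (r + 1) mod 8 \<Longrightarrow> 1 < N \<Longrightarrow> w N 1 \<noteq> 0 \<or> d (N - 1) = 0"
  shows "0 < M \<Longrightarrow> M mod 8 = r mod 8 \<Longrightarrow> d M = 0"
proof (induction "nat M" arbitrary: M rule: less_induct)
  case less
  let ?N = "M + 1"
  have N: "?N mod 8 = (r + 1) mod 8" "1 < ?N"
    using less.prems by (auto intro: mod_add_cong)
  have one: "1 \<in> odd_below ?N" using less.prems by (simp add: odd_below_def)
  have zero: "d (?N - h\<^sup>2) = 0" if h: "h \<in> odd_below ?N - {1}" for h
  proof (rule less.hyps)
    from h have h': "odd h" "0 < h" "h\<^sup>2 < ?N" "h \<noteq> 1" by (auto simp: odd_below_def)
    then have "1 < h" by auto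
    then have "1 < h\<^sup>2" by (simp add: one_less_power)
    then show "nat (?N - h\<^sup>2) < nat M" using less.prems by auto
    show "0 < ?N - h\<^sup>2" using h' by simp
    have "(?N - h\<^sup>2) mod 8 = (?N mod 8 - h\<^sup>2 mod 8) mod 8" by (simp add: mod_diff_eq)
    also have "\<dots> = ((r + 1) mod 8 - 1 mod 8) mod 8" using N(1) odd_square_mod_8[OF h'(1)] by simp
    also have "\<dots> = r mod 8" unfolding mod_diff_eq by simp
    finally show "(?N - h\<^sup>2) mod 8 = r mod 8" .
  qed
  have "0 = (\<Sum>h\<in>odd_below ?N. w ?N h * d (?N - h\<^sup>2))" using rec[OF N] by simp
  also have "\<dots> = w ?N 1 * d M"
    using one zero by (subst sum.remove[OF _ one]) (auto intro!: sum.neutral)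
  finally show ?case using nz[OF N] by auto
qed

section \<open>Four odd squares and the divisor sum\<close>

definition windmills :: "int \<Rightarrow> (int \<times> int \<times> int) set"
  where "windmills N = {(x, y, z). odd x \<and> odd y \<and> odd z \<and> 0 < y \<and> 0 < z \<and> x\<^sup>2 + 4 * y * z = N}"

lemma finite_windmills [simp]: "finite (windmills N)"
proof (rule finite_subset)
  show "windmills N \<subseteq> {-N..N} \<times> {0..N} \<times> {0..N}"
  proof
    fix w assume "w \<in> windmills N"
    then obtain x y z where w: "w = (x, y, z)" "0 < y" "0 < z" "x\<^sup>2 + 4 * y * z = N"
      by (auto simp: windmills_def)
    have "y * 1 \<le> y * z" "1 * z \<le> y * z" using w by (intro mult_mono; auto)+
    moreover have "\<bar>x\<bar> \<le> x\<^sup>2"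
      using self_le_power[of "\<bar>x\<bar>" 2] by (cases "x = 0") auto
    moreover have "0 \<le> x\<^sup>2" by simp
    ultimately have "\<bar>x\<bar> \<le> N" "y \<le> N" "z \<le> N" using w by linarith+
    then show "w \<in> {-N..N} \<times> {0..N} \<times> {0..N}" using w by auto
  qed
qed simp

text \<open>On the windmills with \<open>x < y - z\<close> the map \<open>(x, y, z) \<mapsto> (- x - 2 z, y - x - z, z)\<close> is an
  involution (Zagier), and it changes the sign of \<open>(y + z) (y z - x\<^sup>2) + x (y\<^sup>2 - z\<^sup>2)\<close>.\<close>

lemma sum_windmills: "(\<Sum>(x, y, z)\<in>windmills N. y * (y * z - x\<^sup>2)) = 0"
proof -
  let ?W = "windmills N" and ?R = "{(x, y, z) \<in> windmills N. x < y - z}"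
  let ?L = "{(x, y, z) \<in> windmills N. \<not> x < y - z}"
  define K where "K = (\<lambda>(x, y, z). (y + z) * (y * z - x\<^sup>2) :: int)"
  \<comment> \<open>\<open>q\<close> completes \<open>K\<close> to a quantity that the involution
    negates. It costs nothing: it is odd in \<open>x\<close>, so it sums to zero over all windmills,
    and by its symmetry also over one half of them.\<close>
  define q where "q = (\<lambda>(x, y, z). x * (y\<^sup>2 - z\<^sup>2) :: int)"
  have fin: "finite ?R" "finite ?L" by (auto intro: finite_subset[OF _ finite_windmills])
  have W: "?W = ?R \<union> ?L" "?R \<inter> ?L = {}" by auto
  \<comment> \<open>The map \<open>(x, y, z) \<mapsto> (- x, z, y)\<close> exchanges the two halves;
    the boundary \<open>x = y - z\<close> is empty because \<open>x\<close> is odd and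
    \<open>y - z\<close> is even.\<close>
  have half: "sum f ?W = 2 * sum f ?R" if f: "\<And>x y z. f (- x, z, y) = f (x, y, z)"
    for f :: "int \<times> int \<times> int \<Rightarrow> int"
  proof -
    have "sum f ?L = sum f ?R"
    proof (rule sum.reindex_bij_witness[where i = "\<lambda>(x, y, z). (- x, z, y)" and j = "\<lambda>(x, y, z). (- x, z, y)"])
      fix a assume a: "a \<in> ?L"
      then obtain x y z where xyz: "a = (x, y, z)" "odd x" "odd y" "odd z" "\<not> x < y - z"
        "0 < y" "0 < z" "x\<^sup>2 + 4 * y * z = N" by (auto simp: windmills_def)
      then have "x \<noteq> y - z" by presburger
      then show "(\<lambda>(x, y, z). (- x, z, y)) a \<in> ?R" using xyz
        by (auto simp: windmills_def mult.commute)
    qed (auto simp: windmills_def mult.commute f)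
    then show ?thesis using W fin by (subst W(1), subst sum.union_disjoint) auto
  qed
  have "sum q ?W = sum (\<lambda>w. - q w) ?W"
    by (rule sum.reindex_bij_witness[where i = "\<lambda>(x, y, z). (- x, y, z)" and j = "\<lambda>(x, y, z). (- x, y, z)"])
      (auto simp: windmills_def q_def)
  then have "sum q ?W = 0" by (simp add: sum_negf)
  moreover have "sum q ?W = 2 * sum q ?R" by (rule half) (auto simp: q_def algebra_simps)
  ultimately have q0: "sum q ?R = 0" by simp
  have "(\<Sum>w\<in>?R. K w + q w) = (\<Sum>w\<in>?R. - (K w + q w))"
  proof (rule sum.reindex_bij_witness[where i = "\<lambda>(x, y, z). (- x - 2 * z, y - x - z, z)"
        and j = "\<lambda>(x, y, z). (- x - 2 * z, y - x - z, z)"])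
    fix a assume a: "a \<in> ?R"
    then obtain x y z where xyz: "a = (x, y, z)" "odd x" "odd y" "odd z" "x < y - z"
        "0 < y" "0 < z" "x\<^sup>2 + 4 * y * z = N" by (auto simp: windmills_def)
    have "(- x - 2 * z)\<^sup>2 + 4 * (y - x - z) * z = N"
      using xyz(8) by (simp add: power2_eq_square algebra_simps)
    then show "(case a of (x, y, z) \<Rightarrow> (- x - 2 * z, y - x - z, z)) \<in> ?R"
      using xyz by (auto simp: windmills_def)
    then show "(case a of (x, y, z) \<Rightarrow> (- x - 2 * z, y - x - z, z)) \<in> ?R" .
    show "- (K (case a of (x, y, z) \<Rightarrow> (- x - 2 * z, y - x - z, z)) +
        q (case a of (x, y, z) \<Rightarrow> (- x - 2 * z, y - x - z, z))) = K a + q a"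
      unfolding xyz(1) K_def q_def by (simp add: power2_eq_square algebra_simps)
  qed auto
  then have "(\<Sum>w\<in>?R. K w + q w) = 0" by (simp only: sum_negf)
  then have "sum K ?R = 0" using q0 by (simp add: sum.distrib)
  moreover have "sum K ?W = 2 * sum K ?R" by (rule half) (auto simp: K_def algebra_simps)
  ultimately have "sum K ?W = 0" by simp
  moreover have "sum K ?W = (\<Sum>(x, y, z)\<in>?W. y * (y * z - x\<^sup>2)) + (\<Sum>(x, y, z)\<in>?W. z * (y * z - x\<^sup>2))"
    unfolding sum.distrib[symmetric] by (rule sum.cong) (auto simp: K_def algebra_simps)
  moreover have "(\<Sum>(x, y, z)\<in>?W. z * (y * z - x\<^sup>2)) = (\<Sum>(x, y, z)\<in>?W. y * (y * z - x\<^sup>2))"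
    by (rule sum.reindex_bij_witness[where i = "\<lambda>(x, y, z). (x, z, y)" and j = "\<lambda>(x, y, z). (x, z, y)"])
      (auto simp: windmills_def mult.commute)
  ultimately show ?thesis by simp
qed

text \<open>If \<open>N / 4\<close> is odd, the first entries run through all its positive divisors.
  The factor 4 is kept so that \<open>N - h^2\<close> fits the windmill equation unchanged.\<close>

definition odd_factorizations :: "int \<Rightarrow> (int \<times> int) set"
  where "odd_factorizations N = {(d, e). odd d \<and> odd e \<and> 0 < d \<and> 0 < e \<and> 4 * d * e = N}"

lemma finite_odd_factorizations [simp]: "finite (odd_factorizations N)"
proof (rule finite_subset)
  show "odd_factorizations N \<subseteq> {0..N} \<times> {0..N}"
  proof
    fix w assume "w \<in> odd_factorizations N"
    then obtain y z where w: "w = (y, z)" "0 < y" "0 < z" "4 * y * z = N"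
      by (auto simp: odd_factorizations_def)
    have "y * 1 \<le> y * z" "1 * z \<le> y * z" using w by (intro mult_mono; auto)+
    then have "y \<le> N" "z \<le> N" using w by linarith+
    then show "w \<in> {0..N} \<times> {0..N}" using w by auto
  qed
qed simp

definition four_odd_squares :: "int \<Rightarrow> (int \<times> int \<times> int \<times> int) set"
  where "four_odd_squares N = {(w, x, y, z). odd w \<and> odd x \<and> odd y \<and> odd z \<and>
    0 < w \<and> 0 < x \<and> 0 < y \<and> 0 < z \<and> w\<^sup>2 + x\<^sup>2 + y\<^sup>2 + z\<^sup>2 = N}"

lemma finite_four_odd_squares [simp]: "finite (four_odd_squares N)"
proof (rule finite_subset)
  show "four_odd_squares N \<subseteq> {0..N} \<times> {0..N} \<times> {0..N} \<times> {0..N}"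
  proof
    fix p assume "p \<in> four_odd_squares N"
    then obtain w x y z where p: "p = (w, x, y, z)" "0 < w" "0 < x" "0 < y" "0 < z" "w\<^sup>2 + x\<^sup>2 + y\<^sup>2 + z\<^sup>2 = N"
      by (auto simp: four_odd_squares_def)
    have "w \<le> w\<^sup>2" "x \<le> x\<^sup>2" "y \<le> y\<^sup>2" "z \<le> z\<^sup>2" by (rule int_le_square)+
    with p show "p \<in> {0..N} \<times> {0..N} \<times> {0..N} \<times> {0..N}" by auto
  qed
qed simp

text \<open>On a quintuple with \<open>h^2 + w^2 + x^2 + y^2 + z^2 = N\<close> the weight
  \<open>N - 5 h^2\<close> is the sum of \<open>w^2 - h^2\<close>, \<open>x^2 - h^2\<close>,
  \<open>y^2 - h^2\<close> and \<open>z^2 - h^2\<close>. Each difference cancels in the total when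
  \<open>h\<close> is exchanged with the other variable.\<close>

lemma four_odd_squares_recursion:
  "(\<Sum>h\<in>odd_below N. (N - 5 * h\<^sup>2) * int (card (four_odd_squares (N - h\<^sup>2)))) = 0"
proof -
  let ?S = "Sigma (odd_below N) (\<lambda>h. four_odd_squares (N - h\<^sup>2))"
  define T where "T = ?S"
  have S: "(h, w, x, y, z) \<in> T \<longleftrightarrow> odd h \<and> odd w \<and> odd x \<and> odd y \<and> odd z \<and> 0 < h \<and>
    0 < w \<and> 0 < x \<and> 0 < y \<and> 0 < z \<and> h\<^sup>2 + w\<^sup>2 + x\<^sup>2 + y\<^sup>2 + z\<^sup>2 = N" for h w x y z
  proof -
    have "h\<^sup>2 + w\<^sup>2 + x\<^sup>2 + y\<^sup>2 + z\<^sup>2 = N \<Longrightarrow> 0 < w \<Longrightarrow> h\<^sup>2 < N"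
      using zero_le_power2[of x] zero_le_power2[of y] zero_le_power2[of z] zero_less_power[of w 2]
      by linarith
    then show ?thesis by (auto simp: T_def odd_below_def four_odd_squares_def)
  qed
  have e1: "(\<Sum>(h, w, x, y, z)\<in>T. w\<^sup>2) = (\<Sum>(h, w, x, y, z)\<in>T. h\<^sup>2)"
    by (rule sum.reindex_bij_witness[where i = "\<lambda>(h, w, x, y, z). (w, h, x, y, z)"
          and j = "\<lambda>(h, w, x, y, z). (w, h, x, y, z)"]) (use S in auto)
  have e2: "(\<Sum>(h, w, x, y, z)\<in>T. x\<^sup>2) = (\<Sum>(h, w, x, y, z)\<in>T. h\<^sup>2)"
    by (rule sum.reindex_bij_witness[where i = "\<lambda>(h, w, x, y, z). (x, w, h, y, z)"
          and j = "\<lambda>(h, w, x, y, z). (x, w, h, y, z)"]) (use S in auto)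
  have e3: "(\<Sum>(h, w, x, y, z)\<in>T. y\<^sup>2) = (\<Sum>(h, w, x, y, z)\<in>T. h\<^sup>2)"
    by (rule sum.reindex_bij_witness[where i = "\<lambda>(h, w, x, y, z). (y, w, x, h, z)"
          and j = "\<lambda>(h, w, x, y, z). (y, w, x, h, z)"]) (use S in auto)
  have e4: "(\<Sum>(h, w, x, y, z)\<in>T. z\<^sup>2) = (\<Sum>(h, w, x, y, z)\<in>T. h\<^sup>2)"
    by (rule sum.reindex_bij_witness[where i = "\<lambda>(h, w, x, y, z). (z, w, x, y, h)"
          and j = "\<lambda>(h, w, x, y, z). (z, w, x, y, h)"]) (use S in auto)
  have "(\<Sum>h\<in>odd_below N. (N - 5 * h\<^sup>2) * int (card (four_odd_squares (N - h\<^sup>2))))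
     = (\<Sum>h\<in>odd_below N. \<Sum>p\<in>four_odd_squares (N - h\<^sup>2). N - 5 * h\<^sup>2)"
    by (simp add: mult.commute)
  also have "\<dots> = (\<Sum>(h, p)\<in>?S. N - 5 * h\<^sup>2)" by (subst sum.Sigma) auto
  also have "\<dots> = (\<Sum>(h, w, x, y, z)\<in>?S. (w\<^sup>2 - h\<^sup>2) + (x\<^sup>2 - h\<^sup>2) + (y\<^sup>2 - h\<^sup>2) + (z\<^sup>2 - h\<^sup>2))"
    by (rule sum.cong) (auto simp: four_odd_squares_def)
  also have "\<dots> = 0"
    using e1 e2 e3 e4 unfolding T_def by (simp add: case_prod_unfold sum.distrib sum_subtractf sum_distrib_left)
  finally show ?thesis .
qed

text \<open>With \<open>x = h\<close>, \<open>y = d\<close>, \<open>z = e\<close> the weight becomes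
  \<open>N - 5 x^2 = 4 (y z - x^2)\<close>, so this is four times the windmill sum restricted to
  \<open>x > 0\<close>. The windmill summand is even in \<open>x\<close>, and an odd
  \<open>x\<close> is never 0, so the restricted sum is half of the full one.\<close>

lemma odd_factorizations_recursion:
  assumes "N mod 8 = 5"
  shows "(\<Sum>h\<in>odd_below N. (N - 5 * h\<^sup>2) * (\<Sum>(d, e)\<in>odd_factorizations (N - h\<^sup>2). d)) = 0"
proof -
  let ?S = "Sigma (odd_below N) (\<lambda>h. odd_factorizations (N - h\<^sup>2))"
  let ?P = "{(x, y, z) \<in> windmills N. 0 < x}" and ?M = "{(x, y, z) \<in> windmills N. \<not> 0 < x}"
  define f where "f = (\<lambda>(x, y, z). y * (y * z - x\<^sup>2) :: int)"
  have fin: "finite ?P" "finite ?M" by (auto intro: finite_subset[OF _ finite_windmills])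
  have S: "?S = ?P"
  proof -
    have "x\<^sup>2 < N" if "x\<^sup>2 + 4 * y * z = N" "0 < y" "0 < z" for x y z
      using that(1) mult_pos_pos[OF that(2,3)] unfolding mult.assoc by linarith
    then show ?thesis
      by (auto simp: odd_below_def odd_factorizations_def windmills_def algebra_simps)
  qed
  have "sum f ?M = sum f ?P"
  proof (rule sum.reindex_bij_witness[where i = "\<lambda>(x, y, z). (- x, y, z)" and j = "\<lambda>(x, y, z). (- x, y, z)"])
    fix a assume "a \<in> ?M"
    then obtain x y z where a: "a = (x, y, z)" "(x, y, z) \<in> windmills N" "\<not> 0 < x" by auto
    then have "x \<noteq> 0" by (auto simp: windmills_def)
    with a show "(case a of (x, y, z) \<Rightarrow> (- x, y, z)) \<in> ?P" by (auto simp: windmills_def)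
  qed (auto simp: windmills_def f_def)
  moreover have "sum f (windmills N) = sum f ?P + sum f ?M"
    using fin by (subst sum.union_disjoint[symmetric]) (auto intro: sum.cong)
  ultimately have zero: "sum f ?P = 0" using sum_windmills[of N] by (simp add: f_def)
  have "(\<Sum>h\<in>odd_below N. (N - 5 * h\<^sup>2) * (\<Sum>(d, e)\<in>odd_factorizations (N - h\<^sup>2). d))
    = (\<Sum>h\<in>odd_below N. \<Sum>(d, e)\<in>odd_factorizations (N - h\<^sup>2). (N - 5 * h\<^sup>2) * d)"
    by (simp add: sum_distrib_left case_prod_unfold)
  also have "\<dots> = (\<Sum>(h, d, e)\<in>?S. (N - 5 * h\<^sup>2) * d)" by (subst sum.Sigma) (auto simp: case_prod_unfold)
  also have "\<dots> = (\<Sum>w\<in>?P. 4 * f w)"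
    unfolding S by (rule sum.cong) (auto simp: windmills_def f_def algebra_simps)
  also have "\<dots> = 0" using zero by (simp add: sum_distrib_left[symmetric])
  finally show ?thesis .
qed

text \<open>Jacobi's formula for four odd squares: both sides satisfy the recursion with weight
  \<open>N - 5 h^2\<close>, which has only one solution once the value at 4 is fixed.\<close>

lemma card_four_odd_squares:
  assumes "0 < M" "M mod 8 = 4"
  shows "int (card (four_odd_squares M)) = (\<Sum>(d, e)\<in>odd_factorizations M. d)"
proof -
  let ?d = "\<lambda>M. int (card (four_odd_squares M)) - (\<Sum>(d, e)\<in>odd_factorizations M. d)"
  have "?d M = 0"
  proof (rule odd_square_recursion_unique[where w = "\<lambda>N h. N - 5 * h\<^sup>2" and r = 4 and d = ?d])
    fix N :: int assume N: "N mod 8 = (4 + 1) mod 8" "1 < N"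
    then show "(\<Sum>h\<in>odd_below N. (N - 5 * h\<^sup>2) * ?d (N - h\<^sup>2)) = 0"
      using four_odd_squares_recursion[of N] odd_factorizations_recursion[of N]
      by (simp add: right_diff_distrib sum_subtractf)
    \<comment> \<open>At \<open>N = 5\<close> the weight \<open>N - 5 h^2\<close> vanishes for
      \<open>h = 1\<close>, so the recursion says nothing about the argument 4. There both sides are
      1.\<close>
    have "four_odd_squares 4 = {(1, 1, 1, 1)}"
    proof -
      have "w = 1 \<and> x = 1 \<and> y = 1 \<and> z = 1"
        if "w\<^sup>2 + x\<^sup>2 + y\<^sup>2 + z\<^sup>2 = 4" "0 < w" "0 < x" "0 < y" "0 < z" for w x y z :: int
        using that int_le_square[of w] int_le_square[of x] int_le_square[of y] int_le_square[of z] by linarith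
      then show ?thesis by (force simp: four_odd_squares_def)
    qed
    moreover have "odd_factorizations 4 = {(1, 1)}"
      by (auto simp: odd_factorizations_def zmult_eq_1_iff)
    ultimately have "?d 4 = 0" by simp
    then show "N - 5 * 1\<^sup>2 \<noteq> 0 \<or> ?d (N - 1) = 0" by (cases "N = 5") auto
  qed (use assms in auto)
  then show ?thesis by simp
qed

text \<open>For odd \<open>x, y, z, h\<close> the substitution \<open>2 A = x + y\<close>, \<open>2 C = y + z\<close>, \<open>2 u = h + y\<close>,
  \<open>2 v = h - y\<close> turns \<open>h\<^sup>2 + x y + y z + z x = 4 m\<close> into \<open>A C + u v = m\<close>.\<close>

definition quads1 :: "int \<Rightarrow> (int \<times> int \<times> int \<times> int) set"
  where "quads1 m = {(A, C, u, v). odd A \<and> odd C \<and> odd u \<and> even v \<and>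
    0 < A \<and> 0 < C \<and> 0 < u \<and> 0 < v \<and> A * C + u * v = m}"

definition quads2 :: "int \<Rightarrow> (int \<times> int \<times> int \<times> int) set"
  where "quads2 m = {(A, C, u, v). odd A \<and> odd C \<and> even u \<and> even v \<and>
    0 < A \<and> 0 < C \<and> 0 < u \<and> 0 < v \<and> A * C + u * v = m}"

section \<open>Linear relations between counts of solutions of \<open>A C + u v = m\<close>\<close>

definition n1 :: "int \<Rightarrow> (int \<Rightarrow> int \<Rightarrow> int \<Rightarrow> int \<Rightarrow> bool) \<Rightarrow> int"
  where "n1 m P = int (card {(A, C, u, v) \<in> quads1 m. P A C u v})"

definition n2 :: "int \<Rightarrow> (int \<Rightarrow> int \<Rightarrow> int \<Rightarrow> int \<Rightarrow> bool) \<Rightarrow> int"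
  where "n2 m P = int (card {(A, C, u, v) \<in> quads2 m. P A C u v})"

lemma quads_bounded:
  assumes "A * C + u * v = m" "0 < A" "0 < C" "0 < u" "0 < (v::int)"
  shows "A \<le> m \<and> C \<le> m \<and> u \<le> m \<and> v \<le> m"
proof -
  have "A * 1 \<le> A * C" "1 * C \<le> A * C" "u * 1 \<le> u * v" "1 * v \<le> u * v"
    using assms by (intro mult_mono; simp)+
  moreover have "0 < A * C" "0 < u * v" using assms by simp_all
  ultimately show ?thesis using assms by linarith
qed

lemma finite_quads1 [simp]: "finite (quads1 m)"
proof (rule finite_subset)
  show "quads1 m \<subseteq> {0..m} \<times> {0..m} \<times> {0..m} \<times> {0..m}"
    using quads_bounded[of _ _ _ _ m] unfolding quads1_def by fastforce
qed simp

lemma finite_quads2 [simp]: "finite (quads2 m)"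
proof (rule finite_subset)
  show "quads2 m \<subseteq> {0..m} \<times> {0..m} \<times> {0..m} \<times> {0..m}"
    using quads_bounded[of _ _ _ _ m] unfolding quads2_def by fastforce
qed simp

lemma finite_quads1' [simp]: "finite {(A, C, u, v). (A, C, u, v) \<in> quads1 m \<and> P A C u v}"
  by (rule finite_subset[OF _ finite_quads1]) auto

lemma finite_quads2' [simp]: "finite {(A, C, u, v). (A, C, u, v) \<in> quads2 m \<and> P A C u v}"
  by (rule finite_subset[OF _ finite_quads2]) auto

lemma n1_cong:
  assumes "\<And>A C u v. odd A \<Longrightarrow> odd C \<Longrightarrow> odd u \<Longrightarrow> even v \<Longrightarrow> 0 < A \<Longrightarrow> 0 < C \<Longrightarrow> 0 < u \<Longrightarrow> 0 < v \<Longrightarrow>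
    P A C u v \<longleftrightarrow> Q A C u v"
  shows "n1 m P = n1 m Q"
proof -
  have "{(A, C, u, v) \<in> quads1 m. P A C u v} = {(A, C, u, v) \<in> quads1 m. Q A C u v}"
    using assms by (auto simp: quads1_def)
  then show ?thesis by (simp add: n1_def)
qed

text \<open>Substituting \<open>2 a + 1\<close> and \<open>2 l\<close> makes parity visible to
  linear arithmetic: quantities of different parity, such as \<open>v\<close> and \<open>A\<close>,
  never tie, so splitting by a comparison leaves only the two strict cases.\<close>

lemma n1_split:
  assumes "\<And>a c k l. 0 \<le> a \<Longrightarrow> 0 \<le> c \<Longrightarrow> 0 \<le> k \<Longrightarrow> 0 < l \<Longrightarrow>
    (P (2 * a + 1) (2 * c + 1) (2 * k + 1) (2 * l) \<longleftrightarrow>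
      Q (2 * a + 1) (2 * c + 1) (2 * k + 1) (2 * l) \<or> R (2 * a + 1) (2 * c + 1) (2 * k + 1) (2 * l)) \<and>
    \<not> (Q (2 * a + 1) (2 * c + 1) (2 * k + 1) (2 * l) \<and> R (2 * a + 1) (2 * c + 1) (2 * k + 1) (2 * l))"
  shows "n1 m P = n1 m Q + n1 m R"
proof -
  have *: "(P A C u v \<longleftrightarrow> Q A C u v \<or> R A C u v) \<and> \<not> (Q A C u v \<and> R A C u v)"
    if "(A, C, u, v) \<in> quads1 m" for A C u v
  proof -
    from that obtain a c k l where "A = 2 * a + 1" "C = 2 * c + 1" "u = 2 * k + 1" "v = 2 * l"
      and "0 < A" "0 < C" "0 < u" "0 < v"
      by (auto simp: quads1_def elim!: oddE evenE)
    then show ?thesis using assms[of a c k l] by auto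
  qed
  have "{(A, C, u, v) \<in> quads1 m. P A C u v} =
      {(A, C, u, v) \<in> quads1 m. Q A C u v} \<union> {(A, C, u, v) \<in> quads1 m. R A C u v}"
    "{(A, C, u, v) \<in> quads1 m. Q A C u v} \<inter> {(A, C, u, v) \<in> quads1 m. R A C u v} = {}"
    using * by blast+
  then show ?thesis by (simp add: n1_def card_Un_disjoint)
qed

lemma n1_empty:
  assumes "\<And>A C u v. odd A \<Longrightarrow> odd C \<Longrightarrow> odd u \<Longrightarrow> even v \<Longrightarrow> 0 < A \<Longrightarrow> 0 < C \<Longrightarrow> 0 < u \<Longrightarrow> 0 < v \<Longrightarrow>
    \<not> P A C u v"
  shows "n1 m P = 0"
proof -
  have "{(A, C, u, v) \<in> quads1 m. P A C u v} = {}"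
    using assms by (auto simp: quads1_def)
  then show ?thesis unfolding n1_def by (simp only: card.empty of_nat_0)
qed

lemma n1_swap: "n1 m P = n1 m (\<lambda>A C. P C A)"
  unfolding n1_def of_nat_eq_iff
  by (rule bij_betw_same_card[OF bij_betw_byWitness[where f' = "\<lambda>(A, C, u, v). (C, A, u, v)"
        and f = "\<lambda>(A, C, u, v). (C, A, u, v)"]]) (auto simp: quads1_def mult.commute)

lemma n2_swap1: "n2 m P = n2 m (\<lambda>A C. P C A)"
  unfolding n2_def of_nat_eq_iff
  by (rule bij_betw_same_card[OF bij_betw_byWitness[where f' = "\<lambda>(A, C, u, v). (C, A, u, v)"
        and f = "\<lambda>(A, C, u, v). (C, A, u, v)"]]) (auto simp: quads2_def mult.commute)

lemma n2_swap2: "n2 m P = n2 m (\<lambda>A C u v. P A C v u)"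
  unfolding n2_def of_nat_eq_iff
  by (rule bij_betw_same_card[OF bij_betw_byWitness[where f' = "\<lambda>(A, C, u, v). (A, C, v, u)"
        and f = "\<lambda>(A, C, u, v). (A, C, v, u)"]]) (auto simp: quads2_def mult.commute)

text \<open>\<open>u (v - A) + A (C + u) = A C + u v\<close>, and
  \<open>(A, C, u, v) \<mapsto> (u, v - A, A, C + u)\<close> is an involution of the solutions with
  \<open>A < v\<close> that keeps all parities.\<close>

lemma n1_flip:
  "n1 m (\<lambda>A C u v. A < v \<and> P A C u v) = n1 m (\<lambda>A C u v. A < v \<and> P u (v - A) A (C + u))"
  unfolding n1_def of_nat_eq_iff
  by (rule bij_betw_same_card[OF bij_betw_byWitness[where f' = "\<lambda>(A, C, u, v). (u, v - A, A, C + u)"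
        and f = "\<lambda>(A, C, u, v). (u, v - A, A, C + u)"]]) (auto simp: quads1_def algebra_simps)

text \<open>As \<open>C\<close> is odd and \<open>v\<close> even, one of them is strictly larger.
  Subtracting the smaller one, as in Euclid's algorithm, keeps the value, since
  \<open>(A + u) C + (v - C) u\<close> and \<open>A (C - v) + (u + A) v\<close> both equal
  \<open>A C + u v\<close>, and it makes the third entry odd. So each solution with \<open>u\<close>
  and \<open>v\<close> even corresponds to one with a single even entry.\<close>

lemma n2_shift: "n2 m P = n1 m (\<lambda>A C u v. v < A \<and> P (A - v) C v (u + C)) +
    n1 m (\<lambda>A C u v. A < u \<and> P A (C + v) (u - A) v)"
proof -
  have "{(A, C, u, v) \<in> quads2 m. P A C u v} = {(A, C, u, v) \<in> quads2 m. P A C u v \<and> C < v} \<union>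
      {(A, C, u, v) \<in> quads2 m. P A C u v \<and> v < C}"
    by (auto simp: quads2_def) (metis linorder_neqE_linordered_idom)
  then have "card {(A, C, u, v) \<in> quads2 m. P A C u v} = card {(A, C, u, v) \<in> quads2 m. P A C u v \<and> C < v} +
      card {(A, C, u, v) \<in> quads2 m. P A C u v \<and> v < C}"
    by (simp only:) (rule card_Un_disjoint, auto)
  moreover have "card {(A, C, u, v) \<in> quads2 m. P A C u v \<and> C < v} =
      card {(A, C, u, v) \<in> quads1 m. v < A \<and> P (A - v) C v (u + C)}"
    by (rule bij_betw_same_card[OF bij_betw_byWitness[where f' = "\<lambda>(A, C, u, v). (A - v, C, v, u + C)"
        and f = "\<lambda>(A, C, u, v). (A + u, C, v - C, u)"]]) (auto simp: quads1_def quads2_def algebra_simps)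
  moreover have "card {(A, C, u, v) \<in> quads2 m. P A C u v \<and> v < C} =
      card {(A, C, u, v) \<in> quads1 m. A < u \<and> P A (C + v) (u - A) v}"
    by (rule bij_betw_same_card[OF bij_betw_byWitness[where f' = "\<lambda>(A, C, u, v). (A, C + v, u - A, v)"
        and f = "\<lambda>(A, C, u, v). (A, C - v, u + A, v)"]]) (auto simp: quads1_def quads2_def algebra_simps)
  ultimately show ?thesis by (simp add: n1_def n2_def)
qed

text \<open>The left side will count the quadruples with \<open>h \<noteq> y\<close>, the right side
  is easily evaluated. The predicates do not match under any one bijection; instead all counts are
  expressed by a few basic ones, related by the flip, the shift and parity splits, and the identity
  follows by elimination.\<close>

lemma count_reduced_quads:
  "n1 m (\<lambda>A C u v. \<bar>u - v\<bar> < 2 * A \<and> \<bar>u - v\<bar> < 2 * C) + n1 m (\<lambda>A C u v. \<bar>A - C\<bar> < u \<and> u < A + C + v) +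
    n2 m (\<lambda>A C u v. \<bar>u - v\<bar> < A \<and> (A < u \<or> A < v)) = 2 * n1 m (\<lambda>A C u v. u = A \<and> A < v)"
proof -
  define T where "T = n1 m (\<lambda>A C u v. True)"
  define a where "a = n1 m (\<lambda>A C u v. v < A \<and> v < u)"
  define p where "p = n1 m (\<lambda>A C u v. A < u \<and> u < v)"
  define L where "L = n1 m (\<lambda>A C u v. C + u < A)"
  define x where "x = n1 m (\<lambda>A C u v. C + u < A \<and> A < v)"
  define y where "y = n1 m (\<lambda>A C u v. C + u < A \<and> C < v \<and> v < A)"
  define z where "z = n1 m (\<lambda>A C u v. C + u < A \<and> v < C)"
  define g where "g = n1 m (\<lambda>A C u v. v < A \<and> A + C + u < 2 * v)"
  define st where "st = n1 m (\<lambda>A C u v. v < A \<and> A < C + u)"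
  define S where "S = n1 m (\<lambda>A C u v. u < v \<and> v < A)"
  define U2 where "U2 = n1 m (\<lambda>A C u v. v + 2 * A < u)"
  define V2 where "V2 = n1 m (\<lambda>A C u v. u + 2 * A < v)"
  define UU where "UU = n1 m (\<lambda>A C u v. v + 2 * A < u \<and> v + 2 * C < u)"
  define VV where "VV = n1 m (\<lambda>A C u v. u + 2 * A < v \<and> u + 2 * C < v)"
  define H where "H = n1 m (\<lambda>A C u v. A + C + v < u)"
  define H2 where "H2 = n1 m (\<lambda>A C u v. A + C + 2 * v < u)"
  define E2 where "E2 = n1 m (\<lambda>A C u v. v < A \<and> u + 2 * C < v)"
  define Ev where "Ev = n1 m (\<lambda>A C u v. A < v)"
  define Eu where "Eu = n1 m (\<lambda>A C u v. A < v \<and> A < u)"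

  have lin1: "j = t - 2 * w + r" if "c = w" "b = r" "t = d + e" "e = j + f" "c = b + f" "d = w"
    for j t w r c b d e f :: int using that by simp
  have lin2: "j = t - 2 * l - h" if "t = d + e" "e = l + f" "f = l" "d = j + h"
    for j t l h d e f :: int using that by simp
  \<comment> \<open>In the application \<open>q\<close> is the \<open>n2\<close>-count of
    \<open>u + A < v\<close>, \<open>e\<close> the count of the diagonal \<open>u = A\<close>,
    \<open>A < v\<close>, and \<open>r\<close> the count of
    \<open>v + 2 A < u < v + 2 C\<close>.\<close>
  have lin3: "T - 2 * (U2 + V2) + (UU + VV) + (T - 2 * L - H) + (S - E2 + (H - H2)) = 2 * e"
    if "q = st + p" "q = g + U2" "q = a" "q = E2 + H2" "Ev = 2 * Eu + e" "V2 = x + y" "VV = y - g"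
      "Eu = p + x" "r = p + z" "U2 = UU + r" "L = x + (y + z)" "S + a = T - Ev" "S + a = st + (y + z)"
    for q e r :: int
    using that by smt

  have J2: "n2 m (\<lambda>A C u v. \<bar>u - v\<bar> < A \<and> (A < u \<or> A < v)) = (S - E2) + (H - H2)"
  proof -
    have "n2 m (\<lambda>A C u v. \<bar>u - v\<bar> < A \<and> (A < u \<or> A < v)) =
        n1 m (\<lambda>A C u v. v < A \<and> (\<bar>v - (u + C)\<bar> < C \<and> (C < v \<or> C < u + C))) +
        n1 m (\<lambda>A C u v. A < u \<and> (\<bar>u - A - v\<bar> < C + v \<and> (C + v < u - A \<or> C + v < v)))"
      by (subst n2_swap1) (rule n2_shift)
    also have "n1 m (\<lambda>A C u v. v < A \<and> (\<bar>v - (u + C)\<bar> < C \<and> (C < v \<or> C < u + C))) =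
        n1 m (\<lambda>A C u v. u < v \<and> v < A \<and> v < u + 2 * C)"
      by (rule n1_cong) auto
    also have "n1 m (\<lambda>A C u v. A < u \<and> (\<bar>u - A - v\<bar> < C + v \<and> (C + v < u - A \<or> C + v < v))) =
        n1 m (\<lambda>A C u v. A + C + v < u \<and> u < A + C + 2 * v)"
      by (rule n1_cong) auto
    also have "S = n1 m (\<lambda>A C u v. u < v \<and> v < A \<and> v < u + 2 * C) + E2"
      unfolding S_def E2_def by (rule n1_split) smt
    then have "n1 m (\<lambda>A C u v. u < v \<and> v < A \<and> v < u + 2 * C) = S - E2" by simp
    also have "H = n1 m (\<lambda>A C u v. A + C + v < u \<and> u < A + C + 2 * v) + H2"
      unfolding H_def H2_def by (rule n1_split) smt
    then have "n1 m (\<lambda>A C u v. A + C + v < u \<and> u < A + C + 2 * v) = H - H2" by simp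
    finally show ?thesis .
  qed
  \<comment> \<open>\<open>q1\<close> to \<open>q4\<close> evaluate one and the same count in four
    ways: the shift is applied directly, after exchanging \<open>u\<close> with \<open>v\<close>,
    after exchanging \<open>A\<close> with \<open>C\<close>, and after both exchanges.\<close>
  have q1: "n2 m (\<lambda>A C u v. u + A < v) = st + p"
    unfolding n2_shift st_def p_def by (intro arg_cong2[where f = plus] n1_cong) auto
  have q2: "n2 m (\<lambda>A C u v. u + A < v) = g + U2"
    unfolding n2_swap2[of m "\<lambda>A C u v. u + A < v"] unfolding n2_shift g_def U2_def
    by (intro arg_cong2[where f = plus] n1_cong) auto
  have q3: "n2 m (\<lambda>A C u v. u + A < v) = a"
  proof -
    have "n2 m (\<lambda>A C u v. u + A < v) = a + n1 m (\<lambda>A C u v. A < u \<and> u - A + (C + v) < v)"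
      unfolding n2_swap1[of m "\<lambda>A C u v. u + A < v"] unfolding n2_shift a_def
      by (intro arg_cong2[where f = plus] n1_cong) auto
    also have "n1 m (\<lambda>A C u v. A < u \<and> u - A + (C + v) < v) = 0" by (rule n1_empty) auto
    finally show ?thesis by simp
  qed
  have q4: "n2 m (\<lambda>A C u v. u + A < v) = E2 + H2"
    unfolding n2_swap1[of m "\<lambda>A C u v. u + A < v"] unfolding n2_swap2[of m "\<lambda>A C u v. u + C < v"] unfolding n2_shift E2_def H2_def
    by (intro arg_cong2[where f = plus] n1_cong) auto
  \<comment> \<open>Under \<open>A < v\<close> the flip exchanges \<open>A\<close> and
    \<open>u\<close>, so \<open>u < A\<close> and \<open>A < u\<close> are equally frequent and only
    the diagonal \<open>u = A\<close> is left over.\<close>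
  have i1: "Ev = 2 * Eu + n1 m (\<lambda>A C u v. u = A \<and> A < v)"
  proof -
    have "n1 m (\<lambda>A C u v. A < v \<and> u < A) = n1 m (\<lambda>A C u v. A < v \<and> A < u)"
      by (rule n1_flip)
    moreover have "Ev = Eu + n1 m (\<lambda>A C u v. A < v \<and> \<not> A < u)"
      unfolding Ev_def Eu_def by (rule n1_split) auto
    moreover have "n1 m (\<lambda>A C u v. A < v \<and> \<not> A < u) =
        n1 m (\<lambda>A C u v. A < v \<and> u < A) + n1 m (\<lambda>A C u v. u = A \<and> A < v)"
      by (rule n1_split) auto
    ultimately show ?thesis by (simp add: Eu_def)
  qed
  have i2: "V2 = x + y"
  proof -
    have "V2 = n1 m (\<lambda>A C u v. A < v \<and> u + 2 * A < v)" unfolding V2_def by (rule n1_cong) auto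
    also have "\<dots> = n1 m (\<lambda>A C u v. A < v \<and> A + 2 * u < C + u)" by (rule n1_flip)
    also have "\<dots> = n1 m (\<lambda>A C u v. C < v \<and> C + 2 * u < A + u)" by (rule n1_swap)
    also have "\<dots> = x + y" unfolding x_def y_def by (rule n1_split) smt
    finally show ?thesis .
  qed
  have i3: "VV = y - g"
  proof -
    have "VV = n1 m (\<lambda>A C u v. A < v \<and> (u + 2 * A < v \<and> u + 2 * C < v))"
      unfolding VV_def by (rule n1_cong) auto
    also have "\<dots> = n1 m (\<lambda>A C u v. A < v \<and> (A + 2 * u < C + u \<and> A + 2 * (v - A) < C + u))"
      by (rule n1_flip)
    also have "\<dots> = n1 m (\<lambda>A C u v. C < v \<and> (C + 2 * u < A + u \<and> C + 2 * (v - C) < A + u))"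
      by (rule n1_swap)
    finally have "y = VV + g"
      unfolding y_def g_def by (simp only:) (rule n1_split, smt)
    then show ?thesis by simp
  qed
  have i4: "Eu = p + x"
  proof -
    have "Eu = p + n1 m (\<lambda>A C u v. A < v \<and> (A < u \<and> v < u))"
      unfolding Eu_def p_def by (rule n1_split) smt
    also have "n1 m (\<lambda>A C u v. A < v \<and> (A < u \<and> v < u)) = n1 m (\<lambda>A C u v. A < v \<and> (u < A \<and> C + u < A))"
      by (rule n1_flip)
    also have "\<dots> = x" unfolding x_def by (rule n1_cong) auto
    finally show ?thesis .
  qed
  \<comment> \<open>The range of \<open>u\<close> is split at the even number
    \<open>A + C + v\<close>, which the odd \<open>u\<close> cannot equal. Both pieces arise from
    \<open>p\<close> and \<open>z\<close> by passing to \<open>quads2\<close>, exchanging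
    \<open>u\<close> with \<open>v\<close> there and returning; in each passage one branch of the
    shift is empty.\<close>
  have z1: "n1 m (\<lambda>A C u v. v + 2 * A < u \<and> u < v + 2 * C) = p + z"
  proof -
    have "n2 m (\<lambda>A C u v. v < A + u \<and> C < v \<and> u < C) = z + n1 m (\<lambda>A C u v. A < u \<and> v < A + (u - A) \<and> C + v < v \<and> u - A < C + v)"
      unfolding n2_shift z_def by (intro arg_cong2[where f = plus] n1_cong) auto
    also have "n1 m (\<lambda>A C u v. A < u \<and> v < A + (u - A) \<and> C + v < v \<and> u - A < C + v) = 0"
      by (rule n1_empty) auto
    finally have "z = n2 m (\<lambda>A C u v. u < A + v \<and> C < u \<and> v < C)"
      unfolding n2_swap2[of m "\<lambda>A C u v. v < A + u \<and> C < v \<and> u < C"] by simp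
    also have "\<dots> = n1 m (\<lambda>A C u v. v < A \<and> v < A - v + (u + C) \<and> C < v \<and> u + C < C)
        + n1 m (\<lambda>A C u v. A + C + v < u \<and> u < v + 2 * A)"
      unfolding n2_shift by (intro arg_cong2[where f = plus] n1_cong) auto
    also have "n1 m (\<lambda>A C u v. v < A \<and> v < A - v + (u + C) \<and> C < v \<and> u + C < C) = 0"
      by (rule n1_empty) auto
    finally have z: "z = n1 m (\<lambda>A C u v. C + A + v < u \<and> u < v + 2 * C)"
      by (simp add: n1_swap[of m "\<lambda>A C u v. A + C + v < u \<and> u < v + 2 * A"])
    have "n2 m (\<lambda>A C u v. u + A < v \<and> v < C) =
        n1 m (\<lambda>A C u v. v < A \<and> v + (A - v) < u + C \<and> u + C < C) + p"
      unfolding n2_shift p_def by (intro arg_cong2[where f = plus] n1_cong) auto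
    also have "n1 m (\<lambda>A C u v. v < A \<and> v + (A - v) < u + C \<and> u + C < C) = 0"
      by (rule n1_empty) auto
    finally have "p = n2 m (\<lambda>A C u v. v + A < u \<and> u < C)"
      unfolding n2_swap2[of m "\<lambda>A C u v. u + A < v \<and> v < C"] by simp
    also have "\<dots> = n1 m (\<lambda>A C u v. v < A \<and> u + C + (A - v) < v \<and> v < C) +
        n1 m (\<lambda>A C u v. v + 2 * A < u \<and> u < A + C + v)"
      unfolding n2_shift by (intro arg_cong2[where f = plus] n1_cong) auto
    also have "n1 m (\<lambda>A C u v. v < A \<and> u + C + (A - v) < v \<and> v < C) = 0"
      by (rule n1_empty) auto
    finally have p: "p = n1 m (\<lambda>A C u v. v + 2 * A < u \<and> u < A + C + v)" by simp
    show ?thesis unfolding p z by (rule n1_split) smt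
  qed
  have z2: "U2 = UU + n1 m (\<lambda>A C u v. v + 2 * A < u \<and> u < v + 2 * C)"
    unfolding U2_def UU_def by (rule n1_split) smt
  have s1: "n1 m (\<lambda>A C u v. \<bar>u - v\<bar> < 2 * A \<and> \<bar>u - v\<bar> < 2 * C) = T - 2 * (U2 + V2) + (UU + VV)"
  proof -
    have W: "n1 m (\<lambda>A C u v. 2 * A < \<bar>u - v\<bar>) = U2 + V2"
      unfolding U2_def V2_def by (rule n1_split) smt
    have "n1 m (\<lambda>A C u v. 2 * C < \<bar>u - v\<bar>) = U2 + V2"
      unfolding W[symmetric] by (rule n1_swap)
    moreover have "n1 m (\<lambda>A C u v. 2 * A < \<bar>u - v\<bar> \<and> 2 * C < \<bar>u - v\<bar>) = UU + VV"
      unfolding UU_def VV_def by (rule n1_split) smt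
    moreover have "T = n1 m (\<lambda>A C u v. 2 * A < \<bar>u - v\<bar>) + n1 m (\<lambda>A C u v. \<bar>u - v\<bar> < 2 * A)"
      unfolding T_def by (rule n1_split) smt
    moreover have "n1 m (\<lambda>A C u v. \<bar>u - v\<bar> < 2 * A) = n1 m (\<lambda>A C u v. \<bar>u - v\<bar> < 2 * A \<and> \<bar>u - v\<bar> < 2 * C)
        + n1 m (\<lambda>A C u v. \<bar>u - v\<bar> < 2 * A \<and> 2 * C < \<bar>u - v\<bar>)"
      by (rule n1_split) smt
    moreover have "n1 m (\<lambda>A C u v. 2 * C < \<bar>u - v\<bar>) = n1 m (\<lambda>A C u v. 2 * A < \<bar>u - v\<bar> \<and> 2 * C < \<bar>u - v\<bar>)
        + n1 m (\<lambda>A C u v. \<bar>u - v\<bar> < 2 * A \<and> 2 * C < \<bar>u - v\<bar>)"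
      by (rule n1_split) smt
    ultimately show ?thesis using W by (intro lin1)
  qed
  have s2: "n1 m (\<lambda>A C u v. \<bar>A - C\<bar> < u \<and> u < A + C + v) = T - 2 * L - H"
  proof -
    have "T = n1 m (\<lambda>A C u v. \<bar>A - C\<bar> < u) + n1 m (\<lambda>A C u v. u < \<bar>A - C\<bar>)"
      unfolding T_def by (rule n1_split) smt
    moreover have "n1 m (\<lambda>A C u v. u < \<bar>A - C\<bar>) = L + n1 m (\<lambda>A C u v. A + u < C)"
      unfolding L_def by (rule n1_split) smt
    moreover have "n1 m (\<lambda>A C u v. A + u < C) = L" unfolding L_def by (rule n1_swap)
    moreover have "n1 m (\<lambda>A C u v. \<bar>A - C\<bar> < u) = n1 m (\<lambda>A C u v. \<bar>A - C\<bar> < u \<and> u < A + C + v) + H"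
      unfolding H_def by (rule n1_split) smt
    ultimately show ?thesis by (intro lin2)
  qed
  have s3: "L = x + (y + z)"
  proof -
    have "L = x + n1 m (\<lambda>A C u v. C + u < A \<and> v < A)" unfolding L_def x_def by (rule n1_split) smt
    also have "n1 m (\<lambda>A C u v. C + u < A \<and> v < A) = y + z" unfolding y_def z_def by (rule n1_split) smt
    finally show ?thesis .
  qed
  have s4: "S + a = T - Ev"
  proof -
    have "T = Ev + n1 m (\<lambda>A C u v. v < A)" unfolding T_def Ev_def by (rule n1_split) smt
    moreover have "n1 m (\<lambda>A C u v. v < A) = S + a" unfolding S_def a_def by (rule n1_split) smt
    ultimately show ?thesis by simp
  qed
  have s5: "S + a = st + (y + z)"
  proof -
    have "S + a = n1 m (\<lambda>A C u v. v < A)" unfolding S_def a_def by (rule n1_split[symmetric]) smt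
    also have "\<dots> = st + n1 m (\<lambda>A C u v. C + u < A \<and> v < A)" unfolding st_def by (rule n1_split) smt
    also have "n1 m (\<lambda>A C u v. C + u < A \<and> v < A) = y + z" unfolding y_def z_def by (rule n1_split) smt
    finally show ?thesis .
  qed
  show ?thesis
    unfolding J2 s1 s2 using q1 q2 q3 q4 i1 i2 i3 i4 z1 z2 s3 s4 s5 by (rule lin3)
qed

section \<open>Quadruples of odd numbers with \<open>h^2 + x y + y z + z x = 4 m\<close>\<close>

definition odd_quads :: "int \<Rightarrow> (int \<times> int \<times> int \<times> int) set"
  where "odd_quads N = {(h, x, y, z). odd h \<and> odd x \<and> odd y \<and> odd z \<and>
    0 < h \<and> 0 < x \<and> 0 < y \<and> 0 < z \<and> h\<^sup>2 + (x * y + y * z + z * x) = N}"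

lemma finite_odd_quads [simp]: "finite (odd_quads N)"
proof (rule finite_subset)
  show "odd_quads N \<subseteq> {0..N} \<times> {0..N} \<times> {0..N} \<times> {0..N}"
  proof
    fix p assume "p \<in> odd_quads N"
    then obtain h x y z where p: "p = (h, x, y, z)" "0 < h" "0 < x" "0 < y" "0 < z"
      "h\<^sup>2 + (x * y + y * z + z * x) = N"
      by (auto simp: odd_quads_def)
    have "x * 1 \<le> x * y" "1 * y \<le> x * y" "1 * z \<le> y * z" using p by (intro mult_mono; simp)+
    moreover have "0 < x * y" "0 < y * z" "0 < z * x" using p by simp_all
    moreover have "h \<le> h\<^sup>2" "0 \<le> h\<^sup>2" by (simp_all add: int_le_square)
    ultimately have "h \<le> N" "x \<le> N" "y \<le> N" "z \<le> N" using p by linarith+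
    then show "p \<in> {0..N} \<times> {0..N} \<times> {0..N} \<times> {0..N}" using p by auto
  qed
qed simp

text \<open>For \<open>x = 2 a + 1\<close>, \<open>y = 2 b + 1\<close>, \<open>z = 2 c + 1\<close>
  the equation divided by 4 and reduced modulo 2 says that
  \<open>a b + b c + c a + a + b + c\<close> is even. This forces \<open>a\<close>,
  \<open>b\<close>, \<open>c\<close> to have equal parity, that is, \<open>x\<close>,
  \<open>y\<close>, \<open>z\<close> agree modulo 4.\<close>

lemma odd_quads_halves:
  assumes "odd h" "odd x" "odd y" "odd z" "h\<^sup>2 + (x * y + y * z + z * x) = 4 * (m::int)" "odd m"
  obtains A C B where "x + y = 2 * A" "y + z = 2 * C" "x + z = 2 * B" "odd A" "odd C" "odd B"
proof -
  obtain a b c k where abc: "x = 2 * a + 1" "y = 2 * b + 1" "z = 2 * c + 1" "h = 2 * k + 1"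
    using assms by (elim oddE) blast
  have "even (k * (k + 1))" by simp
  then obtain l where "k * (k + 1) = 2 * l" by (elim evenE)
  then have l: "k * k + k = 2 * l" by (simp add: algebra_simps)
  have "2 * l + (a * b + b * c + c * a) + (a + b + c) + 1 = m"
    using assms(5) unfolding abc l[symmetric] by (simp add: power2_eq_square algebra_simps)
  then have "even (a * b + b * c + c * a + (a + b + c))" using assms(6) by auto
  then have "even (a + b)" "even (b + c)" "even (a + c)" by auto
  then show thesis
    by (intro that[of "a + b + 1" "b + c + 1" "a + c + 1"]) (auto simp: abc)
qed

text \<open>\<open>u\<close> and \<open>v\<close> are the halves \<open>(h + y) / 2\<close> and
  \<open>(h - y) / 2\<close> in some order. As \<open>m\<close> and \<open>A C\<close> are odd,
  \<open>u v\<close> is even while \<open>u + v = h\<close> is odd, so exactly one half is odd.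
  Calling that one \<open>u\<close> makes the parametrization bijective and is the reason for the
  absolute values.\<close>

lemma card_odd_quads_less:
  assumes "odd m"
  shows "int (card {(h, x, y, z) \<in> odd_quads (4 * m). y < h}) =
    n1 m (\<lambda>A C u v. \<bar>u - v\<bar> < 2 * A \<and> \<bar>u - v\<bar> < 2 * C)" (is "int (card ?S) = _")
proof -
  let ?T = "{(A, C, u, v) \<in> quads1 m. \<bar>u - v\<bar> < 2 * A \<and> \<bar>u - v\<bar> < 2 * C}"
  define g where "g = (\<lambda>(A, C, u, v). (u + v, 2 * A - \<bar>u - v\<bar>, \<bar>u - v\<bar>, 2 * C - \<bar>u - v\<bar>) :: int \<times> int \<times> int \<times> int)"
  have inj: "inj_on g ?T"
  proof (rule inj_onI)
    fix p q assume pq: "p \<in> ?T" "q \<in> ?T" "g p = g q"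
    obtain A C u v where p: "p = (A, C, u, v)" "odd u" "even v" using pq by (auto simp: quads1_def)
    obtain A' C' u' v' where q: "q = (A', C', u', v')" "odd u'" "even v'" using pq by (auto simp: quads1_def)
    have e: "u + v = u' + v'" "\<bar>u - v\<bar> = \<bar>u' - v'\<bar>" "A = A'" "C = C'"
      using pq(3) by (auto simp: p q g_def)
    then have "u = u' \<or> u = v'" by linarith
    then have "u = u'" using p q by auto
    with e show "p = q" by (simp add: p q)
  qed
  have img: "g ` ?T = ?S"
  proof (intro equalityI subsetI)
    fix p assume "p \<in> g ` ?T"
    then obtain A C u v where p: "p = (u + v, 2 * A - \<bar>u - v\<bar>, \<bar>u - v\<bar>, 2 * C - \<bar>u - v\<bar>)"
      and q: "odd A" "odd C" "odd u" "even v" "0 < A" "0 < C" "0 < u" "0 < v" "A * C + u * v = m"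
        "\<bar>u - v\<bar> < 2 * A" "\<bar>u - v\<bar> < 2 * C" by (auto simp: g_def quads1_def)
    define s where "s = \<bar>u - v\<bar>"
    have s: "s = u - v \<or> s = v - u" by (auto simp: s_def)
    have "odd (u - v)" using q(3,4) by simp
    then have "odd s" "s \<noteq> 0" unfolding s_def by (auto simp: abs_if)
    then have "0 < s" by (simp add: s_def)
    have "(u + v)\<^sup>2 + ((2 * A - s) * s + s * (2 * C - s) + (2 * C - s) * (2 * A - s)) = 4 * m"
      using power2_abs[of "u - v"] unfolding s_def[symmetric] q(9)[symmetric]
      by (simp add: power2_eq_square algebra_simps)
    moreover have "s < u + v" using s q(7,8) by linarith
    ultimately show "p \<in> ?S"
      using q(3,4,7,8,10,11) \<open>odd s\<close> \<open>0 < s\<close> unfolding p s_def[symmetric] by (simp add: odd_quads_def)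
  next
    fix p assume "p \<in> ?S"
    then obtain h x y z where p: "p = (h, x, y, z)" "odd h" "odd x" "odd y" "odd z" "0 < h" "0 < x" "0 < y"
      "0 < z" "h\<^sup>2 + (x * y + y * z + z * x) = 4 * m" "y < h" by (auto simp: odd_quads_def)
    obtain A C where AC: "x + y = 2 * A" "y + z = 2 * C" "odd A" "odd C"
      using odd_quads_halves[OF p(2-5,10) assms] by blast
    obtain u v where uv: "h + y = 2 * u" "h - y = 2 * v"
      using p(2,4) by (metis even_add even_diff dvdE)
    have hy: "h = u + v" "y = u - v" "x = 2 * A - y" "z = 2 * C - y" using uv AC by auto
    have m: "A * C + u * v = m"
      using p(10) unfolding hy by (simp add: power2_eq_square algebra_simps)
    have pos: "0 < A" "0 < C" "0 < u" "0 < v" "0 < u - v" "u - v < 2 * A" "u - v < 2 * C"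
      using p AC uv by linarith+
    have gp: "p = (u + v, 2 * A - (u - v), u - v, 2 * C - (u - v))"
      unfolding p(1) using hy by simp
    have "even (u * v)" using m assms AC(3,4) by auto
    moreover have "odd (u + v)" using p(2) unfolding hy(1) .
    ultimately consider "odd u" "even v" | "even u" "odd v" by auto
    then show "p \<in> g ` ?T"
    proof cases
      case 1
      then have mem: "(A, C, u, v) \<in> ?T" and "p = g (A, C, u, v)"
        using pos AC(3,4) m by (simp_all add: quads1_def g_def gp)
      show ?thesis by (rule rev_image_eqI[OF mem]) fact
    next
      case 2
      then have mem: "(A, C, v, u) \<in> ?T" and "p = g (A, C, v, u)"
        using pos AC(3,4) m by (simp_all add: quads1_def g_def gp mult.commute abs_minus_commute[of v u])
      show ?thesis by (rule rev_image_eqI[OF mem]) fact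
    qed
  qed
  show ?thesis unfolding img[symmetric] card_image[OF inj] n1_def ..
qed

text \<open>Only \<open>h^2\<close> enters the equation, so each quadruple has two parametrizations,
  \<open>(a, c, B, w)\<close> and \<open>(a - h, c - h, B, w + h)\<close>, belonging to the two
  signs of \<open>h\<close>. Exactly one of them has odd first entries. It is counted by
  \<open>n1\<close> whenever these are positive; for the remaining quadruples the one with even
  first entries is counted by \<open>n2\<close>.\<close>

lemma card_odd_quads_greater:
  assumes "odd m"
  shows "int (card {(h, x, y, z) \<in> odd_quads (4 * m). h < y}) =
    n1 m (\<lambda>A C u v. \<bar>A - C\<bar> < u \<and> u < A + C + v) + n2 m (\<lambda>A C u v. \<bar>u - v\<bar> < A \<and> (A < u \<or> A < v))"
    (is "int (card ?S) = _")
proof -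
  let ?T1 = "{(A, C, u, v) \<in> quads1 m. \<bar>A - C\<bar> < u \<and> u < A + C + v}"
  let ?T2 = "{(A, C, u, v) \<in> quads2 m. \<bar>u - v\<bar> < A \<and> (A < u \<or> A < v)}"
  define g where "g = (\<lambda>(a, c, x, w). (\<bar>a + c - x\<bar>, a - c + x, a + c + 2 * w - x, c - a + x) :: int \<times> int \<times> int \<times> int)"
  \<comment> \<open>The entries are reordered so that the single map \<open>g\<close> serves both
    sets: \<open>a\<close> and \<open>c\<close> form one product, the odd \<open>x\<close> and
    \<open>w\<close> the other.\<close>
  define T2' where "T2' = {(u, v, A, C) |u v A C. (A, C, u, v) \<in> ?T2}"
  have T2': "(u, v, A, C) \<in> T2' \<longleftrightarrow> odd A \<and> odd C \<and> even u \<and> even v \<and>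
    0 < A \<and> 0 < C \<and> 0 < u \<and> 0 < v \<and> u * v + A * C = m \<and> \<bar>u - v\<bar> < A \<and> (A < u \<or> A < v)" for u v A C
    by (auto simp: T2'_def quads2_def)
  have T1: "(A, C, u, v) \<in> ?T1 \<longleftrightarrow> odd A \<and> odd C \<and> odd u \<and> even v \<and>
    0 < A \<and> 0 < C \<and> 0 < u \<and> 0 < v \<and> A * C + u * v = m \<and> \<bar>A - C\<bar> < u \<and> u < A + C + v" for u v A C
    by (auto simp: quads1_def)
  have "card T2' = card ?T2"
    by (rule bij_betw_same_card[OF bij_betw_byWitness[where f' = "\<lambda>(A, C, u, v). (u, v, A, C)"
        and f = "\<lambda>(u, v, A, C). (A, C, u, v)"]]) (auto simp: T2'_def)
  have step: "odd x \<Longrightarrow> a * c + x * w = m \<Longrightarrow> even (a + c) \<Longrightarrow> 0 < x \<Longrightarrow> 0 < w \<Longrightarrow> \<bar>a - c\<bar> < x \<Longrightarrow> x < a + c + w \<Longrightarrow>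
      g (a, c, x, w) \<in> ?S" for a c x w
  proof -
    assume q: "odd x" "a * c + x * w = m" "even (a + c)" "0 < x" "0 < w" "\<bar>a - c\<bar> < x" "x < a + c + w"
    define s where "s = \<bar>a + c - x\<bar>"
    have s: "s = a + c - x \<or> s = x - (a + c)" by (auto simp: s_def)
    have "odd (a + c - x)" using q(1,3) by simp
    then have "odd s" "s \<noteq> 0" unfolding s_def by (auto simp: abs_if)
    then have "0 < s" by (simp add: s_def)
    have par: "odd (a - c + x)" "odd (c - a + x)" "odd (a + c + 2 * w - x)" using q(1,3) by auto
    have "0 < a - c + x" "0 < c - a + x" "0 < a + c + 2 * w - x" "s < a + c + 2 * w - x"
      using q s \<open>0 < s\<close> by linarith+
    moreover have "s\<^sup>2 + ((a - c + x) * (a + c + 2 * w - x) + (a + c + 2 * w - x) * (c - a + x) +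
        (c - a + x) * (a - c + x)) = 4 * m"
      using power2_abs[of "a + c - x"] unfolding s_def[symmetric] q(2)[symmetric]
      by (simp add: power2_eq_square algebra_simps)
    ultimately show ?thesis
      using \<open>odd s\<close> \<open>0 < s\<close> par unfolding g_def prod.case s_def[symmetric] by (simp add: odd_quads_def)
  qed
  have "g ` ?T1 \<subseteq> ?S"
  proof (rule image_subsetI)
    fix p assume "p \<in> ?T1"
    moreover obtain a c x w where p: "p = (a, c, x, w)" by (cases p)
    ultimately show "g p \<in> ?S" unfolding p T1 by (intro step) auto
  qed
  moreover have "g ` T2' \<subseteq> ?S"
  proof (rule image_subsetI)
    fix p assume "p \<in> T2'"
    moreover obtain a c x w where p: "p = (a, c, x, w)" by (cases p)
    ultimately show "g p \<in> ?S" unfolding p T2' by (intro step) auto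
  qed
  moreover have "?S \<subseteq> g ` ?T1 \<union> g ` T2'"
  proof
    fix p assume "p \<in> ?S"
    then obtain h x y z where p: "p = (h, x, y, z)" "odd h" "odd x" "odd y" "odd z" "0 < h" "0 < x" "0 < y"
      "0 < z" "h\<^sup>2 + (x * y + y * z + z * x) = 4 * m" "h < y" by (auto simp: odd_quads_def)
    obtain B where B: "x + z = 2 * B" "odd B"
      using odd_quads_halves[OF p(2-5,10) assms] by blast
    obtain a c w where ac: "x + h = 2 * a" "y - h = 2 * w"
      using p(2-4) by (metis even_add even_diff dvdE)
    have c: "z + h = 2 * (B + h - a)" using B ac by simp
    define c where "c = B + h - a"
    have xy: "x = 2 * a - h" "y = 2 * w + h" "z = 2 * c - h" "B = a + c - h"
      using ac B by (auto simp: c_def)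
    have m: "a * c + B * w = m"
      using p(10) unfolding xy by (simp add: power2_eq_square algebra_simps)
    have m': "(a - h) * (c - h) + B * (w + h) = m"
      using m unfolding xy by (simp add: algebra_simps)
    have par: "even (a + c)" using B(2) p(2) unfolding xy(4) by auto
    have "0 < 2 * a - h" "0 < 2 * c - h" using p(7,9) xy(1,3) by simp_all
    then have pos: "0 < a" "0 < c" "0 < w" "0 < B" "\<bar>a - c\<bar> < B" "B < a + c + w"
      using p(6,11) xy(2,4) by linarith+
    have g1: "p = g (a, c, B, w)" using p(6) by (simp add: g_def p(1) xy)
    have g2: "p = g (a - h, c - h, B, w + h)" using p(6) by (simp add: g_def p(1) xy)
    show "p \<in> g ` ?T1 \<union> g ` T2'"
    proof (cases "odd a")
      case True
      then have "odd c" using par by auto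
      have "even w" using m True \<open>odd c\<close> B(2) assms by (metis even_add even_mult_iff)
      then have "(a, c, B, w) \<in> ?T1" unfolding T1
        using True \<open>odd c\<close> B(2) m pos by simp
      then show ?thesis using g1 by (intro UnI1 rev_image_eqI)
    next
      case False
      then have ec: "even c" using par by auto
      show ?thesis
      proof (cases "h < x \<and> h < z")
        case True
        have odds: "odd (a - h)" "odd (c - h)" using False ec p(2) by auto
        have "even (w + h)" using m' odds B(2) assms
          by (metis even_add even_mult_iff)
        moreover have "0 < a - h" "0 < c - h" using True xy(1,3) by simp_all
        moreover have "\<bar>(a - h) - (c - h)\<bar> < B" "B < (a - h) + (c - h) + (w + h)" "0 < w + h"
          using pos p(6) xy(4) by linarith+
        ultimately have "(a - h, c - h, B, w + h) \<in> ?T1" unfolding T1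
          using odds B(2) m' pos(4) by simp
        then show ?thesis using g2 by (intro UnI1 rev_image_eqI)
      next
        case neg: False
        have "odd w" using m False ec B(2) assms by (metis even_add even_mult_iff)
        have "a \<noteq> h" "c \<noteq> h" using False ec p(2) by auto
        then have "B < a \<or> B < c" using neg xy(1,3,4) by linarith
        then have "(a, c, B, w) \<in> T2'" unfolding T2'
          using False ec \<open>odd w\<close> B(2) m pos by simp
        then show ?thesis using g1 by (intro UnI2 rev_image_eqI)
      qed
    qed
  qed
  ultimately have S: "?S = g ` ?T1 \<union> g ` T2'" by blast
  have gD: "x = x' \<and> (a = a' \<and> c = c' \<and> w = w' \<or> a' + c' - x = x - a - c \<and> a - c = a' - c')"
    if "g (a, c, x, w) = g (a', c', x', w')" for a c x w a' c' x' w'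
  proof -
    from that have "\<bar>a + c - x\<bar> = \<bar>a' + c' - x'\<bar>" "a - c + x = a' - c' + x'" "c - a + x = c' - a' + x'"
      "a + c + 2 * w - x = a' + c' + 2 * w' - x'" by (auto simp: g_def)
    then show ?thesis by linarith
  qed
  have "inj_on g ?T1"
  proof (rule inj_onI)
    fix p q assume pq: "p \<in> ?T1" "q \<in> ?T1" "g p = g q"
    obtain a c x w where p: "p = (a, c, x, w)" by (cases p)
    obtain a' c' x' w' where q: "q = (a', c', x', w')" by (cases q)
    have par: "odd a'" "odd x" "odd c" using pq unfolding p q T1 by auto
    have "\<not> (a' + c' - x = x - a - c \<and> a - c = a' - c')"
    proof
      assume "a' + c' - x = x - a - c \<and> a - c = a' - c'"
      then have "a' = x - c" by linarith
      with par show False by simp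
    qed
    then show "p = q" using gD[OF pq(3)[unfolded p q]] unfolding p q by blast
  qed
  moreover have "inj_on g T2'"
  proof (rule inj_onI)
    fix p q assume pq: "p \<in> T2'" "q \<in> T2'" "g p = g q"
    obtain a c x w where p: "p = (a, c, x, w)" by (cases p)
    obtain a' c' x' w' where q: "q = (a', c', x', w')" by (cases q)
    have par: "even a'" "odd x" "even c" using pq unfolding p q T2' by auto
    have "\<not> (a' + c' - x = x - a - c \<and> a - c = a' - c')"
    proof
      assume "a' + c' - x = x - a - c \<and> a - c = a' - c'"
      then have "a' = x - c" by linarith
      with par show False by simp
    qed
    then show "p = q" using gD[OF pq(3)[unfolded p q]] unfolding p q by blast
  qed
  moreover have "g ` ?T1 \<inter> g ` T2' = {}"
  proof (rule ccontr)
    assume "g ` ?T1 \<inter> g ` T2' \<noteq> {}"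
    then obtain p q where pq: "p \<in> ?T1" "q \<in> T2'" "g p = g q" by blast
    obtain a c x w where p: "p = (a, c, x, w)" by (cases p)
    obtain a' c' x' w' where q: "q = (a', c', x', w')" by (cases q)
    have "odd a" "even a'" "0 < a" "0 < c" "x' < a' \<or> x' < c'" using pq unfolding p q T1 T2' by auto
    moreover have "a' + c' - x = x - a - c \<and> a - c = a' - c' \<Longrightarrow> x = x' \<Longrightarrow> a' = x' - c \<and> c' = x' - a" by linarith
    ultimately show False using gD[OF pq(3)[unfolded p q]] by auto
  qed
  moreover have "finite ?T1" by simp
  moreover have "finite T2'"
    by (rule finite_subset[of _ "(\<lambda>(A, C, u, v). (u, v, A, C)) ` quads2 m"]) (auto simp: T2'_def intro!: rev_image_eqI)
  ultimately have "card ?S = card ?T1 + card T2'"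
    unfolding S by (subst card_Un_disjoint) (auto simp: card_image)
  then show ?thesis using \<open>card T2' = card ?T2\<close> by (simp add: n1_def n2_def)
qed

lemma card_odd_between: "int (card {y. odd y \<and> 0 < y \<and> y < 2 * (n::int)}) = max 0 n"
proof -
  have "{y. odd y \<and> 0 < y \<and> y < 2 * n} = (\<lambda>k. 2 * k + 1) ` {0..<n}"
    by (auto elim!: oddE)
  then show ?thesis by (simp add: card_image inj_on_def)
qed

text \<open>Over the factorizations \<open>A C = m\<close>, the quadruples with \<open>y = h\<close>
  contribute \<open>min A C\<close> and all others contribute \<open>max 0 (C - A)\<close>. The two
  add up to \<open>C\<close>.\<close>

lemma card_odd_quads:
  assumes "odd m"
  shows "int (card (odd_quads (4 * m))) = (\<Sum>(d, e)\<in>odd_factorizations (4 * m). d)"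
proof -
  let ?F = "odd_factorizations (4 * m)"
  let ?L = "{(h, x, y, z) \<in> odd_quads (4 * m). y < h}" and ?G = "{(h, x, y, z) \<in> odd_quads (4 * m). h < y}"
  let ?E = "{(h, x, y, z) \<in> odd_quads (4 * m). y = h}"
  have fin: "finite ?L" "finite ?G" "finite ?E" by (auto intro: finite_subset[OF _ finite_odd_quads])
  have "odd_quads (4 * m) = ?L \<union> (?G \<union> ?E)" by auto
  moreover have "card (?L \<union> (?G \<union> ?E)) = card ?L + (card ?G + card ?E)"
    using fin by (subst card_Un_disjoint, auto)+
  ultimately have 1: "int (card (odd_quads (4 * m))) = int (card ?L) + int (card ?G) + int (card ?E)" by simp
  have F: "(A, C) \<in> ?F \<longleftrightarrow> odd A \<and> odd C \<and> 0 < A \<and> 0 < C \<and> A * C = m" for A C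
    by (auto simp: odd_factorizations_def)
  have "card ?E = card (Sigma ?F (\<lambda>(A, C). {y. odd y \<and> 0 < y \<and> y < 2 * min A C}))"
  proof (rule bij_betw_same_card[symmetric], rule bij_betwI')
    let ?f = "\<lambda>((A, C), y). (y, 2 * A - y, y, 2 * C - y :: int)"
    let ?D = "Sigma ?F (\<lambda>(A, C). {y. odd y \<and> 0 < y \<and> y < 2 * min A C})"
    show "?f p = ?f q \<longleftrightarrow> p = q" for p q by (auto split: prod.splits)
    show "?f p \<in> ?E" if "p \<in> ?D" for p
    proof -
      obtain A C y where "p = ((A, C), y)" by (metis surj_pair)
      then have p: "p = ((A, C), y)" and f: "(A, C) \<in> ?F" "odd y" "0 < y" "y < 2 * min A C"
        using that by auto
      have m: "A * C = m" using f(1) F by simp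
      have "y\<^sup>2 + ((2 * A - y) * y + y * (2 * C - y) + (2 * C - y) * (2 * A - y)) = 4 * m"
        unfolding m[symmetric] by (simp add: power2_eq_square algebra_simps)
      moreover have "y < 2 * A" "y < 2 * C" using f(4) by (auto simp: min_def split: if_splits)
      ultimately show ?thesis using f(2,3) unfolding p by (simp add: odd_quads_def)
    qed
    show "\<exists>p\<in>?D. q = ?f p" if "q \<in> ?E" for q
    proof -
      from that obtain x y z where q: "q = (y, x, y, z)" "odd x" "odd y" "odd z" "0 < x" "0 < y"
        "0 < z" "y\<^sup>2 + (x * y + y * z + z * x) = 4 * m" by (auto simp: odd_quads_def)
      obtain A C where AC: "x + y = 2 * A" "y + z = 2 * C" "odd A" "odd C"
        using odd_quads_halves[OF q(3,2,3,4,8) assms] by blast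
      have xz: "x = 2 * A - y" "z = 2 * C - y" using AC by auto
      have "A * C = m" using q(8) unfolding xz by (simp add: power2_eq_square algebra_simps)
      then have "((A, C), y) \<in> ?D" using AC q(3,5,6,7) xz by (simp add: F min_def)
      moreover have "q = ?f ((A, C), y)" using q xz by simp
      ultimately show ?thesis by (rule bexI[rotated])
    qed
  qed
  moreover have "finite {y. odd y \<and> 0 < y \<and> y < 2 * n}" for n :: int
    by (rule finite_subset[of _ "{0..2 * n}"]) auto
  then have "int (card (Sigma ?F (\<lambda>(A, C). {y. odd y \<and> 0 < y \<and> y < 2 * min A C}))) =
      (\<Sum>(A, C)\<in>?F. int (card {y. odd y \<and> 0 < y \<and> y < 2 * min A C}))"
    by (subst card_SigmaI) (simp_all add: case_prod_unfold)
  moreover have "\<dots> = (\<Sum>(A, C)\<in>?F. min A C)"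
    unfolding card_odd_between by (rule sum.cong) (auto simp: F)
  ultimately have 2: "int (card ?E) = (\<Sum>(A, C)\<in>?F. min A C)" by simp
  \<comment> \<open>With \<open>u = A\<close> the equation reads \<open>A (C + v) = m\<close>. So
    the solutions are factorizations of \<open>m\<close> together with an even number strictly
    between the two factors.\<close>
  have "n1 m (\<lambda>A C u v. u = A \<and> A < v) = int (card (Sigma ?F (\<lambda>(A, C). {k. 0 < C - A \<and> A < 2 * k \<and> 2 * k < C})))"
    unfolding n1_def of_nat_eq_iff
  proof (rule bij_betw_same_card[symmetric], rule bij_betwI')
    let ?f = "\<lambda>((A, C), k). (A, C - 2 * k, A, 2 * k :: int)"
    let ?D = "Sigma ?F (\<lambda>(A, C). {k. 0 < C - A \<and> A < 2 * k \<and> 2 * k < C})"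
    let ?T = "{(A, C, u, v). (A, C, u, v) \<in> quads1 m \<and> u = A \<and> A < v}"
    show "?f p = ?f q \<longleftrightarrow> p = q" for p q by (auto split: prod.splits)
    show "?f p \<in> ?T" if "p \<in> ?D" for p
    proof -
      obtain A C k where "p = ((A, C), k)" by (metis surj_pair)
      then have p: "p = ((A, C), k)" and f: "(A, C) \<in> ?F" "A < 2 * k" "2 * k < C"
        using that by auto
      have "odd A" "odd C" "0 < A" and m: "A * C = m" using f(1) F by auto
      moreover have "A * (C - 2 * k) + A * (2 * k) = m"
        unfolding m[symmetric] by (simp add: algebra_simps)
      ultimately show ?thesis using f unfolding p by (simp add: quads1_def)
    qed
    show "\<exists>p\<in>?D. q = ?f p" if "q \<in> ?T" for q
    proof -
      from that obtain A C v where q: "q = (A, C, A, v)" "odd A" "odd C" "even v" "0 < A" "0 < C" "A < v"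
        "A * C + A * v = m" by (auto simp: quads1_def)
      obtain k where k: "v = 2 * k" using q by blast
      have "((A, C + v), k) \<in> ?D" using q k by (simp add: F distrib_left)
      moreover have "q = ?f ((A, C + v), k)" using q k by simp
      ultimately show ?thesis by (rule bexI[rotated])
    qed
  qed
  also have "\<dots> = (\<Sum>(A, C)\<in>?F. int (card {k. 0 < C - A \<and> A < 2 * k \<and> 2 * k < C}))"
  proof -
    have "finite {k. 0 < C - A \<and> A < 2 * k \<and> 2 * k < C}" for A C :: int
      by (rule finite_subset[of _ "{- \<bar>A\<bar>..\<bar>C\<bar>}"]) auto
    then show ?thesis by (subst card_SigmaI) (simp_all add: case_prod_unfold)
  qed
  finally have "2 * n1 m (\<lambda>A C u v. u = A \<and> A < v) = (\<Sum>(A, C)\<in>?F. 2 * int (card {k. 0 < C - A \<and> A < 2 * k \<and> 2 * k < C}))"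
    by (simp add: sum_distrib_left case_prod_unfold)
  also have "\<dots> = (\<Sum>(A, C)\<in>?F. max 0 (C - A))"
  proof (rule sum.cong[OF refl], clarify)
    fix A C assume "(A, C) \<in> ?F"
    then obtain a c where ac: "A = 2 * a + 1" "C = 2 * c + 1" by (auto simp: F elim!: oddE)
    have "{k. 0 < C - A \<and> A < 2 * k \<and> 2 * k < C} = {a<..c}" by (auto simp: ac)
    then show "2 * int (card {k. 0 < C - A \<and> A < 2 * k \<and> 2 * k < C}) = max 0 (C - A)"
      by (simp add: ac)
  qed
  finally have "int (card (odd_quads (4 * m))) = (\<Sum>(A, C)\<in>?F. max 0 (C - A)) + (\<Sum>(A, C)\<in>?F. min A C)"
    using 1 2 card_odd_quads_less[OF assms] card_odd_quads_greater[OF assms] count_reduced_quads[of m] by simp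
  also have "\<dots> = (\<Sum>(A, C)\<in>?F. C)"
    unfolding sum.distrib[symmetric] by (rule sum.cong) auto
  also have "\<dots> = (\<Sum>(A, C)\<in>?F. A)"
    by (rule sum.reindex_bij_witness[where i = "\<lambda>(A, C). (C, A)" and j = "\<lambda>(A, C). (C, A)"])
      (auto simp: F)
  finally show ?thesis .
qed

section \<open>Three odd squares\<close>

definition three_odd_squares :: "int \<Rightarrow> (int \<times> int \<times> int) set"
  where "three_odd_squares M = {(x, y, z). odd x \<and> odd y \<and> odd z \<and>
    0 < x \<and> 0 < y \<and> 0 < z \<and> x\<^sup>2 + y\<^sup>2 + z\<^sup>2 = M}"

definition odd_triples :: "int \<Rightarrow> (int \<times> int \<times> int) set"
  where "odd_triples M = {(x, y, z). odd x \<and> odd y \<and> odd z \<and>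
    0 < x \<and> 0 < y \<and> 0 < z \<and> x * y + y * z + z * x = M}"

text \<open>Fixing the first entry \<open>h\<close> of a quadruple turns a count at \<open>N\<close>
  into counts of triples at \<open>N - h^2\<close>, which is the shape of the recursion.\<close>

lemma card_sections:
  assumes "finite S" and S: "\<And>h p. (h, p) \<in> S \<longleftrightarrow> h \<in> odd_below N \<and> p \<in> T (N - h\<^sup>2)"
  shows "(\<Sum>h\<in>odd_below N. int (card (T (N - h\<^sup>2)))) = int (card S)"
proof -
  have "S = Sigma (odd_below N) (\<lambda>h. T (N - h\<^sup>2))" using S by auto
  moreover have "finite (T (N - h\<^sup>2))" if "h \<in> odd_below N" for h
    by (rule finite_subset[of _ "snd ` S"]) (use assms that in force)+
  ultimately show ?thesis by (simp add: card_SigmaI)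
qed

text \<open>Adding an odd square turns the two kinds of triples into two kinds of quadruples with
  value \<open>4 m\<close>, \<open>m\<close> odd, and both of these are counted by the divisor sum
  of \<open>m\<close>. Hence the difference of the counts solves the homogeneous recursion with
  weight 1.\<close>

lemma card_three_odd_squares:
  assumes "0 < M" "M mod 8 = 3"
  shows "card (three_odd_squares M) = card (odd_triples M)"
proof -
  let ?d = "\<lambda>M. int (card (three_odd_squares M)) - int (card (odd_triples M))"
  have "?d M = 0"
  proof (rule odd_square_recursion_unique[where w = "\<lambda>N h. 1" and r = 3 and d = ?d])
    fix N :: int assume N: "N mod 8 = (3 + 1) mod 8" "1 < N"
    define m where "m = N div 4"
    have N8: "N mod 8 = 4" using N(1) by simp
    then have m: "N = 4 * m" "odd m" unfolding m_def by presburger+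
    have "(h, p) \<in> four_odd_squares N \<longleftrightarrow> h \<in> odd_below N \<and> p \<in> three_odd_squares (N - h\<^sup>2)" for h p
    proof -
      obtain x y z where p: "p = (x, y, z)" by (cases p)
      have "h\<^sup>2 + x\<^sup>2 + y\<^sup>2 + z\<^sup>2 = N \<Longrightarrow> 0 < x \<Longrightarrow> h\<^sup>2 < N"
        using zero_le_power2[of y] zero_le_power2[of z] zero_less_power[of x 2] by linarith
      then show ?thesis by (auto simp: p odd_below_def four_odd_squares_def three_odd_squares_def)
    qed
    then have "(\<Sum>h\<in>odd_below N. int (card (three_odd_squares (N - h\<^sup>2)))) = int (card (four_odd_squares N))"
      by (intro card_sections) auto
    moreover have "(h, p) \<in> odd_quads N \<longleftrightarrow> h \<in> odd_below N \<and> p \<in> odd_triples (N - h\<^sup>2)" for h p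
    proof -
      obtain x y z where p: "p = (x, y, z)" by (cases p)
      have "h\<^sup>2 + (x * y + y * z + z * x) = N \<Longrightarrow> 0 < x \<Longrightarrow> 0 < y \<Longrightarrow> 0 < z \<Longrightarrow> h\<^sup>2 < N"
        using mult_pos_pos[of x y] mult_pos_pos[of y z] mult_pos_pos[of z x] by linarith
      then show ?thesis by (auto simp: p odd_below_def odd_quads_def odd_triples_def)
    qed
    then have "(\<Sum>h\<in>odd_below N. int (card (odd_triples (N - h\<^sup>2)))) = int (card (odd_quads N))"
      by (intro card_sections) auto
    ultimately show "(\<Sum>h\<in>odd_below N. 1 * ?d (N - h\<^sup>2)) = 0"
      using card_four_odd_squares[OF _ N8] card_odd_quads[OF m(2)] N(2) by (simp add: m(1)[symmetric] sum_subtractf)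
  qed (use assms in auto)
  then show ?thesis by simp
qed

lemma finite_odd_triples: "finite (odd_triples M)"
proof (rule finite_subset)
  show "odd_triples M \<subseteq> {0..M} \<times> {0..M} \<times> {0..M}"
  proof
    fix p assume "p \<in> odd_triples M"
    then obtain x y z where p: "p = (x, y, z)" "0 < x" "0 < y" "0 < z" "x * y + y * z + z * x = M"
      by (auto simp: odd_triples_def)
    have "x * 1 \<le> x * y" "1 * y \<le> x * y" "1 * z \<le> y * z" using p by (intro mult_mono; simp)+
    moreover have "0 < x * y" "0 < y * z" "0 < z * x" using p by simp_all
    ultimately have "x \<le> M" "y \<le> M" "z \<le> M" using p by linarith+
    then show "p \<in> {0..M} \<times> {0..M} \<times> {0..M}" using p by auto
  qed
qed simp

theorem sum_of_three_odd_squares: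
  assumes "0 < M" "M mod 8 = (3::int)"
  obtains x y z where "x\<^sup>2 + y\<^sup>2 + z\<^sup>2 = M"
proof -
  have "(1, 1, (M - 1) div 2) \<in> odd_triples M"
    using assms unfolding odd_triples_def by clarsimp presburger
  then have "card (odd_triples M) \<noteq> 0" using finite_odd_triples by (auto simp: card_eq_0_iff)
  then have "three_odd_squares M \<noteq> {}" using card_three_odd_squares[OF assms] by auto
  then show thesis using that by (auto simp: three_odd_squares_def)
qed

section \<open>Elements of the phase space\<close>

lemma Omega_lmeasurable [simp]: "Omega \<in> lmeasurable"
  by (simp add: Omega_def bounded_box)

lemma Omega_sets [simp]: "Omega \<in> sets lebesgue"
  using Omega_lmeasurable by (rule fmeasurableD)

lemma mem_Omega: "x \<in> Omega \<longleftrightarrow> (\<forall>i. 0 < x $ i \<and> x $ i < pi)"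
  by (simp add: Omega_def mem_box_cart)

lemma finite_measure_Omega: "finite_measure (lebesgue_on Omega)"
  by (rule finite_measure_lebesgue_on) simp

lemma integrable_Omega_bounded:
  fixes f :: "real ^ 3 \<Rightarrow> 'b::{banach, second_countable_topology}"
  assumes "f \<in> borel_measurable (lebesgue_on Omega)" "\<And>x. x \<in> Omega \<Longrightarrow> norm (f x) \<le> B"
  shows "integrable (lebesgue_on Omega) f"
proof -
  interpret finite_measure "lebesgue_on Omega" by (rule finite_measure_Omega)
  show ?thesis
    by (rule integrable_const_bound[where B = B]) (use assms in auto)
qed

lemma continuous_measurable_Omega:
  fixes f :: "real ^ 3 \<Rightarrow> 'b::real_normed_vector"
  assumes "continuous_on UNIV f"
  shows "f \<in> borel_measurable (lebesgue_on Omega)"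
proof -
  have "f \<in> borel_measurable borel" by (rule borel_measurable_continuous_onI) (fact assms)
  then have "f \<in> borel_measurable lebesgue" by (simp add: measurable_completion)
  then show ?thesis by (rule measurable_restrict_space1)
qed

lemma square_integrable_bounded:
  assumes "f \<in> borel_measurable (lebesgue_on Omega)" "\<And>x. x \<in> Omega \<Longrightarrow> norm (f x) \<le> B"
  shows "square_integrable f"
  unfolding square_integrable_def
proof
  show "integrable (lebesgue_on Omega) (\<lambda>x. (norm (f x))\<^sup>2)"
    by (rule integrable_Omega_bounded[where B = "B\<^sup>2"])
      (use assms in \<open>auto intro!: power_mono\<close>)
qed (fact assms)

lemma square_integrable_cong_AE:
  assumes "square_integrable f" "g \<in> borel_measurable (lebesgue_on Omega)"
    "AE x in lebesgue_on Omega. norm (g x) \<le> norm (f x)"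
  shows "square_integrable g"
  unfolding square_integrable_def
proof
  show "integrable (lebesgue_on Omega) (\<lambda>x. (norm (g x))\<^sup>2)"
  proof (rule Bochner_Integration.integrable_bound)
    show "integrable (lebesgue_on Omega) (\<lambda>x. (norm (f x))\<^sup>2)"
      using assms(1) by (simp add: square_integrable_def)
    show "AE x in lebesgue_on Omega. norm ((norm (g x))\<^sup>2) \<le> norm ((norm (f x))\<^sup>2)"
      using assms(3) by eventually_elim (simp add: power_mono)
  qed (use assms in measurable)
qed (fact assms)

lemma L2_eq_refl: "L2_eq f f \<longleftrightarrow> square_integrable f"
  by (simp add: L2_eq_def)

lemma square_integrable_rep [simp]: "square_integrable (rep_L2 u)"
  using Quotient_rep_reflp[OF Quotient_L2, of u] by (simp add: L2_eq_def)

lemma rep_measurable [measurable]: "rep_L2 u \<in> borel_measurable (lebesgue_on Omega)"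
  using square_integrable_rep[of u] by (simp add: square_integrable_def)

lemma abs_rep [simp]: "abs_L2 (rep_L2 u) = u"
  by (rule Quotient_abs_rep[OF Quotient_L2])

lemma rep_abs_AE:
  assumes "square_integrable f"
  shows "AE x in lebesgue_on Omega. rep_L2 (abs_L2 f) x = f x"
  using Quotient_rep_abs[OF Quotient_L2, of f] assms by (simp add: L2_eq_def)

lemma abs_L2_eqI:
  assumes "square_integrable f" "square_integrable g" "AE x in lebesgue_on Omega. f x = g x"
  shows "abs_L2 f = abs_L2 g"
  using Quotient_rel_abs[OF Quotient_L2, of f g] assms by (simp add: L2_eq_def)

lemma abs_L2_add:
  "square_integrable f \<Longrightarrow> square_integrable g \<Longrightarrow> abs_L2 f + abs_L2 g = abs_L2 (\<lambda>x. f x + g x)"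
  by (simp add: plus_L2.abs_eq L2_eq_def)

lemma abs_L2_scaleR: "square_integrable f \<Longrightarrow> c *\<^sub>R abs_L2 f = abs_L2 (\<lambda>x. c *\<^sub>R f x)"
  by (simp add: scaleR_L2.abs_eq L2_eq_def)

lemma square_integrable_diff:
  "square_integrable f \<Longrightarrow> square_integrable g \<Longrightarrow> square_integrable (\<lambda>x. f x - g x)"
  using square_integrable_add[of f "\<lambda>x. (-1) *\<^sub>R g x"] square_integrable_scaleR[of g "-1"] by simp

lemma abs_L2_diff:
  assumes "square_integrable f" "square_integrable g"
  shows "abs_L2 f - abs_L2 g = abs_L2 (\<lambda>x. f x - g x)"
proof -
  have "abs_L2 f - abs_L2 g = abs_L2 f + (-1) *\<^sub>R abs_L2 g" by simp
  also have "\<dots> = abs_L2 (\<lambda>x. f x - g x)"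
    using assms by (subst abs_L2_scaleR, simp, subst abs_L2_add)
      (simp_all add: square_integrable_scaleR[of g "-1", simplified])
  finally show ?thesis .
qed

lemma inner_abs_L2:
  "square_integrable f \<Longrightarrow> square_integrable g \<Longrightarrow>
    abs_L2 f \<bullet> abs_L2 g = (LINT x|lebesgue_on Omega. f x \<bullet> g x)"
  by (simp add: inner_L2.abs_eq L2_eq_def)

lemma norm_abs_L2_square:
  "square_integrable f \<Longrightarrow> (norm (abs_L2 f))\<^sup>2 = (LINT x|lebesgue_on Omega. (norm (f x))\<^sup>2)"
  by (simp add: power2_norm_eq_inner inner_abs_L2)

lemma norm_abs_L2_mono:
  assumes f: "square_integrable f" and g: "square_integrable g"
    and le: "AE x in lebesgue_on Omega. norm (f x) \<le> c * norm (g x)" and c: "0 \<le> c"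
  shows "norm (abs_L2 f) \<le> c * norm (abs_L2 g)"
proof (rule power2_le_imp_le)
  have "(norm (abs_L2 f))\<^sup>2 = (LINT x|lebesgue_on Omega. (norm (f x))\<^sup>2)" by (rule norm_abs_L2_square[OF f])
  also have "\<dots> \<le> (LINT x|lebesgue_on Omega. c\<^sup>2 * (norm (g x))\<^sup>2)"
  proof (rule integral_mono_AE)
    show "AE x in lebesgue_on Omega. (norm (f x))\<^sup>2 \<le> c\<^sup>2 * (norm (g x))\<^sup>2"
      using le by eventually_elim (metis norm_ge_zero power_mono power_mult_distrib)
  qed (use f g in \<open>simp_all add: square_integrable_def\<close>)
  also have "\<dots> = (c * norm (abs_L2 g))\<^sup>2"
    by (simp add: norm_abs_L2_square[OF g] power_mult_distrib)
  finally show "(norm (abs_L2 f))\<^sup>2 \<le> (c * norm (abs_L2 g))\<^sup>2" .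
qed (use c in simp)

text \<open>The square root of the volume, that is, the \<open>L2\<close> norm of a field of
  constant unit length.\<close>

definition vol :: real where "vol = sqrt (measure (lebesgue_on Omega) Omega)"

lemma vol_nonneg: "0 \<le> vol" by (simp add: vol_def)

lemma norm_abs_L2_bound:
  assumes f: "f \<in> borel_measurable (lebesgue_on Omega)"
    and B: "\<And>x. x \<in> Omega \<Longrightarrow> norm (f x) \<le> B" and "0 \<le> B"
  shows "norm (abs_L2 f) \<le> B * vol"
proof -
  interpret finite_measure "lebesgue_on Omega" by (rule finite_measure_Omega)
  have sq: "square_integrable f" by (rule square_integrable_bounded) (use assms in auto)
  have "(norm (abs_L2 f))\<^sup>2 = (LINT x|lebesgue_on Omega. (norm (f x))\<^sup>2)" by (rule norm_abs_L2_square[OF sq])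
  also have "\<dots> \<le> (LINT x|lebesgue_on Omega. B\<^sup>2)"
    by (rule integral_mono) (use sq B in \<open>auto simp: square_integrable_def intro!: power_mono\<close>)
  also have "\<dots> = (B * vol)\<^sup>2" by (simp add: vol_def power_mult_distrib)
  finally show ?thesis
    by (rule power2_le_imp_le) (use assms vol_nonneg in simp)
qed

section \<open>Smooth functions and integration by parts\<close>

text \<open>With an arbitrary polynomial in \<open>1 / t\<close> in front, the functions built from
  \<open>exp (- 1 / t)\<close> are closed under differentiation: \<open>p\<close> passes to
  \<open>x^2 (p - p')\<close>. Smoothness at 0 thus reduces to a first derivative.\<close>

definition flat :: "real poly \<Rightarrow> real \<Rightarrow> real"
  where "flat p t = (if 0 < t then poly p (inverse t) * exp (- inverse t) else 0)"

lemma poly_exp_tendsto_0: "((\<lambda>y. poly p y * exp (- y)) \<longlongrightarrow> (0::real)) at_top"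
proof -
  have "((\<lambda>y. \<Sum>i\<le>degree p. coeff p i * (y ^ i / exp y)) \<longlongrightarrow> (\<Sum>i\<le>degree p. coeff p i * 0)) at_top"
    by (intro tendsto_sum tendsto_mult tendsto_const tendsto_power_div_exp_0)
  then show ?thesis
    by (simp add: poly_altdef exp_minus divide_inverse sum_distrib_right mult.assoc)
qed

lemma flat_has_derivative:
  "(flat p has_field_derivative flat ([:0, 0, 1:] * (p - pderiv p)) t) (at t)"
proof (cases t "0 :: real" rule: linorder_cases)
  case less
  have "((\<lambda>t. 0) has_field_derivative 0) (at t)" by simp
  then have "(flat p has_field_derivative 0) (at t)"
    by (rule has_field_derivative_transform_within_open[of _ _ _ "{..<0}"]) (use less in \<open>auto simp: flat_def\<close>)
  then show ?thesis using less by (simp add: flat_def)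
next
  case greater
  have "((\<lambda>t. poly p (inverse t) * exp (- inverse t)) has_field_derivative
      (poly (pderiv p) (inverse t) * (- (inverse t * 1 * inverse t))) * exp (- inverse t) +
      exp (- inverse t) * (- (- (inverse t * 1 * inverse t))) * poly p (inverse t)) (at t)"
    using greater by (auto intro!: derivative_eq_intros DERIV_chain2[OF poly_DERIV])
  then have "(flat p has_field_derivative (poly (pderiv p) (inverse t) * (- (inverse t * 1 * inverse t))) * exp (- inverse t) +
      exp (- inverse t) * (- (- (inverse t * 1 * inverse t))) * poly p (inverse t)) (at t)"
    by (rule has_field_derivative_transform_within_open[of _ _ _ "{0<..}"]) (use greater in \<open>auto simp: flat_def\<close>)
  then show ?thesis
    by (rule DERIV_cong) (use greater in \<open>simp add: flat_def algebra_simps\<close>)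
next
  case equal
  have "((\<lambda>y. poly ([:0, 1:] * p) y * exp (- y)) \<longlongrightarrow> 0) at_top" by (rule poly_exp_tendsto_0)
  then have "((\<lambda>t. poly ([:0, 1:] * p) (inverse t) * exp (- inverse t)) \<longlongrightarrow> 0) (at_right (0::real))"
    by (rule filterlim_compose[OF _ filterlim_inverse_at_top_right])
  then have "((\<lambda>t. (flat p t - flat p 0) / (t - 0)) \<longlongrightarrow> 0) (at_right 0)"
    by (rule Lim_transform_eventually)
      (auto simp: flat_def eventually_at_filter divide_inverse)
  moreover have "((\<lambda>t. (flat p t - flat p 0) / (t - 0)) \<longlongrightarrow> 0) (at_left 0)"
    by (rule Lim_transform_eventually[OF tendsto_const]) (auto simp: flat_def eventually_at_filter)
  ultimately have "((\<lambda>t. (flat p t - flat p 0) / (t - 0)) \<longlongrightarrow> 0) (at 0)"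
    by (rule filterlim_split_at[rotated])
  then show ?thesis unfolding equal
    by (simp add: has_field_derivative_iff flat_def)
qed

text \<open>Partial derivatives of \<open>nice\<close> functions are \<open>nice\<close>, hence \<open>nice\<close> functions are smooth.\<close>

inductive nice :: "(real ^ 3 \<Rightarrow> real) \<Rightarrow> bool" where
  const: "nice (\<lambda>x. c)"
| flat: "nice (\<lambda>x. flat p (a * x $ i + b))"
| sin: "nice (\<lambda>x. sin (a * x $ i + b))"
| add: "nice f \<Longrightarrow> nice g \<Longrightarrow> nice (\<lambda>x. f x + g x)"
| mult: "nice f \<Longrightarrow> nice g \<Longrightarrow> nice (\<lambda>x. f x * g x)"

lemma nice_derivative:
  "nice f \<Longrightarrow> \<exists>f'. (\<forall>x. (f has_derivative f' x) (at x)) \<and> (\<forall>v. nice (\<lambda>x. f' x v))"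
proof (induction rule: nice.induct)
  case (const c)
  show ?case by (rule exI[of _ "\<lambda>x v. 0"]) (auto intro: nice.const)
next
  case (flat p a i b)
  let ?q = "[:0, 0, 1:] * (p - pderiv p)"
  have "((\<lambda>x. flat p (a * x $ i + b)) has_derivative (\<lambda>v. flat ?q (a * x $ i + b) * (a * v $ i))) (at x)"
    for x :: "real ^ 3"
  proof (rule has_derivative_compose[of "\<lambda>x. a * x $ i + b" "\<lambda>v. a * v $ i"])
    show "((\<lambda>x. a * x $ i + b) has_derivative (\<lambda>v. a * v $ i)) (at x)"
      by (auto intro!: derivative_eq_intros bounded_linear_imp_has_derivative bounded_linear_vec_nth)
    show "(flat p has_derivative (\<lambda>h. flat ?q (a * x $ i + b) * h)) (at (a * x $ i + b))"
      using flat_has_derivative[of p "a * x $ i + b"] by (simp add: has_field_derivative_def)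
  qed
  then show ?case
    by (intro exI[of _ "\<lambda>x v. flat ?q (a * x $ i + b) * (a * v $ i)"]) (auto intro: nice.intros)
next
  case (sin a i b)
  have "((\<lambda>x. sin (a * x $ i + b)) has_derivative (\<lambda>v. sin (a * x $ i + (b + pi / 2)) * (a * v $ i))) (at x)"
    for x :: "real ^ 3"
  proof -
    have "sin (a * x $ i + (b + pi / 2)) = cos (a * x $ i + b)"
      by (simp add: sin_add add.assoc[symmetric] del: add.assoc)
    then show ?thesis
      by (auto intro!: derivative_eq_intros bounded_linear_imp_has_derivative bounded_linear_vec_nth)
  qed
  then show ?case
    by (intro exI[of _ "\<lambda>x v. sin (a * x $ i + (b + pi / 2)) * (a * v $ i)"]) (auto intro: nice.intros)
next
  case (add f g)
  then obtain f' g' where "\<forall>x. (f has_derivative f' x) (at x)" "\<forall>v. nice (\<lambda>x. f' x v)"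
    "\<forall>x. (g has_derivative g' x) (at x)" "\<forall>v. nice (\<lambda>x. g' x v)" by blast
  then show ?case
    by (intro exI[of _ "\<lambda>x v. f' x v + g' x v"]) (auto intro: nice.intros has_derivative_add)
next
  case (mult f g)
  then obtain f' g' where "\<forall>x. (f has_derivative f' x) (at x)" "\<forall>v. nice (\<lambda>x. f' x v)"
    "\<forall>x. (g has_derivative g' x) (at x)" "\<forall>v. nice (\<lambda>x. g' x v)" by blast
  then show ?case using mult.hyps
    by (intro exI[of _ "\<lambda>x v. f x * g' x v + f' x v * g x"]) (auto intro!: nice.intros has_derivative_mult)
qed

lemma nice_C_k: "nice f \<Longrightarrow> C_k m f"
proof (induction m arbitrary: f)
  case 0
  then obtain f' where "\<And>x. (f has_derivative f' x) (at x)" using nice_derivative by blast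
  then have "f differentiable_on UNIV" unfolding differentiable_on_def differentiable_def by blast
  then show ?case by (simp add: differentiable_imp_continuous_on)
next
  case (Suc m)
  then obtain f' where f': "\<And>x. (f has_derivative f' x) (at x)" "\<And>v. nice (\<lambda>x. f' x v)"
    using nice_derivative by blast
  then have "frechet_derivative f (at x) = f' x" for x by (metis frechet_derivative_at)
  then show ?case using f' Suc.IH by (auto simp: differentiable_on_def differentiable_def)
qed

lemma nice_C_infinity: "nice f \<Longrightarrow> C_infinity f"
  by (simp add: C_infinity_def nice_C_k)

lemma nice_cos: "nice (\<lambda>x. cos (a * x $ i))"
proof -
  have "(\<lambda>x::real^3. cos (a * x $ i)) = (\<lambda>x. sin (a * x $ i + pi / 2))"
    by (auto simp: sin_add)
  then show ?thesis by (simp add: nice.sin)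
qed

lemma nice_prod: "finite I \<Longrightarrow> (\<And>i. i \<in> I \<Longrightarrow> nice (f i)) \<Longrightarrow> nice (\<lambda>x. \<Prod>i\<in>I. f i x)"
  by (induction I rule: finite_induct) (auto intro: nice.intros)

lemma
  fixes f :: "'a::euclidean_space \<Rightarrow> real"
  assumes "integrable lborel f"
  shows integrable_translation_lborel: "integrable lborel (\<lambda>x. f (x + c))"
    and integral_translation_lborel: "(LINT x|lborel. f (x + c)) = (LINT x|lborel. f x)"
proof -
  have f: "f \<in> borel_measurable borel" using borel_measurable_integrable[OF assms] by simp
  have c: "(+) c \<in> measurable lborel borel" by simp
  show "integrable lborel (\<lambda>x. f (x + c))"
    using assms integrable_distr_eq[OF c f] by (simp add: lborel_distr_plus add.commute)
  show "(LINT x|lborel. f (x + c)) = (LINT x|lborel. f x)"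
    using integral_distr[OF c f] by (simp add: lborel_distr_plus add.commute)
qed

text \<open>The difference quotients \<open>g n\<close> have integral 0 by translation invariance of
  Lebesgue measure, and they converge dominatedly to the directional derivative. No iterated
  integrals are involved.\<close>

lemma integral_directional_derivative_eq_0:
  fixes f :: "'a::euclidean_space \<Rightarrow> real"
  assumes deriv: "\<And>x. (f has_derivative f' x) (at x)"
    and cont: "continuous_on UNIV (\<lambda>x. f' x e)"
    and K: "compact K" "\<And>x. x \<notin> K \<Longrightarrow> f x = 0"
  shows "(LINT x|lborel. f' x e) = 0"
proof -
  have contf: "continuous_on UNIV f"
    using deriv by (auto intro!: has_derivative_continuous continuous_at_imp_continuous_on)
  obtain R where R: "0 < R" "K \<subseteq> ball 0 R"
    using compact_imp_bounded[OF K(1)] by (metis bounded_subset_ballD)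
  \<comment> \<open>The shifts have length at most \<open>norm e\<close>, so all difference
    quotients vanish outside this enlarged ball.\<close>
  define S where "S = cball (0::'a) (R + norm e)"
  have f0: "f x = 0" if "R \<le> norm x" for x
    using K(2)[of x] R that by fastforce
  have D0: "f' x e = 0" if "R < norm x" for x
  proof -
    have "(f has_derivative (\<lambda>h. 0)) (at x)"
      by (rule has_derivative_transform_within_open[OF has_derivative_const, of "- cball 0 R"])
        (use f0 that in auto)
    then show ?thesis using has_derivative_unique[OF deriv[of x]] by metis
  qed
  have "compact ((\<lambda>x. f' x e) ` cball 0 R)"
    by (rule compact_continuous_image[OF continuous_on_subset[OF cont]]) auto
  then obtain B where B: "0 < B" "\<And>x. x \<in> cball 0 R \<Longrightarrow> \<bar>f' x e\<bar> \<le> B"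
    by (auto dest!: compact_imp_bounded simp: bounded_pos)
  then have B': "\<bar>f' x e\<bar> \<le> B" for x
    using D0[of x] by (cases "norm x \<le> R") auto
  have line: "((\<lambda>t. f (x + t *\<^sub>R e)) has_real_derivative f' (x + t *\<^sub>R e) e) (at t)" for x t
  proof -
    have "((\<lambda>t. f (x + t *\<^sub>R e)) has_derivative (\<lambda>h. f' (x + t *\<^sub>R e) (h *\<^sub>R e))) (at t)"
      by (rule has_derivative_compose[OF _ deriv]) (auto intro!: derivative_eq_intros)
    then show ?thesis
      using linear_scale[OF has_derivative_linear[OF deriv]]
      by (simp add: has_field_derivative_def mult_commute_abs)
  qed
  have lip: "\<bar>f (x + s *\<^sub>R e) - f x\<bar> \<le> B * s" if "0 < s" for x s
  proof -
    have "\<exists>z. 0 < z \<and> z < s \<and> f (x + s *\<^sub>R e) - f (x + 0 *\<^sub>R e) = (s - 0) * f' (x + z *\<^sub>R e) e"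
      by (rule MVT2[OF that]) (rule line)
    then obtain z where "f (x + s *\<^sub>R e) - f x = s * f' (x + z *\<^sub>R e) e" by auto
    then show ?thesis using B'[of "x + z *\<^sub>R e"] that
      by (simp add: abs_mult mult.commute)
  qed
  define g where "g = (\<lambda>n x. (f (x + inverse (real (Suc n)) *\<^sub>R e) - f x) * real (Suc n))"
  have int: "integrable lborel f"
  proof -
    have "integrable lborel (\<lambda>x. indicator (cball 0 R) x *\<^sub>R f x)"
      by (rule borel_integrable_compact) (auto intro: continuous_on_subset[OF contf])
    moreover have "(\<lambda>x. indicator (cball 0 R) x *\<^sub>R f x) = f"
      using f0 by (auto simp: indicator_def fun_eq_iff)
    ultimately show ?thesis by simp
  qed
  have "integral\<^sup>L lborel (g n) = 0" for n
  proof -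
    show ?thesis
      using int integrable_translation_lborel[OF int] integral_translation_lborel[OF int]
      by (simp add: g_def)
  qed
  moreover have "(\<lambda>n. integral\<^sup>L lborel (g n)) \<longlonglongrightarrow> (LINT x|lborel. f' x e)"
  proof (rule integral_dominated_convergence[where w = "\<lambda>x. B * indicator S x"])
    show "(\<lambda>x. f' x e) \<in> borel_measurable lborel"
      using borel_measurable_continuous_onI[OF cont] by simp
    show "g n \<in> borel_measurable lborel" for n
    proof -
      have "continuous_on UNIV (g n)"
        unfolding g_def by (intro continuous_intros continuous_on_compose2[OF contf]) auto
      then show ?thesis using borel_measurable_continuous_onI by auto
    qed
    show "integrable lborel (\<lambda>x. B * indicator S x)"
      unfolding S_def using emeasure_lborel_cball_finite[of "0::'a" "R + norm e"]
      by (intro integrable_mult_right integrable_real_indicator) auto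
    show "AE x in lborel. (\<lambda>n. g n x) \<longlonglongrightarrow> f' x e"
    proof (rule AE_I2)
      fix x
      have "((\<lambda>t. f (x + t *\<^sub>R e)) has_real_derivative f' x e) (at 0)"
        using line[of x 0] by simp
      then have "((\<lambda>h. (f (x + h *\<^sub>R e) - f x) / h) \<longlongrightarrow> f' x e) (at 0)"
        by (simp add: has_field_derivative_iff)
      moreover have "filterlim (\<lambda>n. inverse (real (Suc n))) (at 0) sequentially"
        using LIMSEQ_inverse_real_of_nat by (auto simp: filterlim_at)
      ultimately have "(\<lambda>n. (f (x + inverse (real (Suc n)) *\<^sub>R e) - f x) / inverse (real (Suc n))) \<longlonglongrightarrow> f' x e"
        by (rule filterlim_compose)
      then show "(\<lambda>n. g n x) \<longlonglongrightarrow> f' x e" by (simp add: g_def divide_inverse)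
    qed
    show "AE x in lborel. norm (g n x) \<le> B * indicator S x" for n
    proof (rule AE_I2)
      fix x
      show "norm (g n x) \<le> B * indicator S x"
      proof (cases "x \<in> S")
        case True
        have "\<bar>f (x + inverse (real (Suc n)) *\<^sub>R e) - f x\<bar> \<le> B / real (Suc n)"
          using lip[of "inverse (real (Suc n))" x] by (simp add: divide_inverse)
        then have "\<bar>f (x + inverse (real (Suc n)) *\<^sub>R e) - f x\<bar> * real (Suc n) \<le> B"
          by (subst (asm) pos_le_divide_eq) auto
        then show ?thesis using True by (simp only: g_def) (simp add: abs_mult)
      next
        case False
        then have "R + norm e < norm x" by (simp add: S_def)
        moreover have "norm (inverse (real (Suc n)) *\<^sub>R e) \<le> 1 * norm e"
          unfolding norm_scaleR by (intro mult_right_mono) (auto simp: inverse_eq_divide)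
        moreover have "norm x \<le> norm (x + inverse (real (Suc n)) *\<^sub>R e) + norm (inverse (real (Suc n)) *\<^sub>R e)"
          by (metis add_diff_cancel_right' norm_triangle_ineq4)
        ultimately have "R \<le> norm (x + inverse (real (Suc n)) *\<^sub>R e)" "R \<le> norm x" using norm_ge_zero[of e] by linarith+
        then show ?thesis using False by (simp add: g_def f0)
      qed
    qed
  qed
  ultimately show ?thesis by (simp add: LIMSEQ_const_iff)
qed

section \<open>The Neumann eigenfunctions\<close>

definition tensor :: "(3 \<Rightarrow> real \<Rightarrow> real) \<Rightarrow> real ^ 3 \<Rightarrow> real"
  where "tensor f x = (\<Prod>i\<in>UNIV. f i (x $ i))"

lemma tensor_has_derivative:
  assumes "\<And>i t. (f i has_field_derivative f' i t) (at t)"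
  shows "(tensor f has_derivative (\<lambda>h. \<Sum>j\<in>UNIV. h $ j * tensor (f(j := f' j)) x)) (at x)"
proof -
  have comp: "((\<lambda>x. f i (x $ i)) has_derivative (\<lambda>h. f' i (x $ i) * h $ i)) (at x)" for i
  proof (rule has_derivative_compose[of "\<lambda>x. x $ i" "\<lambda>h. h $ i" x UNIV "f i" "\<lambda>h. f' i (x $ i) * h"])
    show "((\<lambda>x. x $ i) has_derivative (\<lambda>h. h $ i)) (at x)"
      by (rule bounded_linear_imp_has_derivative) (rule bounded_linear_vec_nth)
    show "(f i has_derivative (\<lambda>h. f' i (x $ i) * h)) (at (x $ i))"
      using assms[of i "x $ i"] by (simp add: has_field_derivative_def)
  qed
  have "tensor (f(j := f' j)) x = f' j (x $ j) * (\<Prod>i\<in>UNIV - {j}. f i (x $ i))" for j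
    by (simp add: tensor_def prod.remove[of UNIV j])
  then have "(\<lambda>h. \<Sum>j\<in>UNIV. h $ j * tensor (f(j := f' j)) x) =
      (\<lambda>h. \<Sum>j\<in>UNIV. (f' j (x $ j) * h $ j) * (\<Prod>i\<in>UNIV - {j}. f i (x $ i)))"
    by (simp add: mult.assoc mult.left_commute)
  moreover have "tensor f = (\<lambda>x. \<Prod>i\<in>UNIV. f i (x $ i))" by (simp add: tensor_def fun_eq_iff)
  ultimately show ?thesis using has_derivative_prod[of UNIV "\<lambda>i x. f i (x $ i)", OF comp] by simp
qed

lemma sum_axis: "(\<Sum>j\<in>UNIV. axis i (1::real) $ j * c j) = c i"
  by (simp add: axis_def if_distrib[of "\<lambda>x. x * _"] cong: if_cong)

lemma continuous_tensor:
  assumes "\<And>i. continuous_on UNIV (f i)"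
  shows "continuous_on UNIV (tensor f)"
  unfolding tensor_def
  by (intro continuous_on_prod continuous_on_compose2[OF assms] continuous_intros) auto

lemma abs_tensor_le:
  assumes "\<And>i. \<bar>f i (x $ i)\<bar> \<le> b i"
  shows "\<bar>tensor f x\<bar> \<le> (\<Prod>i\<in>UNIV. b i)"
  unfolding tensor_def abs_prod by (rule prod_mono) (use assms in auto)

lemma continuous_bounded_Omega:
  fixes f :: "real ^ 3 \<Rightarrow> 'b::real_normed_vector"
  assumes "continuous_on UNIV f"
  obtains B where "0 \<le> B" "\<And>x. x \<in> Omega \<Longrightarrow> norm (f x) \<le> B"
proof -
  have "compact (f ` cbox 0 (\<chi> i. pi))"
    by (rule compact_continuous_image[OF continuous_on_subset[OF assms]]) auto
  then obtain B where "0 < B" "\<And>x. x \<in> cbox 0 (\<chi> i. pi) \<Longrightarrow> norm (f x) \<le> B"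
    by (auto dest!: compact_imp_bounded simp: bounded_pos)
  then show thesis
    using that[of B] box_subset_cbox[of "0 :: real ^ 3" "\<chi> i. pi"] by (auto simp: Omega_def)
qed

lemma integrable_continuous_Omega:
  fixes f :: "real ^ 3 \<Rightarrow> 'b::{banach, second_countable_topology}"
  assumes "continuous_on UNIV f"
  shows "integrable (lebesgue_on Omega) f"
  by (rule continuous_bounded_Omega[OF assms])
    (rule integrable_Omega_bounded[OF continuous_measurable_Omega[OF assms]])

lemma square_integrable_continuous:
  assumes "continuous_on UNIV f"
  shows "square_integrable f"
  by (rule continuous_bounded_Omega[OF assms])
    (rule square_integrable_bounded[OF continuous_measurable_Omega[OF assms]])

lemma integral_Omega_eq_lborel:
  fixes f :: "real ^ 3 \<Rightarrow> real"
  assumes "continuous_on UNIV f" "\<And>x. x \<notin> Omega \<Longrightarrow> f x = 0"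
  shows "(LINT x|lebesgue_on Omega. f x) = (LINT x|lborel. f x)"
proof -
  have "(LINT x|lebesgue_on Omega. f x) = (LINT x|lebesgue. indicator Omega x *\<^sub>R f x)"
    by (rule integral_restrict_space) simp
  also have "(\<lambda>x. indicator Omega x *\<^sub>R f x) = f"
    using assms(2) by (auto simp: indicator_def fun_eq_iff)
  also have "(LINT x|lebesgue. f x) = (LINT x|lborel. f x)"
    by (rule integral_completion) (use borel_measurable_continuous_onI[OF assms(1)] in simp)
  finally show ?thesis .
qed

lemma test_function_derivative:
  assumes "test_function \<psi>"
  shows "(\<psi> has_derivative frechet_derivative \<psi> (at x)) (at x)"
    and "continuous_on UNIV (\<lambda>x. frechet_derivative \<psi> (at x) v)"
proof -
  have "C_k (Suc 0) \<psi>" using assms by (auto simp: test_function_def C_infinity_def simp del: C_k.simps)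
  then show "(\<psi> has_derivative frechet_derivative \<psi> (at x)) (at x)"
    "continuous_on UNIV (\<lambda>x. frechet_derivative \<psi> (at x) v)"
    by (auto simp: differentiable_on_def frechet_derivative_works)
qed

text \<open>The product of \<open>c\<close> with the test function has compact support inside
  \<open>Omega\<close>, so the integral of its derivative is 0; \<open>c\<close> itself may be
  arbitrary near the boundary.\<close>

lemma integration_by_parts:
  assumes \<psi>: "test_function \<psi>"
    and c: "\<And>x. (c has_derivative c' x) (at x)" "continuous_on UNIV (\<lambda>x. c' x v)"
  shows "(LINT x|lebesgue_on Omega. frechet_derivative \<psi> (at x) v * c x) =
    - (LINT x|lebesgue_on Omega. \<psi> x * c' x v)"
proof -
  let ?D = "\<lambda>x. frechet_derivative \<psi> (at x)"
  obtain K where K: "compact K" "K \<subseteq> Omega" "\<And>x. x \<notin> K \<Longrightarrow> \<psi> x = 0"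
    using \<psi> by (auto simp: test_function_def)
  have contc: "continuous_on UNIV c" "continuous_on UNIV \<psi>"
    using c(1) test_function_derivative(1)[OF \<psi>]
    by (auto intro!: has_derivative_continuous continuous_at_imp_continuous_on)
  have cont: "continuous_on UNIV (\<lambda>x. \<psi> x * c' x v)" "continuous_on UNIV (\<lambda>x. ?D x v * c x)"
    by (intro continuous_intros contc c(2) test_function_derivative(2)[OF \<psi>])+
  have D0: "?D x v = 0" if "x \<notin> K" for x
  proof -
    have "(\<psi> has_derivative (\<lambda>h. 0)) (at x)"
      by (rule has_derivative_transform_within_open[OF has_derivative_const, of "- K"])
        (use K that compact_imp_closed in auto)
    then show ?thesis using has_derivative_unique[OF test_function_derivative(1)[OF \<psi>]] by metis
  qed
  have "(LINT x|lebesgue_on Omega. \<psi> x * c' x v + ?D x v * c x) = (LINT x|lborel. \<psi> x * c' x v + ?D x v * c x)"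
  proof (rule integral_Omega_eq_lborel)
    fix x assume "x \<notin> Omega"
    then have "x \<notin> K" using K(2) by auto
    then show "\<psi> x * c' x v + ?D x v * c x = 0" using K(3) D0 by simp
  qed (intro continuous_on_add cont)
  also have "\<dots> = 0"
  proof (rule integral_directional_derivative_eq_0[OF _ _ K(1), where f = "\<lambda>x. \<psi> x * c x"])
    show "((\<lambda>x. \<psi> x * c x) has_derivative (\<lambda>h. \<psi> x * c' x h + ?D x h * c x)) (at x)" for x
      by (rule has_derivative_mult[OF test_function_derivative(1)[OF \<psi>] c(1)])
  qed (use K(3) in \<open>auto intro!: continuous_on_add cont\<close>)
  finally show ?thesis
    using integrable_continuous_Omega[OF cont(1)] integrable_continuous_Omega[OF cont(2)]
    by (simp add: add_eq_0_iff)
qed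

definition cosf :: "(3 \<Rightarrow> nat) \<Rightarrow> 3 \<Rightarrow> real \<Rightarrow> real"
  where "cosf n i t = cos (real (n i) * t)"

definition sinf :: "(3 \<Rightarrow> nat) \<Rightarrow> 3 \<Rightarrow> real \<Rightarrow> real"
  where "sinf n i t = - real (n i) * sin (real (n i) * t)"

lemma cosf_has_derivative: "(cosf n i has_field_derivative sinf n i t) (at t)"
  unfolding cosf_def[abs_def] sinf_def by (auto intro!: derivative_eq_intros)

definition eigf :: "(3 \<Rightarrow> nat) \<Rightarrow> 2 \<Rightarrow> L2"
  where "eigf n i = abs_L2 (\<lambda>x. tensor (cosf n) x *\<^sub>R axis i 1)"

definition deigf :: "(3 \<Rightarrow> nat) \<Rightarrow> 2 \<Rightarrow> 3 \<Rightarrow> L2"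
  where "deigf n i j = abs_L2 (\<lambda>x. tensor ((cosf n)(j := sinf n j)) x *\<^sub>R axis i 1)"

lemma continuous_cosf: "continuous_on UNIV (cosf n i)" "continuous_on UNIV (sinf n i)"
  unfolding cosf_def[abs_def] sinf_def[abs_def] by (intro continuous_intros)+

lemma continuous_tensor_cosf:
  "continuous_on UNIV (tensor (cosf n))" "continuous_on UNIV (tensor ((cosf n)(j := sinf n j)))"
  by (rule continuous_tensor, simp add: continuous_cosf)+

lemma square_integrable_eigf:
  "square_integrable (\<lambda>x. tensor (cosf n) x *\<^sub>R axis i 1)"
  "square_integrable (\<lambda>x. tensor ((cosf n)(j := sinf n j)) x *\<^sub>R axis i 1)"
  by (intro square_integrable_continuous continuous_intros continuous_tensor_cosf)+

lemma integral_rep_scaleR: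
  assumes f: "square_integrable f" and \<psi>: "\<psi> \<in> borel_measurable (lebesgue_on Omega)"
  shows "(LINT x|lebesgue_on Omega. \<psi> x *\<^sub>R rep_L2 (abs_L2 f) x) = (LINT x|lebesgue_on Omega. \<psi> x *\<^sub>R f x)"
proof (rule integral_cong_AE)
  show "AE x in lebesgue_on Omega. \<psi> x *\<^sub>R rep_L2 (abs_L2 f) x = \<psi> x *\<^sub>R f x"
    using rep_abs_AE[OF f] by eventually_elim simp
qed (use assms in \<open>auto simp: square_integrable_def\<close>)

lemma weak_partial_eigf: "weak_partial j (eigf n i) (deigf n i j)"
  unfolding weak_partial_def
proof (intro allI impI)
  fix \<psi> assume \<psi>: "test_function \<psi>"
  let ?D = "\<lambda>x. frechet_derivative \<psi> (at x) (axis j 1)"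
  have mD: "?D \<in> borel_measurable (lebesgue_on Omega)"
    by (rule continuous_measurable_Omega) (rule test_function_derivative(2)[OF \<psi>])
  have cont\<psi>: "continuous_on UNIV \<psi>" using test_function_derivative(1)[OF \<psi>]
    by (auto intro!: has_derivative_continuous continuous_at_imp_continuous_on)
  then have m\<psi>: "\<psi> \<in> borel_measurable (lebesgue_on Omega)" by (rule continuous_measurable_Omega)
  have "(LINT x|lebesgue_on Omega. ?D x *\<^sub>R rep_L2 (eigf n i) x) =
      (LINT x|lebesgue_on Omega. (?D x * tensor (cosf n) x) *\<^sub>R axis i 1)"
    unfolding eigf_def by (subst integral_rep_scaleR[OF square_integrable_eigf(1) mD]) simp
  also have "\<dots> = (LINT x|lebesgue_on Omega. ?D x * tensor (cosf n) x) *\<^sub>R axis i 1"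
    by (intro integral_scaleR_left integrable_continuous_Omega continuous_on_mult
        test_function_derivative(2)[OF \<psi>] continuous_tensor_cosf)
  also have "(LINT x|lebesgue_on Omega. ?D x * tensor (cosf n) x) =
      - (LINT x|lebesgue_on Omega. \<psi> x * tensor ((cosf n)(j := sinf n j)) x)"
    using integration_by_parts[OF \<psi>, of "tensor (cosf n)", OF tensor_has_derivative[OF cosf_has_derivative], of "axis j 1"]
      continuous_tensor_cosf(2)[of n j]
    by (simp add: sum_axis)
  also have "\<dots> *\<^sub>R axis i 1 = - (LINT x|lebesgue_on Omega. (\<psi> x * tensor ((cosf n)(j := sinf n j)) x) *\<^sub>R axis i 1)"
    by (subst integral_scaleR_left)
      (auto intro!: integrable_continuous_Omega continuous_on_mult cont\<psi> continuous_tensor_cosf)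
  also have "(LINT x|lebesgue_on Omega. (\<psi> x * tensor ((cosf n)(j := sinf n j)) x) *\<^sub>R axis i 1) =
      (LINT x|lebesgue_on Omega. \<psi> x *\<^sub>R rep_L2 (deigf n i j) x)"
    unfolding deigf_def by (subst integral_rep_scaleR[OF square_integrable_eigf(2) m\<psi>]) simp
  finally show "(LINT x|lebesgue_on Omega. ?D x *\<^sub>R rep_L2 (eigf n i) x) =
      - (LINT x|lebesgue_on Omega. \<psi> x *\<^sub>R rep_L2 (deigf n i j) x)" .
qed

section \<open>Cutoff functions near the faces of the cube\<close>

lemma flat_1_bounds: "0 \<le> flat 1 t" "flat 1 t \<le> 1"
  by (auto simp: flat_def)

definition flat' :: "real \<Rightarrow> real"
  where "flat' t = (if 0 < t then (inverse t)\<^sup>2 * exp (- inverse t) else 0)"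

lemma flat_1_has_derivative: "(flat 1 has_field_derivative flat' t) (at t)"
proof -
  have "flat ([:0, 0, 1:] * (1 - pderiv 1)) t = flat' t"
    by (simp add: flat_def flat'_def power2_eq_square)
  then show ?thesis using flat_has_derivative[of 1 t] by simp
qed

lemma exp_minus_le: "0 \<le> r \<Longrightarrow> r * exp (- r) \<le> (1::real)" "0 \<le> r \<Longrightarrow> r\<^sup>2 * exp (- r) \<le> (2::real)"
proof -
  assume r: "0 \<le> r"
  have e: "1 + r + r\<^sup>2 / 2 \<le> exp r"
    using exp_lower_Taylor_quadratic[OF r] by simp
  then have "r \<le> exp r" "r\<^sup>2 \<le> 2 * exp r" using r zero_le_power2[of r] by linarith+
  then show "r * exp (- r) \<le> 1" "r\<^sup>2 * exp (- r) \<le> 2"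
    by (simp_all add: exp_minus field_simps)
qed

lemma flat'_nonneg: "0 \<le> flat' t"
  by (simp add: flat'_def)

text \<open>For \<open>t + 1 = m s\<close> this bounds \<open>m s flat' (m s - 1)\<close>
  independently of \<open>m\<close>: the derivative of the cutoff may grow like \<open>m\<close>,
  but its product with the distance \<open>s\<close> from the face does not.\<close>

lemma flat'_weight: "\<bar>t + 1\<bar> * flat' t \<le> 3"
proof (cases "0 < t")
  case True
  define r where "r = inverse t"
  have r: "0 < r" "t * r = 1" using True by (auto simp: r_def)
  then have "t * r\<^sup>2 = r" by (simp add: power2_eq_square mult.assoc[symmetric])
  moreover have "\<bar>t + 1\<bar> * flat' t = t * r\<^sup>2 * exp (- r) + r\<^sup>2 * exp (- r)"
    using True by (simp add: flat'_def r_def[symmetric] algebra_simps)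
  ultimately have "\<bar>t + 1\<bar> * flat' t = r * exp (- r) + r\<^sup>2 * exp (- r)" by simp
  also have "\<dots> \<le> 3" using exp_minus_le[of r] r by simp
  finally show ?thesis .
qed (simp add: flat'_def)

lemma flat'_le: "flat' t \<le> (inverse t)\<^sup>2"
  by (auto simp: flat'_def mult_left_le)

lemma abs_sin_mult_le: "0 \<le> t \<Longrightarrow> \<bar>sin (real n * t)\<bar> \<le> real n * t"
  using abs_sin_x_le_abs_x[of "real n * t"] by simp

lemma abs_sin_mult_pi: "\<bar>sin (real n * (pi - t))\<bar> = \<bar>sin (real n * t)\<bar>"
  by (simp add: right_diff_distrib sin_diff abs_mult)

text \<open>Zero within distance \<open>1 / m\<close> of 0 and of \<pi>, and convergent to 1 at
  every point between as \<open>m\<close> grows. It has no plateau of height 1; pointwise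
  convergence takes its place.\<close>

definition cutoff :: "real \<Rightarrow> real \<Rightarrow> real"
  where "cutoff m t = flat 1 (m * t - 1) * flat 1 (m * (pi - t) - 1)"

definition cutoff' :: "real \<Rightarrow> real \<Rightarrow> real"
  where "cutoff' m t = m * flat' (m * t - 1) * flat 1 (m * (pi - t) - 1) -
    flat 1 (m * t - 1) * (m * flat' (m * (pi - t) - 1))"

lemma cutoff_has_derivative: "(cutoff m has_field_derivative cutoff' m t) (at t)"
  unfolding cutoff_def[abs_def] cutoff'_def
  by (rule DERIV_cong, rule DERIV_mult; (rule DERIV_chain2[OF flat_1_has_derivative])?)
    (auto intro!: derivative_eq_intros)

lemma cutoff_bounds: "\<bar>cutoff m t\<bar> \<le> 1"
  using flat_1_bounds by (simp add: cutoff_def abs_mult mult_le_one)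

lemma cutoff_eq_0: "m * t \<le> 1 \<or> m * (pi - t) \<le> 1 \<Longrightarrow> cutoff m t = 0"
  by (auto simp: cutoff_def flat_def)

text \<open>The sine vanishes at both ends and is at most \<open>n\<close> times the distance from
  either, which compensates the growth of the derivative in \<open>m\<close>. Each end contributes
  \<open>3 n\<close>.\<close>

lemma cutoff'_sin_bound:
  assumes "0 < m" "0 < t" "t < pi"
  shows "\<bar>cutoff' m t * sin (real n * t)\<bar> \<le> 6 * real n"
proof -
  have *: "m * flat' (m * s - 1) * (real n * s) \<le> 3 * real n" if "0 < s" for s
  proof -
    have "m * flat' (m * s - 1) * (real n * s) = real n * (\<bar>(m * s - 1) + 1\<bar> * flat' (m * s - 1))"
      using assms that by simp
    also have "\<dots> \<le> real n * 3" by (intro mult_left_mono flat'_weight) simp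
    finally show ?thesis by simp
  qed
  let ?s = "\<bar>sin (real n * t)\<bar>"
  have s: "?s \<le> real n * t" "?s \<le> real n * (pi - t)"
    using abs_sin_mult_le[of t n] abs_sin_mult_le[of "pi - t" n] assms by (simp_all add: abs_sin_mult_pi)
  have "m * flat' (m * t - 1) * flat 1 (m * (pi - t) - 1) * ?s \<le> m * flat' (m * t - 1) * 1 * (real n * t)"
    using assms by (intro mult_mono s flat_1_bounds mult_nonneg_nonneg flat'_nonneg order_refl) auto
  also have "\<dots> \<le> 3 * real n" using *[of t] assms by simp
  finally have 1: "m * flat' (m * t - 1) * flat 1 (m * (pi - t) - 1) * ?s \<le> 3 * real n" .
  have "flat 1 (m * t - 1) * (m * flat' (m * (pi - t) - 1)) * ?s \<le> 1 * (m * flat' (m * (pi - t) - 1)) * (real n * (pi - t))"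
    using assms by (intro mult_mono s flat_1_bounds mult_nonneg_nonneg flat'_nonneg order_refl) auto
  also have "\<dots> \<le> 3 * real n" using *[of "pi - t"] assms by simp
  finally have 2: "flat 1 (m * t - 1) * (m * flat' (m * (pi - t) - 1)) * ?s \<le> 3 * real n" .
  have "\<bar>cutoff' m t\<bar> \<le> m * flat' (m * t - 1) * flat 1 (m * (pi - t) - 1) + flat 1 (m * t - 1) * (m * flat' (m * (pi - t) - 1))"
    unfolding cutoff'_def using assms
    by (intro order_trans[OF abs_triangle_ineq4]) (simp add: abs_mult flat'_nonneg flat_1_bounds)
  then have "\<bar>cutoff' m t\<bar> * ?s \<le> (m * flat' (m * t - 1) * flat 1 (m * (pi - t) - 1) + flat 1 (m * t - 1) * (m * flat' (m * (pi - t) - 1))) * ?s"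
    by (rule mult_right_mono) simp
  also have "\<dots> \<le> 6 * real n" using 1 2 by (simp add: distrib_right)
  finally show ?thesis by (simp add: abs_mult)
qed

lemma flat_1_limit:
  assumes "0 < t"
  shows "(\<lambda>k. flat 1 (real (Suc k) * t - 1)) \<longlonglongrightarrow> 1"
    and "(\<lambda>k. real (Suc k) * flat' (real (Suc k) * t - 1)) \<longlonglongrightarrow> 0"
proof -
  have top: "filterlim (\<lambda>k. real (Suc k) * t - 1) at_top sequentially"
    using assms by real_asymp
  have ev: "\<forall>\<^sub>F k in sequentially. 0 < real (Suc k) * t - 1"
    using filterlim_at_top_dense[THEN iffD1, rule_format, OF top, of 0] .
  have "(\<lambda>k. exp (- inverse (real (Suc k) * t - 1))) \<longlonglongrightarrow> exp (- 0)"
    by (intro tendsto_intros tendsto_inverse_0_at_top top)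
  moreover have "\<forall>\<^sub>F k in sequentially. exp (- inverse (real (Suc k) * t - 1)) = flat 1 (real (Suc k) * t - 1)"
    using ev by eventually_elim (simp add: flat_def)
  ultimately have "(\<lambda>k. flat 1 (real (Suc k) * t - 1)) \<longlonglongrightarrow> exp (- 0)"
    by (rule Lim_transform_eventually)
  then show "(\<lambda>k. flat 1 (real (Suc k) * t - 1)) \<longlonglongrightarrow> 1" by simp
  have lim: "(\<lambda>k. real (Suc k) * (inverse (real (Suc k) * t - 1))\<^sup>2) \<longlonglongrightarrow> 0"
    using assms by real_asymp
  show "(\<lambda>k. real (Suc k) * flat' (real (Suc k) * t - 1)) \<longlonglongrightarrow> 0"
    by (rule tendsto_sandwich[OF _ _ tendsto_const lim])
      (intro always_eventually allI mult_nonneg_nonneg flat'_nonneg mult_left_mono flat'_le of_nat_0_le_iff)+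
qed

lemma cutoff_limit:
  assumes "0 < t" "t < pi"
  shows "(\<lambda>k. cutoff (real (Suc k)) t) \<longlonglongrightarrow> 1" and "(\<lambda>k. cutoff' (real (Suc k)) t) \<longlonglongrightarrow> 0"
proof -
  have p: "0 < pi - t" using assms by simp
  show "(\<lambda>k. cutoff (real (Suc k)) t) \<longlonglongrightarrow> 1"
    using tendsto_mult[OF flat_1_limit(1)[OF assms(1)] flat_1_limit(1)[OF p]] by (simp add: cutoff_def)
  show "(\<lambda>k. cutoff' (real (Suc k)) t) \<longlonglongrightarrow> 0"
    using tendsto_diff[OF tendsto_mult[OF flat_1_limit(2)[OF assms(1)] flat_1_limit(1)[OF p]]
        tendsto_mult[OF flat_1_limit(1)[OF assms(1)] flat_1_limit(2)[OF p]]] by (simp add: cutoff'_def)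
qed

text \<open>Factors of a test function that approximates the \<open>j\<close>-th partial derivative
  of the eigenfunction: sine in direction \<open>j\<close>, cosine in the others, each cut
  off.\<close>

definition bump :: "(3 \<Rightarrow> nat) \<Rightarrow> 3 \<Rightarrow> real \<Rightarrow> 3 \<Rightarrow> real \<Rightarrow> real"
  where "bump n j m l t = cutoff m t * (if l = j then sinf n j t else cosf n l t)"

definition bump' :: "(3 \<Rightarrow> nat) \<Rightarrow> 3 \<Rightarrow> real \<Rightarrow> 3 \<Rightarrow> real \<Rightarrow> real"
  where "bump' n j m l t = cutoff' m t * (if l = j then sinf n j t else cosf n l t) +
    cutoff m t * (if l = j then - (real (n j))\<^sup>2 * cosf n j t else sinf n l t)"

lemma sinf_has_derivative: "(sinf n i has_field_derivative - (real (n i))\<^sup>2 * cosf n i t) (at t)"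
  unfolding cosf_def sinf_def[abs_def] by (auto intro!: derivative_eq_intros simp: power2_eq_square)

lemma bump_has_derivative: "(bump n j m l has_field_derivative bump' n j m l t) (at t)"
  unfolding bump_def[abs_def] bump'_def
  by (cases "l = j") (auto intro!: derivative_eq_intros cutoff_has_derivative cosf_has_derivative sinf_has_derivative)

lemma nice_bump: "nice (tensor (bump n j m))"
proof -
  have c1: "nice (\<lambda>x. flat 1 (m * x $ i - 1))" for i
    using nice.flat[of 1 m i "-1"] by simp
  have c2: "nice (\<lambda>x. flat 1 (m * (pi - x $ i) - 1))" for i
    using nice.flat[of 1 "-m" i "m * pi - 1"] by (simp add: algebra_simps)
  have c: "nice (\<lambda>x. cutoff m (x $ i))" for i
    unfolding cutoff_def by (intro nice.mult c1 c2)
  have s: "nice (\<lambda>x. sinf n i (x $ i))" for i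
    using nice.mult[OF nice.const[of "- real (n i)"] nice.sin[of "real (n i)" i 0]] by (simp add: sinf_def)
  have k: "nice (\<lambda>x. cosf n i (x $ i))" for i
    unfolding cosf_def by (rule nice_cos)
  have "nice (\<lambda>x. bump n j m i (x $ i))" for i
    unfolding bump_def by (cases "i = j") (auto intro!: nice.mult c s k)
  then show ?thesis unfolding tensor_def[abs_def] by (intro nice_prod) auto
qed

lemma test_function_bump:
  assumes "0 < m"
  shows "test_function (tensor (bump n j m))"
  unfolding test_function_def
proof (intro conjI exI[of _ "cbox (\<chi> i. 1 / m) (\<chi> i. pi - 1 / m) :: (real ^ 3) set"] allI impI)
  show "C_infinity (tensor (bump n j m))" by (rule nice_C_infinity[OF nice_bump])
  show "cbox (\<chi> i. 1 / m) (\<chi> i. pi - 1 / m) \<subseteq> Omega"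
  proof
    fix x :: "real ^ 3" assume "x \<in> cbox (\<chi> i. 1 / m) (\<chi> i. pi - 1 / m)"
    then have "1 / m \<le> x $ i \<and> x $ i \<le> pi - 1 / m" for i by (simp add: mem_box_cart)
    moreover have "0 < 1 / m" using assms by simp
    ultimately have "0 < x $ i \<and> x $ i < pi" for i by (smt (verit))
    then show "x \<in> Omega" by (simp add: mem_Omega)
  qed
  fix x :: "real ^ 3" assume "x \<notin> cbox (\<chi> i. 1 / m) (\<chi> i. pi - 1 / m)"
  then obtain i where "x $ i < 1 / m \<or> pi - 1 / m < x $ i" by (auto simp: mem_box_cart not_le)
  then have "m * x $ i \<le> 1 \<or> m * (pi - x $ i) \<le> 1" using assms by (auto simp: field_simps)
  then have "bump n j m i (x $ i) = 0" by (simp add: bump_def cutoff_eq_0)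
  then show "tensor (bump n j m) x = 0" by (auto simp: tensor_def intro!: prod_zero)
qed simp

lemma frechet_bump:
  "frechet_derivative (tensor (bump n j m)) (at x) (axis j 1) = tensor ((bump n j m)(j := bump' n j m j)) x"
proof -
  have "frechet_derivative (tensor (bump n j m)) (at x) =
      (\<lambda>h. \<Sum>i\<in>UNIV. h $ i * tensor ((bump n j m)(i := bump' n j m i)) x)"
    by (rule frechet_derivative_at[symmetric, OF tensor_has_derivative]) (rule bump_has_derivative)
  then show ?thesis by (simp add: sum_axis)
qed

lemma abs_cosf_le: "\<bar>cosf n i t\<bar> \<le> 1"
  by (simp add: cosf_def)

text \<open>Both bounds are uniform in \<open>m\<close>, as dominated convergence requires. In
  \<open>7 = 6 + 1\<close> the 6 stems from the derivative of the cutoff against the sine, the 1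
  from the derivative of the sine.\<close>

lemma abs_bump_le:
  assumes "x \<in> Omega" "0 < m"
  shows "\<bar>bump n j m l (x $ l)\<bar> \<le> 1 + real (n l)"
    and "\<bar>bump' n j m j (x $ j)\<bar> \<le> 7 * (real (n j))\<^sup>2"
proof -
  have "\<bar>if l = j then sinf n j (x $ l) else cosf n l (x $ l)\<bar> \<le> 1 + real (n l)"
    using mult_left_le[of "\<bar>sin (real (n j) * x $ j)\<bar>" "real (n j)"] abs_cosf_le[of n l "x $ l"]
    by (auto simp: sinf_def abs_mult intro: order_trans)
  then have "\<bar>cutoff m (x $ l)\<bar> * \<bar>if l = j then sinf n j (x $ l) else cosf n l (x $ l)\<bar> \<le> 1 * (1 + real (n l))"
    by (intro mult_mono cutoff_bounds) auto
  then show "\<bar>bump n j m l (x $ l)\<bar> \<le> 1 + real (n l)" by (simp add: bump_def abs_mult)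
  have "\<bar>cutoff' m (x $ j) * sinf n j (x $ j)\<bar> = real (n j) * \<bar>cutoff' m (x $ j) * sin (real (n j) * x $ j)\<bar>"
    by (simp add: sinf_def abs_mult)
  also have "\<dots> \<le> real (n j) * (6 * real (n j))"
    using assms by (intro mult_left_mono cutoff'_sin_bound) (auto simp: mem_Omega)
  finally have 1: "\<bar>cutoff' m (x $ j) * sinf n j (x $ j)\<bar> \<le> 6 * (real (n j))\<^sup>2" by (simp add: power2_eq_square)
  have "\<bar>cutoff m (x $ j) * (- (real (n j))\<^sup>2 * cosf n j (x $ j))\<bar> = (real (n j))\<^sup>2 * (\<bar>cutoff m (x $ j)\<bar> * \<bar>cosf n j (x $ j)\<bar>)"
    by (simp add: abs_mult)
  also have "\<dots> \<le> (real (n j))\<^sup>2 * 1"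
    by (intro mult_left_mono mult_le_one cutoff_bounds abs_cosf_le) auto
  finally have 2: "\<bar>cutoff m (x $ j) * (- (real (n j))\<^sup>2 * cosf n j (x $ j))\<bar> \<le> (real (n j))\<^sup>2" by simp
  show "\<bar>bump' n j m j (x $ j)\<bar> \<le> 7 * (real (n j))\<^sup>2"
    unfolding bump'_def using 1 2 by simp
qed

lemma integrable_rep [simp]: "integrable (lebesgue_on Omega) (rep_L2 u)"
proof -
  interpret finite_measure "lebesgue_on Omega" by (rule finite_measure_Omega)
  show ?thesis
  proof (rule Bochner_Integration.integrable_bound)
    show "integrable (lebesgue_on Omega) (\<lambda>x. 1 + (norm (rep_L2 u x))\<^sup>2)"
      using square_integrable_rep[of u] by (simp add: square_integrable_def)
    show "AE x in lebesgue_on Omega. norm (rep_L2 u x) \<le> norm (1 + (norm (rep_L2 u x))\<^sup>2)"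
    proof (rule AE_I2)
      fix x
      have "2 * norm (rep_L2 u x) \<le> 1 + (norm (rep_L2 u x))\<^sup>2"
        using sum_squares_bound[of 1 "norm (rep_L2 u x)"] by simp
      then have "norm (rep_L2 u x) \<le> 1 + (norm (rep_L2 u x))\<^sup>2"
        using norm_ge_zero[of "rep_L2 u x"] by linarith
      then show "norm (rep_L2 u x) \<le> norm (1 + (norm (rep_L2 u x))\<^sup>2)" by simp
    qed
  qed (rule rep_measurable)
qed

lemma rep_component_measurable [measurable]:
  "(\<lambda>x. rep_L2 u x $ i) \<in> borel_measurable (lebesgue_on Omega)"
proof -
  have "(\<lambda>x. rep_L2 u x \<bullet> axis i 1) \<in> borel_measurable (lebesgue_on Omega)" by measurable
  then show ?thesis by (simp add: inner_axis)
qed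

lemma integrable_scaleR_rep:
  fixes f :: "real ^ 3 \<Rightarrow> real"
  assumes "continuous_on UNIV f"
  shows "integrable (lebesgue_on Omega) (\<lambda>x. f x *\<^sub>R rep_L2 u x)"
proof (rule continuous_bounded_Omega[OF assms])
  fix B assume B: "0 \<le> B" "\<And>x. x \<in> Omega \<Longrightarrow> norm (f x) \<le> B"
  show ?thesis
  proof (rule Bochner_Integration.integrable_bound)
    show "integrable (lebesgue_on Omega) (\<lambda>x. B * norm (rep_L2 u x))" by simp
    show "(\<lambda>x. f x *\<^sub>R rep_L2 u x) \<in> borel_measurable (lebesgue_on Omega)"
      using continuous_measurable_Omega[OF assms] by measurable
    show "AE x in lebesgue_on Omega. norm (f x *\<^sub>R rep_L2 u x) \<le> norm (B * norm (rep_L2 u x))"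
      using B by (auto intro!: AE_I2 mult_right_mono)
  qed
qed

text \<open>No boundary condition is imposed on \<open>\<phi>\<close>: since \<open>\<partial>\<^sub>j\<close> of the eigenfunction vanishes
  on the faces \<open>x\<^sub>j \<in> {0, \<pi>}\<close>, the product with the derivative of the cutoff stays bounded.\<close>

lemma deigf_inner:
  assumes "weak_partial j \<phi> d\<phi>"
  shows "deigf n i j \<bullet> d\<phi> = (real (n j))\<^sup>2 * (eigf n i \<bullet> \<phi>)"
proof -
  let ?M = "lebesgue_on Omega"
  define \<psi> where "\<psi> = (\<lambda>k. tensor (bump n j (real (Suc k))))"
  define D where "D = (\<lambda>k. tensor ((bump n j (real (Suc k)))(j := bump' n j (real (Suc k)) j)))"
  have cont\<psi>: "continuous_on UNIV (\<psi> k)" for k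
    unfolding \<psi>_def
    by (rule continuous_tensor, rule DERIV_continuous_on, rule has_field_derivative_at_within, rule bump_has_derivative)
  have t: "test_function (\<psi> k)" for k unfolding \<psi>_def by (rule test_function_bump) simp
  have fr: "frechet_derivative (\<psi> k) (at x) (axis j 1) = D k x" for k x
    unfolding \<psi>_def D_def by (rule frechet_bump)
  have contD: "continuous_on UNIV (D k)" for k
    using test_function_derivative(2)[OF t, of k "axis j 1"] by (simp add: fr)
  have eq: "(LINT x|?M. D k x * rep_L2 \<phi> x $ i) = - (LINT x|?M. \<psi> k x * rep_L2 d\<phi> x $ i)" for k
  proof -
    have "(LINT x|?M. D k x *\<^sub>R rep_L2 \<phi> x) = - (LINT x|?M. \<psi> k x *\<^sub>R rep_L2 d\<phi> x)"
      using assms t[of k] unfolding weak_partial_def fr[symmetric] by blast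
    then have "(LINT x|?M. D k x *\<^sub>R rep_L2 \<phi> x) \<bullet> axis i 1 = - ((LINT x|?M. \<psi> k x *\<^sub>R rep_L2 d\<phi> x) \<bullet> axis i 1)"
      by simp
    then show ?thesis
      unfolding integral_inner_left[symmetric, OF integrable_scaleR_rep[OF contD]]
        integral_inner_left[symmetric, OF integrable_scaleR_rep[OF cont\<psi>]]
      by (simp add: inner_axis)
  qed
  have "(\<lambda>k. LINT x|?M. D k x * rep_L2 \<phi> x $ i) \<longlonglongrightarrow> (LINT x|?M. (- (real (n j))\<^sup>2 * tensor (cosf n) x) * rep_L2 \<phi> x $ i)"
  proof (rule integral_dominated_convergence[where w = "\<lambda>x. (\<Prod>l\<in>UNIV. if l = j then 7 * (real (n j))\<^sup>2 else 1 + real (n l)) * norm (rep_L2 \<phi> x)"])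
    show "(\<lambda>x. - (real (n j))\<^sup>2 * tensor (cosf n) x * rep_L2 \<phi> x $ i) \<in> borel_measurable ?M"
      using continuous_measurable_Omega[OF continuous_tensor_cosf(1)[of n]] by measurable
    show "(\<lambda>x. D k x * rep_L2 \<phi> x $ i) \<in> borel_measurable ?M" for k
      using continuous_measurable_Omega[OF contD[of k]] by measurable
    show "AE x in ?M. (\<lambda>k. D k x * rep_L2 \<phi> x $ i) \<longlonglongrightarrow> - (real (n j))\<^sup>2 * tensor (cosf n) x * rep_L2 \<phi> x $ i"
    proof (rule AE_I2)
      fix x assume "x \<in> space ?M"
      then have x: "0 < x $ l" "x $ l < pi" for l by (auto simp: mem_Omega)
      have "(\<lambda>k. bump n j (real (Suc k)) l (x $ l)) \<longlonglongrightarrow> 1 * cosf n l (x $ l)" if "l \<noteq> j" for l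
        unfolding bump_def using that x[of l] by (simp add: tendsto_mult[OF cutoff_limit(1) tendsto_const, simplified])
      moreover have "(\<lambda>k. bump' n j (real (Suc k)) j (x $ j)) \<longlonglongrightarrow> 0 * sinf n j (x $ j) + 1 * (- (real (n j))\<^sup>2 * cosf n j (x $ j))"
        unfolding bump'_def using x[of j] by (simp only: if_True simp_thms) (intro tendsto_intros cutoff_limit)
      ultimately have "(\<lambda>k. D k x) \<longlonglongrightarrow> (\<Prod>l\<in>UNIV. if l = j then - (real (n j))\<^sup>2 * cosf n j (x $ j) else cosf n l (x $ l))"
        unfolding D_def tensor_def by (intro tendsto_prod) auto
      also have "(\<Prod>l\<in>UNIV. if l = j then - (real (n j))\<^sup>2 * cosf n j (x $ j) else cosf n l (x $ l)) =
          - (real (n j))\<^sup>2 * tensor (cosf n) x"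
        unfolding tensor_def by (simp add: prod.remove[of UNIV j])
      finally show "(\<lambda>k. D k x * rep_L2 \<phi> x $ i) \<longlonglongrightarrow> - (real (n j))\<^sup>2 * tensor (cosf n) x * rep_L2 \<phi> x $ i"
        by (intro tendsto_mult tendsto_const)
    qed
    show "AE x in ?M. norm (D k x * rep_L2 \<phi> x $ i) \<le>
        (\<Prod>l\<in>UNIV. if l = j then 7 * (real (n j))\<^sup>2 else 1 + real (n l)) * norm (rep_L2 \<phi> x)" for k
    proof (rule AE_I2)
      fix x assume "x \<in> space ?M"
      then have x: "x \<in> Omega" by simp
      have "\<bar>D k x\<bar> \<le> (\<Prod>l\<in>UNIV. if l = j then 7 * (real (n j))\<^sup>2 else 1 + real (n l))"
        unfolding D_def by (rule abs_tensor_le) (use abs_bump_le[OF x] in auto)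
      then show "norm (D k x * rep_L2 \<phi> x $ i) \<le>
          (\<Prod>l\<in>UNIV. if l = j then 7 * (real (n j))\<^sup>2 else 1 + real (n l)) * norm (rep_L2 \<phi> x)"
        using component_le_norm_cart[of "rep_L2 \<phi> x" i]
        by (auto simp: abs_mult intro!: mult_mono prod_nonneg)
    qed
  qed simp
  moreover have "(\<lambda>k. LINT x|?M. \<psi> k x * rep_L2 d\<phi> x $ i) \<longlonglongrightarrow> (LINT x|?M. tensor ((cosf n)(j := sinf n j)) x * rep_L2 d\<phi> x $ i)"
  proof (rule integral_dominated_convergence[where w = "\<lambda>x. (\<Prod>l\<in>UNIV. 1 + real (n l)) * norm (rep_L2 d\<phi> x)"])
    show "(\<lambda>x. tensor ((cosf n)(j := sinf n j)) x * rep_L2 d\<phi> x $ i) \<in> borel_measurable ?M"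
      using continuous_measurable_Omega[OF continuous_tensor_cosf(2)[of n j]] by measurable
    show "(\<lambda>x. \<psi> k x * rep_L2 d\<phi> x $ i) \<in> borel_measurable ?M" for k
      using continuous_measurable_Omega[OF cont\<psi>[of k]] by measurable
    show "AE x in ?M. (\<lambda>k. \<psi> k x * rep_L2 d\<phi> x $ i) \<longlonglongrightarrow> tensor ((cosf n)(j := sinf n j)) x * rep_L2 d\<phi> x $ i"
    proof (rule AE_I2)
      fix x assume "x \<in> space ?M"
      then have x: "0 < x $ l" "x $ l < pi" for l by (auto simp: mem_Omega)
      have eq: "((cosf n)(j := sinf n j)) l t = 1 * (if l = j then sinf n j t else cosf n l t)" for l t
        by simp
      have "(\<lambda>k. bump n j (real (Suc k)) l (x $ l)) \<longlonglongrightarrow> ((cosf n)(j := sinf n j)) l (x $ l)" for l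
        unfolding bump_def eq by (intro tendsto_mult cutoff_limit x tendsto_const)
      then have "(\<lambda>k. \<psi> k x) \<longlonglongrightarrow> tensor ((cosf n)(j := sinf n j)) x"
        unfolding \<psi>_def tensor_def by (intro tendsto_prod)
      then show "(\<lambda>k. \<psi> k x * rep_L2 d\<phi> x $ i) \<longlonglongrightarrow> tensor ((cosf n)(j := sinf n j)) x * rep_L2 d\<phi> x $ i"
        by (intro tendsto_mult tendsto_const)
    qed
    show "AE x in ?M. norm (\<psi> k x * rep_L2 d\<phi> x $ i) \<le> (\<Prod>l\<in>UNIV. 1 + real (n l)) * norm (rep_L2 d\<phi> x)" for k
    proof (rule AE_I2)
      fix x assume "x \<in> space ?M"
      then have x: "x \<in> Omega" by simp
      have "\<bar>\<psi> k x\<bar> \<le> (\<Prod>l\<in>UNIV. 1 + real (n l))"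
        unfolding \<psi>_def by (rule abs_tensor_le) (use abs_bump_le(1)[OF x] in auto)
      then show "norm (\<psi> k x * rep_L2 d\<phi> x $ i) \<le> (\<Prod>l\<in>UNIV. 1 + real (n l)) * norm (rep_L2 d\<phi> x)"
        using component_le_norm_cart[of "rep_L2 d\<phi> x" i]
        by (auto simp: abs_mult intro!: mult_mono prod_nonneg)
    qed
  qed simp
  ultimately have "(LINT x|?M. (- (real (n j))\<^sup>2 * tensor (cosf n) x) * rep_L2 \<phi> x $ i) =
      - (LINT x|?M. tensor ((cosf n)(j := sinf n j)) x * rep_L2 d\<phi> x $ i)"
    unfolding eq by (intro LIMSEQ_unique[OF _ tendsto_minus])
  then have "(real (n j))\<^sup>2 * (LINT x|?M. tensor (cosf n) x * rep_L2 \<phi> x $ i) =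
      (LINT x|?M. tensor ((cosf n)(j := sinf n j)) x * rep_L2 d\<phi> x $ i)"
    by (simp add: mult.assoc)
  moreover have "eigf n i \<bullet> \<phi> = (LINT x|?M. tensor (cosf n) x * rep_L2 \<phi> x $ i)"
    using inner_abs_L2[OF square_integrable_eigf(1)[of n i] square_integrable_rep[of \<phi>]]
    by (simp add: eigf_def inner_axis' mult.commute)
  moreover have "deigf n i j \<bullet> d\<phi> = (LINT x|?M. tensor ((cosf n)(j := sinf n j)) x * rep_L2 d\<phi> x $ i)"
    using inner_abs_L2[OF square_integrable_eigf(2)[of n j i] square_integrable_rep[of d\<phi>]]
    by (simp add: deigf_def inner_axis' mult.commute)
  ultimately show ?thesis by simp
qed

text \<open>The eigenvalue of \<open>- \<Delta>\<close> belonging to \<open>eigf n i\<close>. As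
  \<open>n\<close> varies, its values are exactly the sums of three squares.\<close>

definition freq :: "(3 \<Rightarrow> nat) \<Rightarrow> real"
  where "freq n = (\<Sum>j\<in>UNIV. (real (n j))\<^sup>2)"

lemma is_neumann_eigf: "is_neumann (eigf n i) ((1 + freq n) *\<^sub>R eigf n i)"
  unfolding is_neumann_def
proof (intro exI[of _ "deigf n i"] conjI allI impI)
  fix \<phi> d\<phi> assume "\<forall>j. weak_partial j \<phi> (d\<phi> j)"
  then have "deigf n i j \<bullet> d\<phi> j = (real (n j))\<^sup>2 * (eigf n i \<bullet> \<phi>)" for j
    by (intro deigf_inner) blast
  then have "(\<Sum>j\<in>UNIV. deigf n i j \<bullet> d\<phi> j) = freq n * (eigf n i \<bullet> \<phi>)"
    by (simp add: freq_def sum_distrib_right)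
  then show "(\<Sum>j\<in>UNIV. deigf n i j \<bullet> d\<phi> j) + eigf n i \<bullet> \<phi> = (1 + freq n) *\<^sub>R eigf n i \<bullet> \<phi>"
    by (simp add: distrib_right)
qed (rule weak_partial_eigf)

text \<open>For modes in the same component choose a direction \<open>j\<close> in which the
  frequencies differ. Integrating by parts either way evaluates the inner product of the
  \<open>j\<close>-th derivatives as two different multiples of the inner product of the modes,
  which must then be 0.\<close>

lemma eigf_orthogonal:
  assumes "(n, i) \<noteq> (n', i')"
  shows "eigf n i \<bullet> eigf n' i' = 0"
proof (cases "i = i'")
  case True
  then obtain j where j: "n j \<noteq> n' j" using assms by auto
  have "(real (n j))\<^sup>2 * (eigf n i \<bullet> eigf n' i') = (real (n' j))\<^sup>2 * (eigf n i \<bullet> eigf n' i')"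
    using deigf_inner[OF weak_partial_eigf, of n i j n' i'] deigf_inner[OF weak_partial_eigf, of n' i' j n i]
    by (simp add: inner_commute)
  moreover have "(real (n j))\<^sup>2 \<noteq> (real (n' j))\<^sup>2" using j by simp
  ultimately show ?thesis by simp
next
  case False
  then show ?thesis
    using inner_abs_L2[OF square_integrable_eigf(1)[of n i] square_integrable_eigf(1)[of n' i']]
    by (simp add: eigf_def inner_axis_axis)
qed

section \<open>Completeness of the eigenfunctions\<close>

inductive cospoly :: "(real ^ 3 \<Rightarrow> real) \<Rightarrow> bool" where
  tens: "cospoly (tensor (cosf n))"
| cmult: "cospoly h \<Longrightarrow> cospoly (\<lambda>x. c * h x)"
| add: "cospoly f \<Longrightarrow> cospoly g \<Longrightarrow> cospoly (\<lambda>x. f x + g x)"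

lemma cospoly_zero: "cospoly (\<lambda>x. 0)"
  using cospoly.cmult[OF cospoly.tens, of 0] by simp

lemma cospoly_sum: "finite I \<Longrightarrow> (\<And>i. i \<in> I \<Longrightarrow> cospoly (f i)) \<Longrightarrow> cospoly (\<lambda>x. \<Sum>i\<in>I. f i x)"
  by (induction I rule: finite_induct) (auto intro: cospoly_zero cospoly.add)

lemma continuous_cospoly: "cospoly h \<Longrightarrow> continuous_on UNIV h"
  by (induction rule: cospoly.induct) (auto intro!: continuous_intros continuous_tensor_cosf)

lemma tensor_cosf_upd:
  "tensor (cosf (n(i := k))) x = cos (real k * x $ i) * (\<Prod>j\<in>UNIV - {i}. cosf n j (x $ j))"
  by (simp add: tensor_def prod.remove[of UNIV i] cosf_def)

text \<open>Product formula \<open>2 cos t cos (k t) = cos ((k + 1) t) + cos ((k - 1) t)\<close>.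
  For \<open>k = 0\<close> the frequency -1 is replaced by 1, as the cosine is even.\<close>

lemma cospoly_mult_cos: "cospoly h \<Longrightarrow> cospoly (\<lambda>x. cos (x $ i) * h x)"
proof (induction rule: cospoly.induct)
  case (tens n)
  have eq: "cos (x $ i) * tensor (cosf n) x =
      1 / 2 * tensor (cosf (n(i := Suc (n i)))) x + 1 / 2 * tensor (cosf (n(i := if n i = 0 then 1 else n i - 1))) x"
    for x :: "real ^ 3"
  proof -
    have "cos (x $ i) * cos (real (n i) * x $ i) =
        1 / 2 * cos (real (Suc (n i)) * x $ i) + 1 / 2 * cos (real (if n i = 0 then 1 else n i - 1) * x $ i)"
    proof (cases "n i")
      case (Suc k)
      then have "real (n i) = real k + 1" by simp
      then show ?thesis unfolding Suc
        by (simp add: cos_times_cos algebra_simps)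
    qed simp
    moreover have "tensor (cosf n) x = cos (real (n i) * x $ i) * (\<Prod>j\<in>UNIV - {i}. cosf n j (x $ j))"
      using tensor_cosf_upd[of n i "n i" x] by simp
    ultimately show ?thesis unfolding tensor_cosf_upd
      by (simp add: mult.assoc[symmetric] distrib_right)
  qed
  show ?case unfolding eq by (intro cospoly.intros)
next
  case (cmult h c)
  then show ?case using cospoly.cmult[of "\<lambda>x. cos (x $ i) * h x" c] by (simp add: mult.left_commute)
next
  case (add f g)
  then show ?case using cospoly.add by (simp add: distrib_left)
qed

lemma cospoly_mult_poly:
  assumes "real_polynomial_function p"
  shows "cospoly h \<Longrightarrow> cospoly (\<lambda>x. p (\<chi> i. cos (x $ i)) * h x)"
  using assms
proof (induction p arbitrary: h rule: real_polynomial_function.induct)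
  case (linear f)
  have expand: "f y = (\<Sum>i\<in>UNIV. f (axis i 1) * y $ i)" for y :: "real ^ 3"
  proof -
    have "f y = f (\<Sum>i\<in>UNIV. (y $ i) *\<^sub>R axis i 1)"
      using basis_expansion[of y] by (simp add: scalar_mult_eq_scaleR)
    then show ?thesis
      by (simp add: linear_sum[OF bounded_linear.linear[OF linear(1)]]
          linear_scale[OF bounded_linear.linear[OF linear(1)]] mult.commute)
  qed
  have "(\<lambda>x. f (\<chi> i. cos (x $ i)) * h x) = (\<lambda>x. \<Sum>i\<in>UNIV. f (axis i 1) * (cos (x $ i) * h x))"
    by (subst expand) (simp add: sum_distrib_right mult.assoc)
  moreover have "cospoly (\<lambda>x. \<Sum>i\<in>UNIV. f (axis i 1) * (cos (x $ i) * h x))"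
    by (intro cospoly_sum cospoly.cmult cospoly_mult_cos linear) simp
  ultimately show ?case by simp
next
  case (const c)
  then show ?case by (simp add: cospoly.cmult)
next
  case (add f g)
  then show ?case using cospoly.add by (simp add: distrib_right)
next
  case (mult f g)
  then show ?case by (simp add: mult.assoc)
qed

text \<open>The substitution \<open>y = cos x\<close>, taken componentwise, maps the closed cube
  homeomorphically onto \<open>[-1, 1]^3\<close>, where polynomials in \<open>y\<close> are dense.
  The tensor with frequency 0 is the constant 1 on which the multiplication by the polynomial
  starts.\<close>

lemma cospoly_approx:
  fixes f :: "real ^ 3 \<Rightarrow> real"
  assumes f: "continuous_on UNIV f" and "0 < e"
  obtains h where "cospoly h" "\<And>x. x \<in> Omega \<Longrightarrow> \<bar>f x - h x\<bar> < e"
proof -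
  let ?S = "cbox (\<chi> i. -1) (\<chi> i. 1) :: (real ^ 3) set"
  have "continuous_on ?S (\<lambda>y. f (\<chi> i. arccos (y $ i)))"
    by (intro continuous_on_compose2[OF f] continuous_on_vec_lambda continuous_on_arccos continuous_intros)
      (auto simp: mem_box_cart)
  then obtain g where g: "real_polynomial_function g"
    "\<And>y. y \<in> ?S \<Longrightarrow> \<bar>f (\<chi> i. arccos (y $ i)) - g y\<bar> < e"
    using Stone_Weierstrass_real_polynomial_function[OF compact_cbox _ \<open>0 < e\<close>] by blast
  show thesis
  proof (rule that)
    show "cospoly (\<lambda>x. g (\<chi> i. cos (x $ i)) * tensor (cosf (\<lambda>_. 0)) x)"
      by (rule cospoly_mult_poly[OF g(1) cospoly.tens])
    fix x assume "x \<in> Omega"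
    then have "0 \<le> x $ i \<and> x $ i \<le> pi" for i by (auto simp: mem_Omega less_imp_le)
    then have "(\<chi> i. arccos ((\<chi> i. cos (x $ i)) $ i)) = x" by (simp add: vec_eq_iff arccos_cos)
    moreover have "(\<chi> i. cos (x $ i)) \<in> ?S" by (simp add: mem_box_cart)
    ultimately show "\<bar>f x - g (\<chi> i. cos (x $ i)) * tensor (cosf (\<lambda>_. 0)) x\<bar> < e"
      using g(2)[of "\<chi> i. cos (x $ i)"] by (simp add: tensor_def cosf_def)
  qed
qed

abbreviation eigspan :: "L2 set"
  where "eigspan \<equiv> span (range (\<lambda>(n, i). eigf n i))"

lemma cospoly_in_eigspan: "cospoly h \<Longrightarrow> abs_L2 (\<lambda>x. h x *\<^sub>R axis i 1) \<in> eigspan"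
proof (induction rule: cospoly.induct)
  case (tens n)
  have "eigf n i \<in> range (\<lambda>(n, i). eigf n i)" by force
  then show ?case unfolding eigf_def[symmetric] by (rule span_base)
next
  case (cmult h c)
  have "square_integrable (\<lambda>x. h x *\<^sub>R axis i 1)"
    by (intro square_integrable_continuous continuous_intros continuous_cospoly cmult.hyps)
  then show ?case using span_scale[OF cmult.IH, of c] by (simp add: abs_L2_scaleR)
next
  case (add f g)
  have "square_integrable (\<lambda>x. f x *\<^sub>R axis i 1)" "square_integrable (\<lambda>x. g x *\<^sub>R axis i 1)"
    by (intro square_integrable_continuous continuous_intros continuous_cospoly add.hyps)+
  then show ?case using span_add[OF add.IH] by (simp add: abs_L2_add scaleR_add_left)
qed

lemma continuous_in_closure_eigspan:
  fixes f :: "real ^ 3 \<Rightarrow> real ^ 2"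
  assumes f: "continuous_on UNIV f"
  shows "abs_L2 f \<in> closure eigspan"
  unfolding closure_approachable
proof (intro allI impI)
  fix e :: real assume "0 < e"
  define d where "d = e / (2 * (vol + 1))"
  have d: "0 < d" using \<open>0 < e\<close> vol_nonneg by (simp add: d_def)
  have "\<exists>h. cospoly h \<and> (\<forall>x\<in>Omega. \<bar>f x $ i - h x\<bar> < d)" for i
    using cospoly_approx[of "\<lambda>x. f x $ i" d, OF _ d] f by (metis continuous_on_component)
  then obtain h where h: "\<And>i. cospoly (h i)" "\<And>i x. x \<in> Omega \<Longrightarrow> \<bar>f x $ i - h i x\<bar> < d" by metis
  have sq: "square_integrable (\<lambda>x. h i x *\<^sub>R axis i 1)" for i
    by (intro square_integrable_continuous continuous_intros continuous_cospoly h)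
  let ?g = "\<lambda>x. h 1 x *\<^sub>R axis 1 1 + h 2 x *\<^sub>R axis 2 1 :: real ^ 2"
  have g: "continuous_on UNIV ?g" by (intro continuous_intros continuous_cospoly h)
  have "abs_L2 ?g = abs_L2 (\<lambda>x. h 1 x *\<^sub>R axis 1 1) + abs_L2 (\<lambda>x. h 2 x *\<^sub>R axis 2 1)"
    by (simp add: abs_L2_add sq)
  then have mem: "abs_L2 ?g \<in> eigspan" by (simp add: span_add cospoly_in_eigspan h)
  have "norm (abs_L2 (\<lambda>x. ?g x - f x)) \<le> (2 * d) * vol"
  proof (rule norm_abs_L2_bound)
    show "(\<lambda>x. ?g x - f x) \<in> borel_measurable (lebesgue_on Omega)"
      by (intro continuous_measurable_Omega continuous_intros g f)
    fix x assume x: "x \<in> Omega"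
    have "norm (?g x - f x) \<le> (\<Sum>i\<in>UNIV. \<bar>(?g x - f x) $ i\<bar>)" by (rule norm_le_l1_cart)
    also have "\<dots> = \<bar>f x $ 1 - h 1 x\<bar> + \<bar>f x $ 2 - h 2 x\<bar>"
      by (simp add: sum_2 axis_def abs_minus_commute)
    also have "\<dots> \<le> 2 * d" using h(2)[OF x, of 1] h(2)[OF x, of 2] by simp
    finally show "norm (?g x - f x) \<le> 2 * d" .
  qed (use d in simp)
  also have "\<dots> < e" using \<open>0 < e\<close> vol_nonneg by (simp add: d_def field_simps)
  finally have "dist (abs_L2 ?g) (abs_L2 f) < e"
    by (simp add: dist_norm abs_L2_diff square_integrable_continuous f g)
  with mem show "\<exists>y\<in>eigspan. dist y (abs_L2 f) < e" by blast
qed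

section \<open>Density of the eigenfunctions in the whole phase space\<close>

lemma abs_L2_dominated_convergence:
  assumes f: "\<And>k. square_integrable (f k)" "square_integrable g"
    and w: "square_integrable w"
    and lim: "AE x in lebesgue_on Omega. (\<lambda>k. f k x) \<longlonglongrightarrow> g x"
    and dom: "\<And>k. AE x in lebesgue_on Omega. norm (f k x - g x) \<le> norm (w x)"
  shows "(\<lambda>k. abs_L2 (f k)) \<longlonglongrightarrow> abs_L2 g"
proof -
  have sq: "square_integrable (\<lambda>x. f k x - g x)" for k by (rule square_integrable_diff[OF f(1) f(2)])
  have "(\<lambda>k. LINT x|lebesgue_on Omega. (norm (f k x - g x))\<^sup>2) \<longlonglongrightarrow> (LINT x|lebesgue_on Omega. 0)"
  proof (rule integral_dominated_convergence[where w = "\<lambda>x. (norm (w x))\<^sup>2"])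
    show "AE x in lebesgue_on Omega. (\<lambda>k. (norm (f k x - g x))\<^sup>2) \<longlonglongrightarrow> 0"
      using lim
    proof eventually_elim
      case (elim x)
      then have "(\<lambda>k. (norm (f k x - g x))\<^sup>2) \<longlonglongrightarrow> (norm (g x - g x))\<^sup>2"
        by (intro tendsto_intros)
      then show ?case by simp
    qed
    show "AE x in lebesgue_on Omega. norm ((norm (f k x - g x))\<^sup>2) \<le> (norm (w x))\<^sup>2" for k
      using dom[of k] by eventually_elim (simp add: power_mono)
    show "(\<lambda>x. (norm (f k x - g x))\<^sup>2) \<in> borel_measurable (lebesgue_on Omega)" for k
    proof -
      have "(\<lambda>x. f k x - g x) \<in> borel_measurable (lebesgue_on Omega)"
        using sq[of k] by (simp add: square_integrable_def)
      then show ?thesis by measurable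
    qed
  qed (use w in \<open>simp_all add: square_integrable_def\<close>)
  then have "(\<lambda>k. (norm (abs_L2 (f k) - abs_L2 g))\<^sup>2) \<longlonglongrightarrow> 0"
    by (simp add: abs_L2_diff f norm_abs_L2_square sq)
  then have "(\<lambda>k. sqrt ((norm (abs_L2 (f k) - abs_L2 g))\<^sup>2)) \<longlonglongrightarrow> sqrt 0"
    by (rule tendsto_real_sqrt)
  then show ?thesis by (simp add: tendsto_norm_zero_iff Lim_null[of "\<lambda>k. abs_L2 (f k)"])
qed

definition trunc :: "real \<Rightarrow> real ^ 2 \<Rightarrow> real ^ 2"
  where "trunc R y = (R / max R (norm y)) *\<^sub>R y"

lemma trunc_bound: "0 < R \<Longrightarrow> norm (trunc R y) \<le> R"
  by (auto simp: trunc_def max_def field_simps)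

lemma continuous_trunc: "0 < R \<Longrightarrow> continuous_on UNIV (trunc R)"
  unfolding trunc_def[abs_def] by (intro continuous_intros) (auto simp: max_def)

lemma trunc_eq: "0 < R \<Longrightarrow> norm y \<le> R \<Longrightarrow> trunc R y = y"
  by (simp add: trunc_def max_def)

lemma trunc_diff: "0 < R \<Longrightarrow> norm (trunc R y - y) \<le> norm y"
proof -
  assume R: "0 < R"
  have "trunc R y - y = (R / max R (norm y) - 1) *\<^sub>R y" by (simp add: trunc_def scaleR_diff_left)
  moreover have "0 \<le> R / max R (norm y)" "R / max R (norm y) \<le> 1"
    using R by (auto simp: max_def divide_le_eq_1)
  then have "\<bar>R / max R (norm y) - 1\<bar> \<le> 1" by linarith
  ultimately show ?thesis by (simp add: mult_left_le_one_le)
qed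

text \<open>Continuous functions converging almost everywhere to the representative need not be
  dominated. They are therefore truncated radially at a fixed level, which keeps them continuous and
  permits the first limit; the level tends to infinity in a second one.\<close>

theorem closure_eigspan: "closure eigspan = UNIV"
proof (intro equalityI subset_UNIV subsetI)
  fix u :: L2
  have "rep_L2 u measurable_on Omega" by (simp add: measurable_on_iff_borel_measurable)
  then obtain N g where N: "negligible N" and g: "\<And>n. continuous_on UNIV (g n)"
    and lim: "\<And>x. x \<notin> N \<Longrightarrow> (\<lambda>n. g n x) \<longlonglongrightarrow> (if x \<in> Omega then rep_L2 u x else 0)"
    unfolding measurable_on_def by blast
  have AEN: "AE x in lebesgue_on Omega. x \<notin> N"
  proof -
    have "AE x in lebesgue. x \<notin> N"
      using N by (intro AE_not_in) (simp add: negligible_iff_null_sets)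
    then show ?thesis by (auto simp: AE_restrict_space_iff elim: AE_mp)
  qed
  have R: "0 < real (Suc k)" for k by simp
  have mt: "(\<lambda>x. trunc (real (Suc k)) (rep_L2 u x)) \<in> borel_measurable (lebesgue_on Omega)" for k
    using borel_measurable_continuous_onI[OF continuous_trunc[OF R]] by measurable
  have sqt: "square_integrable (\<lambda>x. trunc (real (Suc k)) (rep_L2 u x))" for k
    by (rule square_integrable_bounded[OF mt trunc_bound[OF R]])
  have ct: "continuous_on UNIV (\<lambda>x. trunc (real (Suc k)) (g n x))" for k n
    by (rule continuous_on_compose2[OF continuous_trunc[OF R] g]) auto
  have inner: "abs_L2 (\<lambda>x. trunc (real (Suc k)) (rep_L2 u x)) \<in> closure eigspan" for k
  proof (rule closed_sequentially[OF closed_closure])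
    show "abs_L2 (\<lambda>x. trunc (real (Suc k)) (g n x)) \<in> closure eigspan" for n
      by (intro continuous_in_closure_eigspan ct)
    show "(\<lambda>n. abs_L2 (\<lambda>x. trunc (real (Suc k)) (g n x))) \<longlonglongrightarrow> abs_L2 (\<lambda>x. trunc (real (Suc k)) (rep_L2 u x))"
    proof (rule abs_L2_dominated_convergence[OF square_integrable_continuous[OF ct] sqt,
          where w = "\<lambda>x. (2 * real (Suc k)) *\<^sub>R axis 1 1"])
      show "AE x in lebesgue_on Omega. (\<lambda>n. trunc (real (Suc k)) (g n x)) \<longlonglongrightarrow> trunc (real (Suc k)) (rep_L2 u x)"
        using AEN AE_space
      proof eventually_elim
        case (elim x)
        then have "(\<lambda>n. g n x) \<longlonglongrightarrow> rep_L2 u x" using lim[of x] by simp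
        then show ?case
          by (rule isCont_tendsto_compose[rotated])
            (use continuous_trunc[OF R, of k] in \<open>simp add: continuous_on_eq_continuous_at\<close>)
      qed
      show "AE x in lebesgue_on Omega. norm (trunc (real (Suc k)) (g n x) - trunc (real (Suc k)) (rep_L2 u x))
          \<le> norm ((2 * real (Suc k)) *\<^sub>R axis 1 1 :: real ^ 2)" for n
      proof (rule AE_I2)
        fix x
        have "norm (trunc (real (Suc k)) (g n x) - trunc (real (Suc k)) (rep_L2 u x)) \<le> real (Suc k) + real (Suc k)"
          by (rule order_trans[OF norm_triangle_ineq4 add_mono[OF trunc_bound[OF R] trunc_bound[OF R]]])
        then show "norm (trunc (real (Suc k)) (g n x) - trunc (real (Suc k)) (rep_L2 u x))
          \<le> norm ((2 * real (Suc k)) *\<^sub>R axis 1 1 :: real ^ 2)" by simp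
      qed
    qed (intro square_integrable_continuous continuous_intros)
  qed
  show "u \<in> closure eigspan"
  proof (rule closed_sequentially[OF closed_closure])
    show "abs_L2 (\<lambda>x. trunc (real (Suc k)) (rep_L2 u x)) \<in> closure eigspan" for k by (rule inner)
    have "(\<lambda>k. abs_L2 (\<lambda>x. trunc (real (Suc k)) (rep_L2 u x))) \<longlonglongrightarrow> abs_L2 (rep_L2 u)"
    proof (rule abs_L2_dominated_convergence[OF sqt square_integrable_rep square_integrable_rep[of u]])
      show "AE x in lebesgue_on Omega. (\<lambda>k. trunc (real (Suc k)) (rep_L2 u x)) \<longlonglongrightarrow> rep_L2 u x"
      proof (rule AE_I2)
        fix x
        obtain K :: nat where "norm (rep_L2 u x) \<le> real K" using real_arch_simple by blast
        then have "\<forall>\<^sub>F k in sequentially. trunc (real (Suc k)) (rep_L2 u x) = rep_L2 u x"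
          by (intro eventually_sequentiallyI[of K] trunc_eq) auto
        then show "(\<lambda>k. trunc (real (Suc k)) (rep_L2 u x)) \<longlonglongrightarrow> rep_L2 u x"
          by (rule tendsto_eventually)
      qed
    qed (auto intro!: AE_I2 trunc_diff)
    then show "(\<lambda>k. abs_L2 (\<lambda>x. trunc (real (Suc k)) (rep_L2 u x))) \<longlonglongrightarrow> u" by simp
  qed
qed

lemma linear_eq_on_eigf:
  assumes "bounded_linear f" "bounded_linear g" "\<And>n i. f (eigf n i) = g (eigf n i)"
  shows "f = g"
proof
  fix u :: L2
  have "f u - g u = 0" if "u \<in> eigspan" for u
  proof -
    have "f u = g u"
      by (rule linear_eq_on_span[OF bounded_linear.linear[OF assms(1)] bounded_linear.linear[OF assms(2)] _ that])
        (use assms(3) in auto)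
    then show ?thesis by simp
  qed
  then have "f u - g u = 0"
    by (intro continuous_constant_on_closure[of eigspan "\<lambda>u. f u - g u" 0 u])
      (auto simp: closure_eigspan intro!: linear_continuous_on bounded_linear_sub assms)
  then show "f u = g u" by simp
qed

lemma orthogonal_eigf_imp_zero:
  assumes "\<And>n i. w \<bullet> eigf n i = 0"
  shows "w = 0"
proof -
  have "(\<lambda>v. w \<bullet> v) = (\<lambda>v. 0)"
    by (rule linear_eq_on_eigf) (use assms in \<open>auto intro: bounded_linear_inner_right\<close>)
  then have "w \<bullet> w = 0" by metis
  then show ?thesis by simp
qed

section \<open>The operator \<open>A\<close>\<close>

lemma rep_add_AE: "AE x in lebesgue_on Omega. rep_L2 (u + v) x = rep_L2 u x + rep_L2 v x"
  using rep_abs_AE[OF square_integrable_add[OF square_integrable_rep[of u] square_integrable_rep[of v]]]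
  by (simp add: abs_L2_add[symmetric])

lemma rep_scaleR_AE: "AE x in lebesgue_on Omega. rep_L2 (c *\<^sub>R u) x = c *\<^sub>R rep_L2 u x"
  using rep_abs_AE[OF square_integrable_scaleR[OF square_integrable_rep[of u], of c]]
  by (simp add: abs_L2_scaleR[symmetric])

text \<open>The chosen representative of a sum is the sum of the representatives only almost
  everywhere, so linearity holds under the integral and not pointwise.\<close>

lemma integral_mult_rep_linear:
  fixes \<psi> :: "real ^ 3 \<Rightarrow> real"
  assumes "continuous_on UNIV \<psi>"
  shows "(LINT x|lebesgue_on Omega. \<psi> x *\<^sub>R rep_L2 (u + v) x) =
      (LINT x|lebesgue_on Omega. \<psi> x *\<^sub>R rep_L2 u x) + (LINT x|lebesgue_on Omega. \<psi> x *\<^sub>R rep_L2 v x)"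
    and "(LINT x|lebesgue_on Omega. \<psi> x *\<^sub>R rep_L2 (c *\<^sub>R u) x) =
      c *\<^sub>R (LINT x|lebesgue_on Omega. \<psi> x *\<^sub>R rep_L2 u x)"
proof -
  note int = integrable_scaleR_rep[OF assms]
  have "(LINT x|lebesgue_on Omega. \<psi> x *\<^sub>R rep_L2 (u + v) x) =
      (LINT x|lebesgue_on Omega. \<psi> x *\<^sub>R rep_L2 u x + \<psi> x *\<^sub>R rep_L2 v x)"
  proof (rule integral_cong_AE)
    show "AE x in lebesgue_on Omega. \<psi> x *\<^sub>R rep_L2 (u + v) x = \<psi> x *\<^sub>R rep_L2 u x + \<psi> x *\<^sub>R rep_L2 v x"
      using rep_add_AE[of u v] by eventually_elim (simp add: scaleR_add_right)
  qed (use int in \<open>auto intro!: borel_measurable_integrable\<close>)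
  then show "(LINT x|lebesgue_on Omega. \<psi> x *\<^sub>R rep_L2 (u + v) x) =
      (LINT x|lebesgue_on Omega. \<psi> x *\<^sub>R rep_L2 u x) + (LINT x|lebesgue_on Omega. \<psi> x *\<^sub>R rep_L2 v x)"
    by (simp add: Bochner_Integration.integral_add int)
  have "(LINT x|lebesgue_on Omega. \<psi> x *\<^sub>R rep_L2 (c *\<^sub>R u) x) =
      (LINT x|lebesgue_on Omega. c *\<^sub>R (\<psi> x *\<^sub>R rep_L2 u x))"
  proof (rule integral_cong_AE)
    show "AE x in lebesgue_on Omega. \<psi> x *\<^sub>R rep_L2 (c *\<^sub>R u) x = c *\<^sub>R (\<psi> x *\<^sub>R rep_L2 u x)"
      using rep_scaleR_AE[of c u] by eventually_elim simp
  qed (intro borel_measurable_integrable integrable_scaleR_right int)+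
  then show "(LINT x|lebesgue_on Omega. \<psi> x *\<^sub>R rep_L2 (c *\<^sub>R u) x) =
      c *\<^sub>R (LINT x|lebesgue_on Omega. \<psi> x *\<^sub>R rep_L2 u x)"
    by (simp add: int del: scaleR_scaleR)
qed

lemma test_function_continuous: "test_function \<psi> \<Longrightarrow> continuous_on UNIV \<psi>"
  using test_function_derivative(1)
  by (auto intro!: has_derivative_continuous continuous_at_imp_continuous_on)

lemma weak_partial_add: "weak_partial j u d \<Longrightarrow> weak_partial j v e \<Longrightarrow> weak_partial j (u + v) (d + e)"
  unfolding weak_partial_def
  by (simp add: integral_mult_rep_linear(1) test_function_continuous test_function_derivative(2))

lemma weak_partial_scaleR: "weak_partial j u d \<Longrightarrow> weak_partial j (c *\<^sub>R u) (c *\<^sub>R d)"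
  unfolding weak_partial_def
  by (simp add: integral_mult_rep_linear(2) test_function_continuous test_function_derivative(2))

lemma is_neumann_add:
  assumes "is_neumann u w" "is_neumann v z"
  shows "is_neumann (u + v) (w + z)"
proof -
  obtain du dv where d: "\<forall>j. weak_partial j u (du j)" "\<forall>j. weak_partial j v (dv j)"
    "\<forall>\<phi> d\<phi>. (\<forall>j. weak_partial j \<phi> (d\<phi> j)) \<longrightarrow> (\<Sum>j\<in>UNIV. du j \<bullet> d\<phi> j) + u \<bullet> \<phi> = w \<bullet> \<phi>"
    "\<forall>\<phi> d\<phi>. (\<forall>j. weak_partial j \<phi> (d\<phi> j)) \<longrightarrow> (\<Sum>j\<in>UNIV. dv j \<bullet> d\<phi> j) + v \<bullet> \<phi> = z \<bullet> \<phi>"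
    using assms unfolding is_neumann_def by blast
  show ?thesis unfolding is_neumann_def
  proof (intro exI[of _ "\<lambda>j. du j + dv j"] conjI allI impI)
    fix \<phi> d\<phi> assume "\<forall>j. weak_partial j \<phi> (d\<phi> j)"
    then have "(\<Sum>j\<in>UNIV. du j \<bullet> d\<phi> j) + u \<bullet> \<phi> = w \<bullet> \<phi>" "(\<Sum>j\<in>UNIV. dv j \<bullet> d\<phi> j) + v \<bullet> \<phi> = z \<bullet> \<phi>"
      using d by blast+
    then show "(\<Sum>j\<in>UNIV. (du j + dv j) \<bullet> d\<phi> j) + (u + v) \<bullet> \<phi> = (w + z) \<bullet> \<phi>"
      by (simp add: inner_add_left sum.distrib)
  qed (use d weak_partial_add in blast)
qed

lemma is_neumann_scaleR:
  assumes "is_neumann u w"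
  shows "is_neumann (c *\<^sub>R u) (c *\<^sub>R w)"
proof -
  obtain du where d: "\<forall>j. weak_partial j u (du j)"
    "\<forall>\<phi> d\<phi>. (\<forall>j. weak_partial j \<phi> (d\<phi> j)) \<longrightarrow> (\<Sum>j\<in>UNIV. du j \<bullet> d\<phi> j) + u \<bullet> \<phi> = w \<bullet> \<phi>"
    using assms unfolding is_neumann_def by blast
  show ?thesis unfolding is_neumann_def
  proof (intro exI[of _ "\<lambda>j. c *\<^sub>R du j"] conjI allI impI)
    fix \<phi> d\<phi> assume "\<forall>j. weak_partial j \<phi> (d\<phi> j)"
    then have "(\<Sum>j\<in>UNIV. du j \<bullet> d\<phi> j) + u \<bullet> \<phi> = w \<bullet> \<phi>" using d by blast
    then have "c * ((\<Sum>j\<in>UNIV. du j \<bullet> d\<phi> j) + u \<bullet> \<phi>) = c * (w \<bullet> \<phi>)" by simp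
    then show "(\<Sum>j\<in>UNIV. (c *\<^sub>R du j) \<bullet> d\<phi> j) + (c *\<^sub>R u) \<bullet> \<phi> = (c *\<^sub>R w) \<bullet> \<phi>"
      by (simp add: distrib_left sum_distrib_left)
  qed (use d weak_partial_scaleR in blast)
qed

text \<open>The two values may come with different weak gradients of \<open>u\<close>. Tested
  against an eigenfunction, however, \<open>deigf_inner\<close> expresses the gradient term through
  \<open>u\<close> alone, and by completeness these tests determine the value.\<close>

lemma is_neumann_unique:
  assumes "is_neumann u w" "is_neumann u w'"
  shows "w = w'"
proof -
  have "w \<bullet> eigf n i = w' \<bullet> eigf n i" for n i
  proof -
    obtain du dv where d: "\<forall>j. weak_partial j u (du j)" "\<forall>j. weak_partial j u (dv j)"
      "(\<Sum>j\<in>UNIV. du j \<bullet> deigf n i j) + u \<bullet> eigf n i = w \<bullet> eigf n i"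
      "(\<Sum>j\<in>UNIV. dv j \<bullet> deigf n i j) + u \<bullet> eigf n i = w' \<bullet> eigf n i"
      using assms weak_partial_eigf unfolding is_neumann_def by blast
    have "du j \<bullet> deigf n i j = dv j \<bullet> deigf n i j" for j
      using deigf_inner[of j u "du j" n i] deigf_inner[of j u "dv j" n i] d(1,2) by (simp add: inner_commute)
    then show ?thesis using d(3,4) by simp
  qed
  then have "w - w' = 0" by (intro orthogonal_eigf_imp_zero) (simp add: inner_diff_left)
  then show ?thesis by simp
qed

lemma A_op_eqI: "is_neumann u w \<Longrightarrow> A_op u = w"
  unfolding A_op_def using is_neumann_unique by blast

lemma X1_iff: "u \<in> X1 \<longleftrightarrow> is_neumann u (A_op u)"
  unfolding X1_def using A_op_eqI by auto

lemma X1I: "is_neumann u w \<Longrightarrow> u \<in> X1 \<and> A_op u = w"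
  unfolding X1_def using A_op_eqI by blast

lemma A_op_add: "u \<in> X1 \<Longrightarrow> v \<in> X1 \<Longrightarrow> u + v \<in> X1 \<and> A_op (u + v) = A_op u + A_op v"
  by (rule X1I, rule is_neumann_add) (simp_all only: X1_iff)

lemma A_op_scaleR: "u \<in> X1 \<Longrightarrow> c *\<^sub>R u \<in> X1 \<and> A_op (c *\<^sub>R u) = c *\<^sub>R A_op u"
  by (rule X1I, rule is_neumann_scaleR) (simp only: X1_iff)

lemma A_op_eigf: "eigf n i \<in> X1 \<and> A_op (eigf n i) = (1 + freq n) *\<^sub>R eigf n i"
  by (rule X1I, rule is_neumann_eigf)

lemma A_op_nonneg:
  assumes "u \<in> X1"
  shows "0 \<le> A_op u \<bullet> u"
proof -
  obtain du where "\<forall>j. weak_partial j u (du j)"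
    "\<forall>\<phi> d\<phi>. (\<forall>j. weak_partial j \<phi> (d\<phi> j)) \<longrightarrow> (\<Sum>j\<in>UNIV. du j \<bullet> d\<phi> j) + u \<bullet> \<phi> = A_op u \<bullet> \<phi>"
    using assms unfolding X1_iff is_neumann_def by blast
  then have "A_op u \<bullet> u = (\<Sum>j\<in>UNIV. du j \<bullet> du j) + u \<bullet> u" by metis
  then show ?thesis by (simp add: sum_nonneg)
qed

lemma A_op_monotone:
  assumes "u \<in> X1" "v \<in> X1"
  shows "0 \<le> (A_op u - A_op v) \<bullet> (u - v)"
proof -
  have "u + (-1) *\<^sub>R v \<in> X1 \<and> A_op (u + (-1) *\<^sub>R v) = A_op u + (-1) *\<^sub>R A_op v"
    using A_op_add[OF assms(1), of "(-1) *\<^sub>R v"] A_op_scaleR[OF assms(2), of "-1"] by simp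
  then show ?thesis using A_op_nonneg[of "u + (-1) *\<^sub>R v"] by simp
qed

section \<open>Approximate solutions\<close>

lemma square_integrable_superposition:
  assumes g: "L-lipschitz_on UNIV g" and f: "square_integrable f"
  shows "square_integrable (\<lambda>x. g (f x) :: real ^ 2)"
proof -
  have fm: "f \<in> borel_measurable (lebesgue_on Omega)" using f by (simp add: square_integrable_def)
  let ?b = "\<lambda>x. (L * norm (f x) + norm (g 0)) *\<^sub>R axis 1 1 :: real ^ 2"
  have L: "0 \<le> L" using g by (rule lipschitz_on_nonneg)
  have 1: "square_integrable (\<lambda>x. (L * norm (f x)) *\<^sub>R axis 1 1)"
    by (rule square_integrable_cong_AE[OF square_integrable_scaleR[OF f, of L]])
      (use fm L in \<open>auto simp: abs_mult\<close>)
  have 2: "square_integrable (\<lambda>x. norm (g 0) *\<^sub>R axis 1 1)"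
    by (intro square_integrable_continuous continuous_intros)
  have b: "square_integrable ?b"
    using square_integrable_add[OF 1 2] by (simp add: scaleR_add_left)
  show ?thesis
  proof (rule square_integrable_cong_AE[OF b])
    show "(\<lambda>x. g (f x)) \<in> borel_measurable (lebesgue_on Omega)"
      using borel_measurable_continuous_onI[OF lipschitz_on_continuous_on[OF g]] fm by measurable
    show "AE x in lebesgue_on Omega. norm (g (f x)) \<le> norm (?b x)"
    proof (rule AE_I2)
      fix x
      have "norm (g (f x)) \<le> norm (g (f x) - g 0) + norm (g 0)"
        by (metis add.commute diff_add_cancel norm_triangle_ineq)
      also have "norm (g (f x) - g 0) \<le> L * norm (f x)"
        using lipschitz_on_normD[OF g, of "f x" 0] by simp
      finally show "norm (g (f x)) \<le> norm (?b x)" using L by simp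
    qed
  qed
qed

lemma F_op_abs:
  assumes g: "L-lipschitz_on UNIV g" and f: "square_integrable f"
  shows "F_op g (abs_L2 f) = abs_L2 (\<lambda>x. f x + g (f x))"
  unfolding F_op_def
proof (rule abs_L2_eqI)
  show "AE x in lebesgue_on Omega. rep_L2 (abs_L2 f) x + g (rep_L2 (abs_L2 f) x) = f x + g (f x)"
    using rep_abs_AE[OF f] by eventually_elim simp
qed (intro square_integrable_add square_integrable_superposition[OF g] f square_integrable_rep)+

lemma F_op_lipschitz:
  assumes g: "L-lipschitz_on UNIV g"
  shows "norm (F_op g u - F_op g v) \<le> (1 + L) * norm (u - v)"
proof -
  let ?u = "rep_L2 u" and ?v = "rep_L2 v"
  have L: "0 \<le> L" using g by (rule lipschitz_on_nonneg)
  have sq: "square_integrable (\<lambda>x. rep_L2 w x + g (rep_L2 w x))" for w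
    by (intro square_integrable_add square_integrable_superposition[OF g] square_integrable_rep)
  have "norm (F_op g u - F_op g v) = norm (abs_L2 (\<lambda>x. (?u x + g (?u x)) - (?v x + g (?v x))))"
    unfolding F_op_def by (simp add: abs_L2_diff sq)
  also have "\<dots> \<le> (1 + L) * norm (abs_L2 (\<lambda>x. ?u x - ?v x))"
  proof (rule norm_abs_L2_mono)
    show "AE x in lebesgue_on Omega. norm ((?u x + g (?u x)) - (?v x + g (?v x))) \<le> (1 + L) * norm (?u x - ?v x)"
    proof (rule AE_I2)
      fix x
      have "(?u x + g (?u x)) - (?v x + g (?v x)) = (?u x - ?v x) + (g (?u x) - g (?v x))" by simp
      then have "norm ((?u x + g (?u x)) - (?v x + g (?v x))) \<le> norm (?u x - ?v x) + norm (g (?u x) - g (?v x))"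
        by (metis norm_triangle_ineq)
      then show "norm ((?u x + g (?u x)) - (?v x + g (?v x))) \<le> (1 + L) * norm (?u x - ?v x)"
        using lipschitz_on_normD[OF g, of "?u x" "?v x"] by (simp add: distrib_right)
    qed
  qed (use L in \<open>auto intro!: square_integrable_diff sq\<close>)
  also have "abs_L2 (\<lambda>x. ?u x - ?v x) = u - v"
    using abs_L2_diff[OF square_integrable_rep[of u] square_integrable_rep[of v]] by simp
  finally show ?thesis .
qed

text \<open>An energy estimate: \<open>A\<close> is monotone and \<open>F\<close> is Lipschitz with
  constant \<open>1 + L\<close>. With residual 0 it is uniqueness of trajectories; with a
  quadratically small residual it takes the place of differentiability of the flow.\<close>

lemma approximate_solution:
  assumes U: "is_solution g u0 U" and g: "L-lipschitz_on UNIV g"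
    and V: "continuous_on {0..T} V" "V 0 = u0" "\<And>t. 0 < t \<Longrightarrow> t < T \<Longrightarrow> V t \<in> X1"
      "\<And>t. 0 < t \<Longrightarrow> t < T \<Longrightarrow> (V has_vector_derivative (- A_op (V t) + F_op g (V t) + r t)) (at t)"
    and r: "\<And>t. 0 < t \<Longrightarrow> t < T \<Longrightarrow> norm (r t) \<le> \<rho>" and \<rho>: "0 \<le> \<rho>" and T: "0 \<le> T"
  shows "norm (U T - V T) \<le> \<rho> * exp ((3 + 2 * L) * T)"
proof (cases "T = 0")
  case True
  then show ?thesis using U V(2) \<rho> by (simp add: is_solution_def)
next
  case False
  with T have T: "0 < T" by simp
  have L: "0 \<le> L" using g by (rule lipschitz_on_nonneg)
  define c where "c = 3 + 2 * L"
  define w where "w = (\<lambda>t. U t - V t)"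
  \<comment> \<open>Adding \<open>\<rho>^2\<close> absorbs the residual: the derivative of
    \<open>norm (w t)^2\<close> is at most \<open>c norm (w t)^2 + \<rho>^2\<close>, where
    \<open>c = 2 (1 + L) + 1\<close>, and \<open>c \<ge> 1\<close> makes this at most
    \<open>c (norm (w t)^2 + \<rho>^2)\<close>.\<close>
  define E where "E = (\<lambda>t. exp (- c * t) * (w t \<bullet> w t + \<rho>\<^sup>2))"
  have contU: "continuous_on {0..T} U"
    using U by (auto simp: is_solution_def intro: continuous_on_subset)
  have contE: "continuous_on {0..T} E"
    unfolding E_def w_def by (intro continuous_intros contU V(1))
  have "E T \<le> E 0"
  proof (rule DERIV_nonpos_imp_decreasing_open[OF less_imp_le[OF T] _ contE])
    fix t assume t: "0 < t" "t < T"
    define w' where "w' = (- A_op (U t) + F_op g (U t)) - (- A_op (V t) + F_op g (V t) + r t)"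
    have U': "(U has_vector_derivative (- A_op (U t) + F_op g (U t))) (at t)" "U t \<in> X1"
      using U t by (auto simp: is_solution_def)
    have w': "(w has_vector_derivative w') (at t)"
      unfolding w_def w'_def by (intro has_vector_derivative_diff U' V(4) t)
    have dw: "((\<lambda>t. w t \<bullet> w t) has_real_derivative 2 * (w t \<bullet> w')) (at t)"
      using has_derivative_inner[OF w'[unfolded has_vector_derivative_def] w'[unfolded has_vector_derivative_def]]
      unfolding has_field_derivative_def by (simp add: inner_commute algebra_simps mult_commute_abs)
    have dE: "(E has_real_derivative exp (- c * t) * (2 * (w t \<bullet> w')) + (exp (- c * t) * (- c)) * (w t \<bullet> w t + \<rho>\<^sup>2)) (at t)"
      unfolding E_def by (rule DERIV_cong, rule DERIV_mult) (auto intro!: derivative_eq_intros dw)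
    have "w t \<bullet> w' = - ((A_op (U t) - A_op (V t)) \<bullet> (U t - V t)) + w t \<bullet> (F_op g (U t) - F_op g (V t)) - w t \<bullet> r t"
      by (simp add: w_def w'_def inner_diff_left inner_diff_right inner_add_right inner_commute algebra_simps)
    also have "\<dots> \<le> w t \<bullet> (F_op g (U t) - F_op g (V t)) - w t \<bullet> r t"
      using A_op_monotone[OF U'(2) V(3)[OF t]] by simp
    also have "\<dots> \<le> norm (w t) * ((1 + L) * norm (w t)) + norm (w t) * \<rho>"
    proof -
      have "w t \<bullet> (F_op g (U t) - F_op g (V t)) \<le> norm (w t) * norm (F_op g (U t) - F_op g (V t))"
        by (rule norm_cauchy_schwarz)
      also have "\<dots> \<le> norm (w t) * ((1 + L) * norm (w t))"
        unfolding w_def by (intro mult_left_mono F_op_lipschitz[OF g]) simp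
      finally have 1: "w t \<bullet> (F_op g (U t) - F_op g (V t)) \<le> norm (w t) * ((1 + L) * norm (w t))" .
      have "- (w t \<bullet> r t) \<le> norm (w t) * norm (r t)"
        using Cauchy_Schwarz_ineq2[of "w t" "r t"] by linarith
      also have "\<dots> \<le> norm (w t) * \<rho>" using r[OF t] by (intro mult_left_mono) auto
      finally show ?thesis using 1 by linarith
    qed
    finally have "2 * (w t \<bullet> w') \<le> 2 * (1 + L) * (w t \<bullet> w t) + 2 * norm (w t) * \<rho>"
      by (simp add: power2_norm_eq_inner[symmetric] power2_eq_square algebra_simps)
    also have "2 * norm (w t) * \<rho> \<le> w t \<bullet> w t + \<rho>\<^sup>2"
      using sum_squares_bound[of "norm (w t)" \<rho>] by (simp add: power2_norm_eq_inner)
    finally have "2 * (w t \<bullet> w') \<le> c * (w t \<bullet> w t) + \<rho>\<^sup>2" by (simp add: c_def algebra_simps)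
    moreover have "1 * \<rho>\<^sup>2 \<le> c * \<rho>\<^sup>2" using L by (intro mult_right_mono) (auto simp: c_def)
    ultimately have "2 * (w t \<bullet> w') - c * (w t \<bullet> w t + \<rho>\<^sup>2) \<le> 0" by (simp add: distrib_left)
    then have "exp (- c * t) * (2 * (w t \<bullet> w') - c * (w t \<bullet> w t + \<rho>\<^sup>2)) \<le> 0"
      by (simp add: mult_le_0_iff)
    then have "exp (- c * t) * (2 * (w t \<bullet> w')) + (exp (- c * t) * (- c)) * (w t \<bullet> w t + \<rho>\<^sup>2) \<le> 0"
      by (simp add: algebra_simps)
    with dE show "\<exists>y. (E has_real_derivative y) (at t) \<and> y \<le> 0" by blast
  qed
  moreover have "w 0 = 0" using U V(2) by (simp add: w_def is_solution_def)
  ultimately have "exp (- c * T) * (w T \<bullet> w T + \<rho>\<^sup>2) \<le> \<rho>\<^sup>2" by (simp add: E_def)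
  then have "w T \<bullet> w T + \<rho>\<^sup>2 \<le> \<rho>\<^sup>2 * exp (c * T)"
    by (simp add: exp_minus field_simps)
  then have "w T \<bullet> w T \<le> \<rho>\<^sup>2 * exp (c * T)" using zero_le_power2[of \<rho>] by linarith
  also have "\<dots> \<le> \<rho>\<^sup>2 * (exp (c * T))\<^sup>2"
  proof (intro mult_left_mono)
    have "1 \<le> exp (c * T)" using L T by (simp add: c_def)
    then show "exp (c * T) \<le> (exp (c * T))\<^sup>2" using self_le_power by (metis pos2)
  qed simp
  finally have "(norm (w T))\<^sup>2 \<le> (\<rho> * exp (c * T))\<^sup>2"
    by (simp add: power2_norm_eq_inner power_mult_distrib)
  then have "norm (w T) \<le> \<rho> * exp (c * T)"
    by (rule power2_le_imp_le) (use \<rho> in simp)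
  then show ?thesis by (simp add: w_def c_def)
qed

section \<open>Linearization along spatially homogeneous trajectories\<close>

definition base :: L2 where "base = eigf (\<lambda>_. 0) 1"

lemma tensor_cosf_0 [simp]: "tensor (cosf (\<lambda>_. 0)) x = 1"
  by (simp add: tensor_def cosf_def)

lemma freq_0 [simp]: "freq (\<lambda>_. 0) = 0"
  by (simp add: freq_def)

text \<open>\<open>rate i p\<close> is the \<open>i\<close>-th diagonal entry of the Jacobian of the reaction term at \<open>(p, 0)\<close>.\<close>

definition rate :: "2 \<Rightarrow> real \<Rightarrow> real"
  where "rate i p = (if i = 1 then 4 * (1 - 6 * p\<^sup>2) else 4 * (1 - p\<^sup>2))"

text \<open>In the first direction the remainder is \<open>24 p y^2 + 8 y^3\<close>, whence
  \<open>32 = 24 + 8\<close>; in the second its components are \<open>- 4 p y^2\<close> and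
  \<open>4 y^3\<close>.\<close>

lemma reaction_remainder:
  fixes p y :: real
  assumes p: "0 \<le> p" "p\<^sup>2 \<le> 1 / 2" and y: "\<bar>y\<bar> \<le> 1 / 2"
  shows "norm ((4 * p * (1 - 2 * p\<^sup>2)) *\<^sub>R axis 1 1 + (rate i p * y) *\<^sub>R axis i 1 -
    reaction 4 2 1 (p *\<^sub>R axis 1 1 + y *\<^sub>R axis i 1)) \<le> 32 * y\<^sup>2" (is "norm ?d \<le> _")
proof -
  have p1: "p \<le> 1" by (rule power2_le_imp_le) (use p(2) in simp_all)
  have y1: "\<bar>y\<bar> \<le> 1" using y by simp
  have y3: "\<bar>y ^ 3\<bar> \<le> y\<^sup>2"
  proof -
    have "\<bar>y ^ 3\<bar> = \<bar>y\<bar> * y\<^sup>2" by (simp add: power3_eq_cube power2_eq_square abs_mult)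
    also have "\<dots> \<le> 1 * y\<^sup>2" using y1 by (intro mult_right_mono) auto
    finally show ?thesis by simp
  qed
  have py: "\<bar>p * y\<^sup>2\<bar> \<le> y\<^sup>2"
    using mult_right_mono[OF p1, of "y\<^sup>2"] p by (simp add: abs_mult)
  have i: "i = 1 \<or> i = 2" using exhaust_2 by blast
  have "norm ?d \<le> \<bar>?d $ 1\<bar> + \<bar>?d $ 2\<bar>"
    using norm_le_l1_cart[of ?d] by (simp add: sum_2)
  also have "\<dots> \<le> 32 * y\<^sup>2"
  proof (cases "i = 1")
    case True
    have "?d $ 1 = 24 * (p * y\<^sup>2) + 8 * y ^ 3" "?d $ 2 = 0"
      by (simp_all add: True reaction_def rate_def axis_def power2_eq_square power3_eq_cube algebra_simps)
    then show ?thesis using y3 py by linarith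
  next
    case False
    with i have i2: "i = 2" by simp
    have "?d $ 1 = - 4 * (p * y\<^sup>2)" "?d $ 2 = 4 * y ^ 3"
      by (simp_all add: i2 reaction_def rate_def axis_def power2_eq_square power3_eq_cube algebra_simps)
    then show ?thesis using y3 py zero_le_power2[of y] by linarith
  qed
  finally show ?thesis .
qed

text \<open>The ansatz solves the equation up to a residual quadratic in the amplitude, since
  \<open>p\<close> solves the reaction equation and \<open>c\<close> the linearized equation of one
  mode. The summand \<open>u\<close> in \<open>A u\<close> and the one in \<open>F(u)\<close>
  cancel, which leaves \<open>rate - freq\<close>. All values stay in the disk where
  \<open>g\<close> is the original reaction term.\<close>

lemma homogeneous_perturbation:
  assumes g: "L-lipschitz_on UNIV g" and \<Phi>: "phase_semiflow g \<Phi>"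
    and R: "2 \<le> R\<^sup>2" "0 < R" "\<And>v. norm v \<le> R \<Longrightarrow> g v = reaction 4 2 1 v"
    and p: "\<And>t. (p has_real_derivative 4 * p t * (1 - 2 * (p t)\<^sup>2)) (at t)" "\<And>t. 0 \<le> p t" "\<And>t. (p t)\<^sup>2 \<le> 1 / 2"
    and c: "\<And>t. (c has_real_derivative (rate i (p t) - freq n) * c t) (at t)"
    and B: "\<And>t. 0 \<le> t \<Longrightarrow> t \<le> T \<Longrightarrow> \<bar>c t\<bar> \<le> B" "B \<le> 1 / 2" and T: "0 \<le> T"
  shows "norm (\<Phi> T (p 0 *\<^sub>R base + c 0 *\<^sub>R eigf n i) - (p T *\<^sub>R base + c T *\<^sub>R eigf n i))
    \<le> 32 * B\<^sup>2 * vol * exp ((3 + 2 * L) * T)"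
proof -
  define V where "V = (\<lambda>t. p t *\<^sub>R base + c t *\<^sub>R eigf n i)"
  define f where "f = (\<lambda>t x. p t *\<^sub>R axis 1 1 + (c t * tensor (cosf n) x) *\<^sub>R axis i 1 :: real ^ 2)"
  define \<rho> where "\<rho> = (\<lambda>t x. (4 * p t * (1 - 2 * (p t)\<^sup>2)) *\<^sub>R axis 1 1 +
      (rate i (p t) * (c t * tensor (cosf n) x)) *\<^sub>R axis i 1 - g (f t x))"
  define V' where "V' = (\<lambda>t. (4 * p t * (1 - 2 * (p t)\<^sup>2)) *\<^sub>R base + ((rate i (p t) - freq n) * c t) *\<^sub>R eigf n i)"
  have e0: "square_integrable (\<lambda>x. axis 1 1)" "square_integrable (\<lambda>x. tensor (cosf n) x *\<^sub>R axis i 1)"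
    using square_integrable_eigf(1)[of "\<lambda>_. 0" 1] square_integrable_eigf(1)[of n i] by simp_all
  have comb: "a *\<^sub>R base + b *\<^sub>R eigf n i = abs_L2 (\<lambda>x. a *\<^sub>R axis 1 1 + (b * tensor (cosf n) x) *\<^sub>R axis i 1)" for a b
  proof -
    have "a *\<^sub>R base + b *\<^sub>R eigf n i = abs_L2 (\<lambda>x. a *\<^sub>R axis 1 1) + abs_L2 (\<lambda>x. b *\<^sub>R (tensor (cosf n) x *\<^sub>R axis i 1))"
      unfolding base_def eigf_def abs_L2_scaleR[OF square_integrable_eigf(1)] by simp
    also have "\<dots> = abs_L2 (\<lambda>x. a *\<^sub>R axis 1 1 + b *\<^sub>R (tensor (cosf n) x *\<^sub>R axis i 1))"
      by (rule abs_L2_add) (intro square_integrable_scaleR e0)+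
    finally show ?thesis by (simp only: scaleR_scaleR)
  qed
  have sqf: "square_integrable (\<lambda>x. a *\<^sub>R axis 1 1 + (b * tensor (cosf n) x) *\<^sub>R axis i 1)" for a b
    by (intro square_integrable_continuous continuous_intros continuous_tensor_cosf)
  have V: "V t = abs_L2 (f t)" for t unfolding V_def f_def by (rule comb)
  have sqfg: "square_integrable (\<lambda>x. g (f t x))" for t
    unfolding f_def by (rule square_integrable_superposition[OF g sqf])
  have F: "F_op g (V t) = V t + abs_L2 (\<lambda>x. g (f t x))" for t
  proof -
    have "square_integrable (f t)" unfolding f_def by (rule sqf)
    then show ?thesis unfolding V F_op_abs[OF g \<open>square_integrable (f t)\<close>] by (rule abs_L2_add[OF _ sqfg, symmetric])
  qed
  have X1: "V t \<in> X1 \<and> A_op (V t) = p t *\<^sub>R base + ((1 + freq n) * c t) *\<^sub>R eigf n i" for t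
  proof -
    have "A_op base = base" "base \<in> X1" using A_op_eigf[of "\<lambda>_. 0" 1] by (simp_all add: base_def)
    then show ?thesis
      unfolding V_def
      using A_op_add[of "p t *\<^sub>R base" "c t *\<^sub>R eigf n i"] A_op_scaleR[of base "p t"]
        A_op_scaleR[of "eigf n i" "c t"] A_op_eigf[of n i] by (simp add: mult.commute)
  qed
  have eq: "V' t = - A_op (V t) + F_op g (V t) + abs_L2 (\<rho> t)" for t
  proof -
    have rho: "abs_L2 (\<rho> t) = (4 * p t * (1 - 2 * (p t)\<^sup>2)) *\<^sub>R base + (rate i (p t) * c t) *\<^sub>R eigf n i - abs_L2 (\<lambda>x. g (f t x))"
      unfolding comb \<rho>_def by (subst abs_L2_diff[OF sqf sqfg]) (simp add: mult.assoc)
    show ?thesis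
      by (simp only: F conjunct2[OF X1] rho) (simp add: V_def V'_def algebra_simps)
  qed
  have "(V has_vector_derivative V' t) (at t)" for t
    unfolding V_def V'_def
    using p(1)[of t] c[of t] by (auto intro!: derivative_eq_intros has_vector_derivative_add
        simp: has_real_derivative_iff_has_vector_derivative)
  then have dV: "(V has_vector_derivative - A_op (V t) + F_op g (V t) + abs_L2 (\<rho> t)) (at t)" for t
    by (simp only: eq)
  have bound: "norm (abs_L2 (\<rho> t)) \<le> 32 * B\<^sup>2 * vol" if t: "0 < t" "t < T" for t
  proof (rule norm_abs_L2_bound)
    have "square_integrable (\<rho> t)" unfolding \<rho>_def
      using square_integrable_diff[OF sqf sqfg] by (simp add: mult.assoc[symmetric])
    then show "\<rho> t \<in> borel_measurable (lebesgue_on Omega)" by (simp add: square_integrable_def)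
    fix x
    define y where "y = c t * tensor (cosf n) x"
    have "\<bar>tensor (cosf n) x\<bar> \<le> (\<Prod>i\<in>(UNIV :: 3 set). 1)" by (rule abs_tensor_le) (rule abs_cosf_le)
    then have y: "\<bar>y\<bar> \<le> B"
      using B(1)[of t] t mult_mono[of "\<bar>c t\<bar>" B "\<bar>tensor (cosf n) x\<bar>" 1] by (simp add: y_def abs_mult)
    then have y2: "\<bar>y\<bar> \<le> 1 / 2" using B(2) by simp
    have "norm (f t x) \<le> R"
    proof (rule power2_le_imp_le)
      have "norm (f t x) \<le> p t + \<bar>y\<bar>"
        unfolding f_def y_def[symmetric] using norm_triangle_ineq[of "p t *\<^sub>R axis 1 1" "y *\<^sub>R axis i 1 :: real ^ 2"] p(2)[of t] by simp
      then have "(norm (f t x))\<^sup>2 \<le> (p t + \<bar>y\<bar>)\<^sup>2" by (intro power_mono) auto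
      also have "\<dots> \<le> 2 * (p t)\<^sup>2 + 2 * y\<^sup>2"
        using sum_squares_bound[of "p t" "\<bar>y\<bar>"] by (simp add: power2_sum)
      \<comment> \<open>\<open>2 (1 / 2) + 2 (1 / 4) = 3 / 2\<close>, which lies below the bound 2
        for \<open>R^2\<close>.\<close>
      also have "\<dots> \<le> R\<^sup>2"
      proof -
        have "y\<^sup>2 \<le> (1 / 2)\<^sup>2" using y2 by (metis abs_ge_zero power2_abs power_mono)
        then show ?thesis using p(3)[of t] R(1) by (simp add: power2_eq_square)
      qed
      finally show "(norm (f t x))\<^sup>2 \<le> R\<^sup>2" .
    qed (use R in simp)
    then have "g (f t x) = reaction 4 2 1 (p t *\<^sub>R axis 1 1 + y *\<^sub>R axis i 1)"
      using R(3) by (simp add: f_def y_def)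
    then have "norm (\<rho> t x) \<le> 32 * y\<^sup>2"
      using reaction_remainder[OF p(2,3) y2, of t i] by (simp add: \<rho>_def y_def[symmetric])
    also have "\<dots> \<le> 32 * B\<^sup>2"
      using y by (simp add: power2_le_iff_abs_le order_trans[OF abs_ge_zero y])
    finally show "norm (\<rho> t x) \<le> 32 * B\<^sup>2" .
  qed simp
  have "norm (\<Phi> T (V 0) - V T) \<le> 32 * B\<^sup>2 * vol * exp ((3 + 2 * L) * T)"
  proof (rule approximate_solution[OF _ g, where r = "\<lambda>t. abs_L2 (\<rho> t)"])
    show "is_solution g (V 0) (\<lambda>t. \<Phi> t (V 0))" using \<Phi> by (simp add: phase_semiflow_def)
    show "continuous_on {0..T} V"
      by (rule continuous_on_vector_derivative, rule has_vector_derivative_at_within, rule dV)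
  qed (use X1 dV bound T vol_nonneg in auto)
  then show ?thesis by (simp add: V_def)
qed

text \<open>The heteroclinic solution of the Bernoulli equation \<open>p' = 4 p (1 - 2 p^2)\<close>,
  for which \<open>1 / p^2 = 2 + exp (- 8 t)\<close>. Written as an exponential, it is visibly
  positive and its logarithmic derivative is immediate.\<close>

definition logistic :: "real \<Rightarrow> real"
  where "logistic t = exp (4 * t - ln (1 + 2 * exp (8 * t)) / 2)"

text \<open>\<open>weight i\<close> solves the \<open>i\<close>-th component of the equation linearized along
  \<open>(logistic t, 0)\<close>, without the diffusion term.\<close>

definition weight :: "2 \<Rightarrow> real \<Rightarrow> real"
  where "weight i t = exp (4 * t - (if i = 1 then 3 / 2 else 1 / 4) * ln (1 + 2 * exp (8 * t)))"

lemma one_plus_two_exp_pos: "0 < 1 + 2 * exp (8 * (t::real))"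
  using exp_gt_zero[of "8 * t"] by linarith

lemma logistic_square: "(logistic t)\<^sup>2 = exp (8 * t) / (1 + 2 * exp (8 * t))"
proof -
  have "(logistic t)\<^sup>2 = exp (2 * (4 * t - ln (1 + 2 * exp (8 * t)) / 2))"
    by (simp only: logistic_def exp_double)
  also have "2 * (4 * t - ln (1 + 2 * exp (8 * t)) / 2) = 8 * t - ln (1 + 2 * exp (8 * t))" by simp
  also have "exp \<dots> = exp (8 * t) / (1 + 2 * exp (8 * t))" by (simp add: exp_diff one_plus_two_exp_pos)
  finally show ?thesis .
qed

lemma log_has_derivative:
  "((\<lambda>t. ln (1 + 2 * exp (8 * t))) has_real_derivative 16 * (logistic t)\<^sup>2) (at t)"
  unfolding logistic_square using one_plus_two_exp_pos[of t] by (auto intro!: derivative_eq_intros)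

lemma logistic_has_derivative:
  "(logistic has_real_derivative 4 * logistic t * (1 - 2 * (logistic t)\<^sup>2)) (at t)"
proof -
  have "((\<lambda>t. 4 * t - ln (1 + 2 * exp (8 * t)) / 2) has_real_derivative (4 * 1 - 16 * (logistic t)\<^sup>2 / 2)) (at t)"
    by (intro DERIV_diff DERIV_cmult DERIV_cdivide log_has_derivative DERIV_ident)
  from DERIV_fun_exp[OF this]
  have "(logistic has_real_derivative logistic t * (4 * 1 - 16 * (logistic t)\<^sup>2 / 2)) (at t)"
    unfolding logistic_def[abs_def] .
  then show ?thesis by (rule DERIV_cong) (simp add: algebra_simps)
qed

lemma weight_has_derivative: "(weight i has_real_derivative rate i (logistic t) * weight i t) (at t)"
proof -
  \<comment> \<open>The logarithm has derivative \<open>16 p^2\<close>, so the terms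
    \<open>24 p^2\<close> and \<open>4 p^2\<close> of the two rates require the factors
    \<open>24 / 16\<close> and \<open>4 / 16\<close>.\<close>
  let ?k = "if i = 1 then 3 / 2 else 1 / 4 :: real"
  have "((\<lambda>t. 4 * t - ?k * ln (1 + 2 * exp (8 * t))) has_real_derivative (4 * 1 - ?k * (16 * (logistic t)\<^sup>2))) (at t)"
    by (intro DERIV_diff DERIV_cmult log_has_derivative DERIV_ident)
  from DERIV_fun_exp[OF this]
  have "(weight i has_real_derivative weight i t * (4 * 1 - ?k * (16 * (logistic t)\<^sup>2))) (at t)"
    unfolding weight_def[abs_def] .
  then show ?thesis by (rule DERIV_cong) (simp add: rate_def algebra_simps)
qed

lemma logistic_bounds: "0 \<le> logistic t" "(logistic t)\<^sup>2 \<le> 1 / 2"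
proof -
  show "0 \<le> logistic t" by (simp add: logistic_def)
  show "(logistic t)\<^sup>2 \<le> 1 / 2"
    unfolding logistic_square using one_plus_two_exp_pos[of t] by (simp add: field_simps)
qed

lemma logistic_at_bot: "(logistic \<longlongrightarrow> 0) at_bot"
  unfolding logistic_def[abs_def] by real_asymp

lemma logistic_at_top: "(logistic \<longlongrightarrow> sqrt (1 / 2)) at_top"
proof -
  have "((\<lambda>t. sqrt (exp (8 * t) / (1 + 2 * exp (8 * t)))) \<longlongrightarrow> sqrt (1 / 2)) at_top"
    by (intro tendsto_real_sqrt) real_asymp
  moreover have "sqrt (exp (8 * t) / (1 + 2 * exp (8 * t))) = logistic t" for t
    using logistic_bounds(1) by (simp add: logistic_square[symmetric])
  ultimately show ?thesis by simp
qed

text \<open>Near the corner 0 of the cube all cosines are close to 1. So the product is positive on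
  a nonempty open part of \<open>Omega\<close>, which is not negligible.\<close>

lemma eigf_nonzero: "eigf n i \<noteq> 0"
proof
  assume z: "eigf n i = 0"
  have cont: "continuous_on UNIV (\<lambda>x. tensor (cosf n) x *\<^sub>R axis i 1 :: real ^ 2)"
    by (intro continuous_intros continuous_tensor_cosf)
  have "L2_eq (\<lambda>x. tensor (cosf n) x *\<^sub>R axis i 1) (\<lambda>x. 0)"
    using Quotient_rel[OF Quotient_L2, of "\<lambda>x. tensor (cosf n) x *\<^sub>R axis i 1" "\<lambda>x. 0"]
      z square_integrable_eigf(1)[of n i] square_integrable_0
    by (simp add: eigf_def zero_L2.abs_eq L2_eq_refl)
  then have ae: "AE x in lebesgue_on Omega. tensor (cosf n) x = 0"
    by (auto simp: L2_eq_def axis_eq_0_iff)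
  have "tensor (cosf n) (0 :: real ^ 3) = 1" by (simp add: tensor_def cosf_def)
  moreover have "isCont (tensor (cosf n)) 0"
    using continuous_tensor_cosf(1)[of n] by (simp add: continuous_on_eq_continuous_at)
  ultimately have "\<forall>\<^sub>F x in at 0. tensor (cosf n) x > 0"
    by (intro order_tendstoD(1)[of _ 1]) (auto simp: isCont_def)
  then obtain d where d: "0 < d" "\<And>x. x \<noteq> 0 \<Longrightarrow> dist x 0 < d \<Longrightarrow> tensor (cosf n) x > 0"
    unfolding eventually_at by auto
  let ?S = "Omega \<inter> ball 0 d"
  have "negligible ?S"
  proof -
    have "AE x in lebesgue. x \<in> Omega \<longrightarrow> tensor (cosf n) x = 0"
      using ae by (simp add: AE_restrict_space_iff)
    moreover have "x \<in> Omega \<Longrightarrow> x \<noteq> 0" for x :: "real ^ 3" by (auto simp: mem_Omega)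
    ultimately have "AE x in lebesgue. x \<notin> ?S"
      by (elim AE_mp) (use d in \<open>fastforce intro!: AE_I2 simp: dist_commute\<close>)
    moreover have "?S \<in> sets lebesgue" by (intro sets.Int Omega_sets) auto
    ultimately show ?thesis
      using AE_iff_null_sets[of ?S lebesgue] by (simp add: negligible_iff_null_sets)
  qed
  moreover have "open ?S" by (intro open_Int open_ball) (simp add: Omega_def open_box)
  moreover have "?S \<noteq> {}"
  proof -
    define e where "e = min 1 (d / 4)"
    have e: "0 < e" "e < pi" "e < d / 3" using d(1) pi_gt3 by (auto simp: e_def min_def)
    have "norm (\<chi> i. e :: real ^ 3) \<le> (\<Sum>i\<in>(UNIV :: 3 set). \<bar>e\<bar>)"
      using norm_le_l1_cart[of "\<chi> i. e :: real ^ 3"] by simp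
    also have "\<dots> < d" using e by simp
    finally have "(\<chi> i. e) \<in> ?S" using e by (simp add: mem_Omega)
    then show ?thesis by blast
  qed
  ultimately show False using open_not_negligible by blast
qed

text \<open>The multiples of a mode are admissible increments in \<open>X1\<close>. Hence an
  expansion of \<open>G\<close> with error of order \<open>s^2\<close> along this one direction
  determines the value of \<open>D\<close> there.\<close>

lemma has_gen_derivative_eigf:
  assumes D: "has_gen_derivative G D u"
    and G: "\<And>s. 0 \<le> s \<Longrightarrow> s \<le> d \<Longrightarrow> norm (G (u + s *\<^sub>R eigf n i) - (v + (s * c) *\<^sub>R eigf n i)) \<le> K * s\<^sup>2"
    and d: "0 < d"
  shows "D (eigf n i) = c *\<^sub>R eigf n i"
proof -
  let ?e = "eigf n i"
  let ?A = "norm (A_op ?e)"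
  have lin: "linear D" using D by (simp add: has_gen_derivative_def bounded_linear.linear)
  have Gu: "G u = v"
    using G[of 0] d by simp
  have "norm (c *\<^sub>R ?e - D ?e) \<le> \<epsilon>" if \<epsilon>: "0 < \<epsilon>" for \<epsilon>
  proof -
    define \<eta> where "\<eta> = \<epsilon> / (2 * (?A + 1))"
    have \<eta>: "0 < \<eta>" using \<epsilon> by (simp add: \<eta>_def add_nonneg_pos)
    obtain \<delta> where \<delta>: "0 < \<delta>" "\<And>h. h \<in> X1 \<Longrightarrow> norm (A_op h) < \<delta> \<Longrightarrow>
        norm (G (u + h) - G u - D h) \<le> \<eta> * norm (A_op h)"
      using D \<eta> unfolding has_gen_derivative_def by blast
    \<comment> \<open>The three bounds keep \<open>s\<close> in the range of the expansion, the
      increment below \<open>\<delta>\<close> in the norm of \<open>X1\<close>, and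
      \<open>K s\<close> at most \<open>\<epsilon> / 2\<close>.\<close>
    define s where "s = min d (min (\<delta> / (2 * (?A + 1))) (\<epsilon> / (2 * (\<bar>K\<bar> + 1))))"
    have s: "0 < s" "s \<le> d" "s \<le> \<delta> / (2 * (?A + 1))" "s \<le> \<epsilon> / (2 * (\<bar>K\<bar> + 1))"
      using d \<delta>(1) \<epsilon> by (auto simp: s_def add_nonneg_pos)
    have "A_op (s *\<^sub>R ?e) = s *\<^sub>R A_op ?e" and A1: "s *\<^sub>R ?e \<in> X1"
      using A_op_scaleR[OF conjunct1[OF A_op_eigf]] by blast+
    then have A2: "norm (A_op (s *\<^sub>R ?e)) = s * ?A"
      using s(1) by (simp only: norm_scaleR abs_of_pos)
    note A = A1 A2
    have pos: "0 < 2 * (?A + 1)" "0 < 2 * (\<bar>K\<bar> + 1)" by (simp_all add: add_nonneg_pos)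
    have s3: "s * (2 * (?A + 1)) \<le> \<delta>" and s4: "s * (2 * (\<bar>K\<bar> + 1)) \<le> \<epsilon>"
      using s(3,4) unfolding pos_le_divide_eq[OF pos(1)] pos_le_divide_eq[OF pos(2)] .
    have "s * ?A < \<delta>"
    proof -
      have "s * ?A \<le> s * (?A + 1)" using s(1) by simp
      also have "\<dots> \<le> \<delta> / 2" using s3 by (simp add: algebra_simps)
      also have "\<dots> < \<delta>" using \<delta>(1) by simp
      finally show ?thesis .
    qed
    then have 1: "norm (G (u + s *\<^sub>R ?e) - v - D (s *\<^sub>R ?e)) \<le> \<eta> * (s * ?A)"
      using \<delta>(2)[OF A(1)] A(2) Gu by simp
    have 2: "norm (G (u + s *\<^sub>R ?e) - (v + (s * c) *\<^sub>R ?e)) \<le> K * s\<^sup>2"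
      using G s by simp
    have "s *\<^sub>R (c *\<^sub>R ?e - D ?e) = (G (u + s *\<^sub>R ?e) - v - D (s *\<^sub>R ?e)) - (G (u + s *\<^sub>R ?e) - (v + (s * c) *\<^sub>R ?e))"
      by (simp add: linear_scale[OF lin] scaleR_diff_right)
    then have "norm (s *\<^sub>R (c *\<^sub>R ?e - D ?e)) \<le> \<eta> * (s * ?A) + K * s\<^sup>2"
      by (simp only:) (rule order_trans[OF norm_triangle_ineq4 add_mono[OF 1 2]])
    then have "s * norm (c *\<^sub>R ?e - D ?e) \<le> \<eta> * (s * ?A) + K * s\<^sup>2"
      using s(1) by (simp only: norm_scaleR abs_of_pos)
    also have "\<dots> = s * (\<eta> * ?A + K * s)" by (simp add: power2_eq_square algebra_simps)
    finally have "norm (c *\<^sub>R ?e - D ?e) \<le> \<eta> * ?A + K * s" using s(1) by simp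
    also have "\<eta> * ?A \<le> \<epsilon> / 2"
    proof -
      have "\<eta> * ?A \<le> \<eta> * (?A + 1)" using \<eta> by simp
      also have "\<dots> = \<epsilon> / 2" by (simp add: \<eta>_def field_simps add_nonneg_eq_0_iff)
      finally show ?thesis .
    qed
    also have "K * s \<le> \<epsilon> / 2"
    proof -
      have "K * s \<le> (\<bar>K\<bar> + 1) * s" using s(1) by (intro mult_right_mono) auto
      also have "\<dots> \<le> \<epsilon> / 2" using s4 by (simp add: algebra_simps)
      finally show ?thesis .
    qed
    finally show ?thesis by simp
  qed
  then have "norm (c *\<^sub>R ?e - D ?e) \<le> 0" by (rule field_le_epsilon) simp
  then show ?thesis by simp
qed

text \<open>Solutions on the invariant segment from 0 to \<open>1 / sqrt 2\<close> of the first
  axis. They are required for all real times, so that they are complete bounded trajectories and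
  hence lie in the attractor.\<close>

definition homogeneous_solution :: "(real \<Rightarrow> real) \<Rightarrow> bool"
  where "homogeneous_solution p \<longleftrightarrow>
    (\<forall>t. (p has_real_derivative 4 * p t * (1 - 2 * (p t)\<^sup>2)) (at t) \<and> 0 \<le> p t \<and> (p t)\<^sup>2 \<le> 1 / 2)"

lemma homogeneous_solution_zero: "homogeneous_solution (\<lambda>t. 0)"
  by (simp add: homogeneous_solution_def)

lemma homogeneous_solution_sqrt: "homogeneous_solution (\<lambda>t. sqrt (1 / 2))"
  by (simp add: homogeneous_solution_def)

lemma homogeneous_solution_logistic: "homogeneous_solution logistic"
  using logistic_has_derivative logistic_bounds by (simp add: homogeneous_solution_def)

lemma homogeneous_solution_shift:
  "homogeneous_solution p \<Longrightarrow> homogeneous_solution (\<lambda>t. p (t + s))"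
  by (simp add: homogeneous_solution_def DERIV_shift[symmetric])

lemma weight_nonzero: "weight i t \<noteq> 0"
  by (simp add: weight_def)

lemma exp_rate_le:
  fixes a b K :: real
  assumes "0 < K" "\<And>t. 0 \<le> t \<Longrightarrow> inverse K * exp (a * t) \<le> exp (b * t)"
  shows "a \<le> b"
proof (rule ccontr)
  assume "\<not> a \<le> b"
  then have ab: "0 < a - b" by simp
  define t where "t = (\<bar>ln K\<bar> + 1) / (a - b)"
  have t: "0 \<le> t" "(a - b) * t = \<bar>ln K\<bar> + 1" using ab by (simp_all add: t_def)
  have "K = exp (ln K)" using assms(1) by simp
  also have "\<dots> < exp ((a - b) * t)" unfolding t(2) by simp
  finally have "K < exp ((a - b) * t)" .
  moreover have "exp ((a - b) * t) = exp (a * t) / exp (b * t)" by (simp add: left_diff_distrib exp_diff)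
  ultimately have "K * exp (b * t) < exp (a * t)" by (simp add: pos_less_divide_eq)
  moreover have "exp (a * t) \<le> K * exp (b * t)"
    using assms(2)[OF t(1)] assms(1) by (simp add: field_simps)
  ultimately show False by simp
qed

text \<open>What both variants of the alteration share: a global Lipschitz bound and agreement with
  the reaction term on a disk. The bound 2 is \<open>2 / min a b\<close> for \<open>a = 2\<close>,
  \<open>b = 1\<close>.\<close>

locale altered_system =
  fixes g :: "real ^ 2 \<Rightarrow> real ^ 2" and \<Phi> :: "real \<Rightarrow> L2 \<Rightarrow> L2" and L R :: real
  assumes lip: "L-lipschitz_on UNIV g" and flow: "phase_semiflow g \<Phi>"
    and R: "2 \<le> R\<^sup>2" "0 < R" "\<And>v. norm v \<le> R \<Longrightarrow> g v = reaction 4 2 1 v"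
begin

text \<open>A perturbation of amplitude \<open>B = 0\<close> has error bound 0, so the estimate
  becomes an equality.\<close>

lemma flow_homogeneous:
  assumes "homogeneous_solution p" "0 \<le> T"
  shows "\<Phi> T (p 0 *\<^sub>R base) = p T *\<^sub>R base"
  using homogeneous_perturbation[OF lip flow R, of p "\<lambda>t. 0" 1 "\<lambda>_. 0" T 0] assms
  by (simp add: homogeneous_solution_def)

text \<open>The mode equation is linear, so \<open>s c\<close> solves it as well; its amplitude is
  \<open>s B\<close> and the error is quadratic in \<open>s\<close>. For
  \<open>s \<le> 1 / (2 B)\<close> the amplitude stays within the admissible
  \<open>1 / 2\<close>.\<close>

lemma derivative_eigf:
  assumes p: "homogeneous_solution p" and T: "0 \<le> T"
    and c: "\<And>t. (c has_real_derivative (rate i (p t) - freq n) * c t) (at t)" "c 0 = 1"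
    and D: "has_gen_derivative (\<Phi> T) D (p 0 *\<^sub>R base)"
  shows "D (eigf n i) = c T *\<^sub>R eigf n i"
proof -
  have "continuous_on {0..T} c"
    by (rule DERIV_continuous_on, rule has_field_derivative_at_within, rule c(1))
  then have "compact (c ` {0..T})" by (rule compact_continuous_image) simp
  then obtain B where B: "0 < B" "\<And>t. 0 \<le> t \<Longrightarrow> t \<le> T \<Longrightarrow> \<bar>c t\<bar> \<le> B"
    by (auto dest!: compact_imp_bounded simp: bounded_pos)
  show ?thesis
  proof (rule has_gen_derivative_eigf[OF D, where v = "p T *\<^sub>R base" and d = "1 / (2 * B)"
        and K = "32 * B\<^sup>2 * vol * exp ((3 + 2 * L) * T)"])
    fix s :: real assume s: "0 \<le> s" "s \<le> 1 / (2 * B)"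
    have "norm (\<Phi> T (p 0 *\<^sub>R base + (s * c 0) *\<^sub>R eigf n i) - (p T *\<^sub>R base + (s * c T) *\<^sub>R eigf n i))
        \<le> 32 * (s * B)\<^sup>2 * vol * exp ((3 + 2 * L) * T)"
    proof (rule homogeneous_perturbation[OF lip flow R])
      show "((\<lambda>t. s * c t) has_real_derivative (rate i (p t) - freq n) * (s * c t)) (at t)" for t
        using DERIV_cmult[OF c(1), of s t] by (simp add: mult_ac)
      show "\<bar>s * c t\<bar> \<le> s * B" if "0 \<le> t" "t \<le> T" for t
        using B(2)[OF that] s by (simp add: abs_mult mult_left_mono)
      show "s * B \<le> 1 / 2" using s(2) B(1) by (simp add: field_simps)
    qed (use p T in \<open>simp_all add: homogeneous_solution_def\<close>)
    then show "norm (\<Phi> T (p 0 *\<^sub>R base + s *\<^sub>R eigf n i) - (p T *\<^sub>R base + (s * c T) *\<^sub>R eigf n i))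
        \<le> 32 * B\<^sup>2 * vol * exp ((3 + 2 * L) * T) * s\<^sup>2"
      using c(2) by (simp add: power_mult_distrib mult_ac)
  qed (use B in simp)
qed

lemma homogeneous_in_attractor:
  assumes p: "homogeneous_solution p"
  shows "p t *\<^sub>R base \<in> global_attractor \<Phi>"
proof -
  define u where "u = (\<lambda>t. p t *\<^sub>R base)"
  have "\<bar>p t\<bar> \<le> 1" for t
  proof (rule power2_le_imp_le)
    show "\<bar>p t\<bar>\<^sup>2 \<le> 1\<^sup>2"
      using p unfolding homogeneous_solution_def power2_abs by (smt (verit) divide_le_eq_1 one_power2)
  qed simp
  then have "bounded (range u)"
    by (intro boundedI[of _ "norm base"]) (auto simp: u_def mult_left_le_one_le)
  moreover have "u (t + s) = \<Phi> s (u t)" if "0 \<le> s" for t s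
    using flow_homogeneous[OF homogeneous_solution_shift[OF p, of t] that] by (simp add: u_def add.commute)
  ultimately have "range u \<subseteq> global_attractor \<Phi>" unfolding global_attractor_def by blast
  then show ?thesis by (auto simp: u_def)
qed

lemma not_normally_hyperbolic:
  assumes M: "inertial_manifold \<Phi> M" and nh: "normally_hyperbolic \<Phi> M"
  shows False
proof -
  obtain N D where spl: "bundle_splitting M N"
    and D: "\<And>u t. u \<in> M \<Longrightarrow> 0 \<le> t \<Longrightarrow> has_gen_derivative (\<Phi> t) (D t u) u"
      "\<And>u t. u \<in> M \<Longrightarrow> 0 \<le> t \<Longrightarrow> D t u ` tangent_space M u \<subseteq> tangent_space M (\<Phi> t u)"
      "\<And>u t. u \<in> M \<Longrightarrow> 0 \<le> t \<Longrightarrow> D t u ` N u \<subseteq> N (\<Phi> t u)"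
    and rates: "\<And>u. u \<in> M \<Longrightarrow> \<exists>K>0. \<exists>\<gamma>\<^sub>1 \<gamma>\<^sub>2. 0 < \<gamma>\<^sub>1 \<and> \<gamma>\<^sub>1 < \<gamma>\<^sub>2 \<and> (\<forall>t\<ge>0.
      (\<forall>h\<in>tangent_space M u. norm (D t u h) \<ge> inverse K * exp (- \<gamma>\<^sub>1 * t) * norm h) \<and>
      (\<forall>h\<in>N u. norm (D t u h) \<le> K * exp (- \<gamma>\<^sub>2 * t) * norm h))"
    using nh unfolding normally_hyperbolic_def
  proof (elim exE conjE)
    fix N D
    assume "bundle_splitting M N" and 1: "\<forall>u\<in>M. \<forall>t\<ge>0. has_gen_derivative (\<Phi> t) (D t u) u \<and>
        D t u ` tangent_space M u \<subseteq> tangent_space M (\<Phi> t u) \<and> D t u ` N u \<subseteq> N (\<Phi> t u)"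
      and 2: "\<forall>u\<in>M. \<exists>K>0. \<exists>\<gamma>\<^sub>1 \<gamma>\<^sub>2. 0 < \<gamma>\<^sub>1 \<and> \<gamma>\<^sub>1 < \<gamma>\<^sub>2 \<and> (\<forall>t\<ge>0.
        (\<forall>h\<in>tangent_space M u. norm (D t u h) \<ge> inverse K * exp (- \<gamma>\<^sub>1 * t) * norm h) \<and>
        (\<forall>h\<in>N u. norm (D t u h) \<le> K * exp (- \<gamma>\<^sub>2 * t) * norm h))"
    show thesis
      by (rule that[of N D], fact) (use 1 2 in blast)+
  qed
  obtain P where P: "\<And>u. u \<in> M \<Longrightarrow> bounded_linear (P u)" "\<And>u h. u \<in> M \<Longrightarrow> P u (P u h) = P u h"
      "\<And>u. u \<in> M \<Longrightarrow> range (P u) = tangent_space M u" "\<And>u. u \<in> M \<Longrightarrow> {h. P u h = 0} = N u"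
    and contP: "continuous_on (M \<times> UNIV) (\<lambda>(u, h). P u h)"
    using spl unfolding bundle_splitting_def by blast
  have inM: "p t *\<^sub>R base \<in> M" if "homogeneous_solution p" for p t
    using homogeneous_in_attractor[OF that] M by (auto simp: inertial_manifold_def)
  have flowM: "\<Phi> t u \<in> M" if "u \<in> M" "0 \<le> t" for u t
    using M that unfolding inertial_manifold_def by blast
  have linD: "bounded_linear (D t u)" if "u \<in> M" "0 \<le> t" for u t
    using D(1)[OF that] by (simp add: has_gen_derivative_def)
  \<comment> \<open>Invariance of both bundles, applied to the parts \<open>P u h\<close> and
    \<open>h - P u h\<close> separately.\<close>
  have commute: "P (\<Phi> t u) (D t u h) = D t u (P u h)" if u: "u \<in> M" "0 \<le> t" for u t h
  proof -
    note lin = bounded_linear.linear[OF linD[OF u]] bounded_linear.linear[OF P(1)[OF flowM[OF u]]]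
      bounded_linear.linear[OF P(1)[OF u(1)]]
    have "P u h \<in> tangent_space M u" using P(3)[OF u(1)] by blast
    then have "D t u (P u h) \<in> range (P (\<Phi> t u))"
      using D(2)[OF u] P(3)[OF flowM[OF u]] by blast
    then have 1: "P (\<Phi> t u) (D t u (P u h)) = D t u (P u h)" using P(2)[OF flowM[OF u]] by auto
    have "P u (h - P u h) = 0" using P(2)[OF u(1)] by (simp add: linear_diff[OF lin(3)])
    then have "D t u (h - P u h) \<in> N (\<Phi> t u)" using D(3)[OF u] P(4)[OF u(1)] by blast
    then have "P (\<Phi> t u) (D t u (h - P u h)) = 0" using P(4)[OF flowM[OF u]] by blast
    then show ?thesis using 1 by (simp add: linear_diff[OF lin(1)] linear_diff[OF lin(2)])
  qed
  \<comment> \<open>Since \<open>D\<close> is diagonal in all modes, the \<open>e\<close>-component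
    of \<open>D (P e)\<close> is \<open>c\<close> times that of \<open>P e\<close>. By commutation
    \<open>D (P e)\<close> is also \<open>c\<close> times the projection of \<open>e\<close> at the
    later point, and the nonzero factor \<open>c\<close> cancels.\<close>
  have diag: "P (p T *\<^sub>R base) (eigf n i) \<bullet> eigf n i = P (p 0 *\<^sub>R base) (eigf n i) \<bullet> eigf n i"
    if p: "homogeneous_solution p" and T: "0 \<le> T"
      and c: "\<And>n i t. (c n i has_real_derivative (rate i (p t) - freq n) * c n i t) (at t)"
        "\<And>n i. c n i 0 = 1" "\<And>n i t. c n i t \<noteq> 0"
    for p T n i and c :: "(3 \<Rightarrow> nat) \<Rightarrow> 2 \<Rightarrow> real \<Rightarrow> real"
  proof -
    let ?u = "p 0 *\<^sub>R base" and ?u' = "p T *\<^sub>R base" and ?e = "eigf n i"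
    have u: "?u \<in> M" "?u' \<in> M" using inM[OF p] by auto
    have fl: "\<Phi> T ?u = ?u'" by (rule flow_homogeneous[OF p T])
    have De: "D T ?u (eigf n i) = c n i T *\<^sub>R eigf n i" for n i
      by (rule derivative_eigf[OF p T c(1) c(2) D(1)[OF u(1) T]])
    have "(\<lambda>h. D T ?u h \<bullet> ?e) = (\<lambda>h. c n i T * (h \<bullet> ?e))"
    proof (rule linear_eq_on_eigf)
      show "bounded_linear (\<lambda>h. D T ?u h \<bullet> ?e)"
        by (rule bounded_linear_compose[OF bounded_linear_inner_left linD[OF u(1) T]])
      show "bounded_linear (\<lambda>h. c n i T * (h \<bullet> ?e))"
        by (rule bounded_linear_const_mult[OF bounded_linear_inner_left])
      fix n' i'
      show "D T ?u (eigf n' i') \<bullet> ?e = c n i T * (eigf n' i' \<bullet> ?e)"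
        unfolding De using eigf_orthogonal[of n' i' n i] by (cases "(n', i') = (n, i)") auto
    qed
    then have "D T ?u (P ?u ?e) \<bullet> ?e = c n i T * (P ?u ?e \<bullet> ?e)" by metis
    moreover have "D T ?u (P ?u ?e) = c n i T *\<^sub>R P ?u' ?e"
      using commute[OF u(1) T, of ?e] linear_scale[OF bounded_linear.linear[OF P(1)[OF u(2)]]]
      by (simp add: fl De)
    ultimately show ?thesis using c(3)[of n i T] by simp
  qed
  \<comment> \<open>\<open>D\<close> multiplies \<open>e\<close>, and by commutation also
    \<open>P e\<close> and \<open>e - P e\<close>, by the same factor \<open>exp (\<mu> t)\<close>.
    If \<open>P e \<noteq> 0\<close>, the lower estimate gives
    \<open>\<mu> \<ge> - \<gamma>\<^sub>1\<close>; if \<open>P e \<noteq> e\<close>, the upper one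
    gives \<open>\<mu> \<le> - \<gamma>\<^sub>2\<close>. As
    \<open>\<gamma>\<^sub>1 < \<gamma>\<^sub>2\<close>, only one of these can occur.\<close>
  have equil: "\<exists>\<gamma>>0. \<forall>n i. (- \<gamma> \<le> rate i q - freq n \<longrightarrow> P (q *\<^sub>R base) (eigf n i) = eigf n i) \<and>
      (rate i q - freq n < - \<gamma> \<longrightarrow> P (q *\<^sub>R base) (eigf n i) = 0)"
    if q: "homogeneous_solution (\<lambda>t. q)" for q
  proof -
    let ?u = "q *\<^sub>R base"
    have u: "?u \<in> M" by (rule inM[OF q])
    have fl: "\<Phi> t ?u = ?u" if "0 \<le> t" for t using flow_homogeneous[OF q that] by simp
    note linP = bounded_linear.linear[OF P(1)[OF u]]
    obtain K \<gamma>\<^sub>1 \<gamma>\<^sub>2 where K: "0 < K" "0 < \<gamma>\<^sub>1" "\<gamma>\<^sub>1 < \<gamma>\<^sub>2"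
      "\<And>t h. 0 \<le> t \<Longrightarrow> h \<in> tangent_space M ?u \<Longrightarrow> norm (D t ?u h) \<ge> inverse K * exp (- \<gamma>\<^sub>1 * t) * norm h"
      "\<And>t h. 0 \<le> t \<Longrightarrow> h \<in> N ?u \<Longrightarrow> norm (D t ?u h) \<le> K * exp (- \<gamma>\<^sub>2 * t) * norm h"
      using rates[OF u] by blast
    have "(- \<gamma>\<^sub>1 \<le> rate i q - freq n \<longrightarrow> P ?u (eigf n i) = eigf n i) \<and>
      (rate i q - freq n < - \<gamma>\<^sub>1 \<longrightarrow> P ?u (eigf n i) = 0)" for n i
    proof -
      let ?e = "eigf n i"
      define \<mu> where "\<mu> = rate i q - freq n"
      define a where "a = P ?u ?e"
      have De: "D t ?u ?e = exp (\<mu> * t) *\<^sub>R ?e" if t: "0 \<le> t" for t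
      proof (rule derivative_eigf[OF q t _ _ D(1)[OF u t]])
        show "((\<lambda>t. exp (\<mu> * t)) has_real_derivative (rate i q - freq n) * exp (\<mu> * t)) (at t)" for t
          by (auto intro!: derivative_eq_intros simp: \<mu>_def)
      qed simp
      have Da: "D t ?u a = exp (\<mu> * t) *\<^sub>R a" if t: "0 \<le> t" for t
        using commute[OF u t, of ?e] by (simp add: fl t De a_def linear_scale[OF linP])
      have Db: "D t ?u (?e - a) = exp (\<mu> * t) *\<^sub>R (?e - a)" if t: "0 \<le> t" for t
        by (simp add: linear_diff[OF bounded_linear.linear[OF linD[OF u t]]] De Da t scaleR_diff_right)
      have 1: "- \<gamma>\<^sub>1 \<le> \<mu>" if "a \<noteq> 0"
      proof (rule exp_rate_le[OF K(1)])
        fix t :: real assume t: "0 \<le> t"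
        have "a \<in> tangent_space M ?u" using P(3)[OF u] by (auto simp: a_def)
        then have "inverse K * exp (- \<gamma>\<^sub>1 * t) * norm a \<le> exp (\<mu> * t) * norm a"
          using K(4)[OF t] Da[OF t] by (metis abs_exp_cancel norm_scaleR)
        then show "inverse K * exp (- \<gamma>\<^sub>1 * t) \<le> exp (\<mu> * t)" using that by simp
      qed
      have 2: "\<mu> \<le> - \<gamma>\<^sub>2" if "?e - a \<noteq> 0"
      proof (rule exp_rate_le[OF K(1)])
        fix t :: real assume t: "0 \<le> t"
        have "P ?u (?e - a) = 0" using P(2)[OF u] by (simp add: a_def linear_diff[OF linP])
        then have "?e - a \<in> N ?u" using P(4)[OF u] by blast
        then have "exp (\<mu> * t) * norm (?e - a) \<le> K * exp (- \<gamma>\<^sub>2 * t) * norm (?e - a)"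
          using K(5)[OF t] Db[OF t] by (metis abs_exp_cancel norm_scaleR)
        then have "exp (\<mu> * t) \<le> K * exp (- \<gamma>\<^sub>2 * t)" using that by simp
        then show "inverse K * exp (\<mu> * t) \<le> exp (- \<gamma>\<^sub>2 * t)" using K(1) by (simp add: field_simps)
      qed
      show ?thesis using 1 2 K(3) by (fold \<mu>_def a_def) force
    qed
    then show ?thesis using K(2) by blast
  qed
  define q where "q = sqrt (1 / 2 :: real)"
  have transfer: "P (0 *\<^sub>R base) (eigf n i) \<bullet> eigf n i = P (q *\<^sub>R base) (eigf n i) \<bullet> eigf n i" for n i
  proof -
    let ?e = "eigf n i"
    define Q where "Q = (\<lambda>t. P (logistic t *\<^sub>R base) ?e \<bullet> ?e)"
    have step: "Q (s + T) = Q s" if "0 \<le> T" for s T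
    proof -
      have "P (logistic (T + s) *\<^sub>R base) ?e \<bullet> ?e = P (logistic (0 + s) *\<^sub>R base) ?e \<bullet> ?e"
      \<comment> \<open>The solution of the mode equation started at time \<open>s\<close>: the
        reaction weight normalized to 1 there, times the decay due to diffusion.\<close>
      proof (rule diag[OF homogeneous_solution_shift[OF homogeneous_solution_logistic] that,
            where c = "\<lambda>n i t. weight i (t + s) / weight i s * exp (- freq n * t)"])
        fix n i t
        have "((\<lambda>t. weight i (t + s)) has_real_derivative rate i (logistic (t + s)) * weight i (t + s)) (at t)"
          using weight_has_derivative[of i "t + s"] by (simp add: DERIV_shift)
        then show "((\<lambda>t. weight i (t + s) / weight i s * exp (- freq n * t)) has_real_derivative
            (rate i (logistic (t + s)) - freq n) * (weight i (t + s) / weight i s * exp (- freq n * t))) (at t)"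
          using weight_nonzero[of i s]
          by (auto intro!: derivative_eq_intros simp: algebra_simps diff_divide_distrib)
      qed (simp_all add: weight_def)
      then show ?thesis by (simp add: Q_def add.commute)
    qed
    have const: "Q t = Q 0" for t
      using step[of t 0] step[of "- t" t] by (cases "0 \<le> t") auto
    have lim: "(Q \<longlongrightarrow> P (r *\<^sub>R base) ?e \<bullet> ?e) F"
      if "(logistic \<longlongrightarrow> r) F" "homogeneous_solution (\<lambda>t. r)" for r F
    proof -
      have "((\<lambda>t. (logistic t *\<^sub>R base, ?e)) \<longlongrightarrow> (r *\<^sub>R base, ?e)) F"
        by (intro tendsto_intros that)
      then have "((\<lambda>t. case (logistic t *\<^sub>R base, ?e) of (u, h) \<Rightarrow> P u h) \<longlongrightarrow> (case (r *\<^sub>R base, ?e) of (u, h) \<Rightarrow> P u h)) F"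
        by (rule continuous_on_tendsto_compose[OF contP])
          (use inM[OF that(2)] inM[OF homogeneous_solution_logistic] in auto)
      then show ?thesis unfolding Q_def by (intro tendsto_intros) simp
    qed
    have Q: "Q = (\<lambda>t. Q 0)" using const by blast
    have "Q 0 = P (0 *\<^sub>R base) ?e \<bullet> ?e"
      using lim[OF logistic_at_bot homogeneous_solution_zero] tendsto_const[of "Q 0" at_bot]
      by (subst (asm) Q) (rule tendsto_unique[OF trivial_limit_at_bot_linorder])
    moreover have "Q 0 = P (q *\<^sub>R base) ?e \<bullet> ?e"
      using lim[OF logistic_at_top homogeneous_solution_sqrt] tendsto_const[of "Q 0" at_top] unfolding q_def
      by (subst (asm) Q) (rule tendsto_unique[OF trivial_limit_at_top_linorder])
    ultimately show ?thesis by simp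
  qed
  obtain \<gamma> where \<gamma>: "0 < \<gamma>"
    "\<And>n i. - \<gamma> \<le> rate i 0 - freq n \<Longrightarrow> P (0 *\<^sub>R base) (eigf n i) = eigf n i"
    "\<And>n i. rate i 0 - freq n < - \<gamma> \<Longrightarrow> P (0 *\<^sub>R base) (eigf n i) = 0"
    using equil[OF homogeneous_solution_zero] by blast
  obtain \<gamma>' where \<gamma>': "0 < \<gamma>'"
    "\<And>n i. - \<gamma>' \<le> rate i q - freq n \<Longrightarrow> P (q *\<^sub>R base) (eigf n i) = eigf n i"
    "\<And>n i. rate i q - freq n < - \<gamma>' \<Longrightarrow> P (q *\<^sub>R base) (eigf n i) = 0"
    using equil[OF homogeneous_solution_sqrt] unfolding q_def by blast
  have r: "rate i 0 = 4" "rate 1 q = - 8" "rate 2 q = 2" for i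
    by (simp_all add: rate_def q_def)
  \<comment> \<open>The eigenvalues whose modes are tangent at the equilibrium 0, since
    \<open>- \<gamma> \<le> 4 - m\<close> there. They are recorded as natural numbers, so that a
    largest one exists.\<close>
  define S where "S = {m::nat. (\<exists>n. freq n = real m) \<and> real m \<le> 4 + \<gamma>}"
  have "finite S"
    by (rule finite_subset[of _ "{..nat \<lceil>4 + \<gamma>\<rceil>}"]) (auto simp: S_def le_nat_iff, linarith)
  moreover have "0 \<in> S" using \<gamma>(1) by (auto simp: S_def intro!: exI[of _ "\<lambda>_. 0"])
  ultimately have max: "Max S \<in> S" "\<And>m. m \<in> S \<Longrightarrow> m \<le> Max S" by (auto intro: Max_in)
  define m where "m = Max S"
  obtain n where n: "freq n = real m" "real m \<le> 4 + \<gamma>" using max(1)[folded m_def] unfolding S_def by blast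
  \<comment> \<open>As \<open>m + 1 + (7 m + 2) = 8 m + 3\<close>, this is the least number above
    \<open>m\<close> that is 3 modulo 8, and it exceeds \<open>m\<close> by at most 8.\<close>
  define m' where "m' = m + 1 + (7 * m + 2) mod 8"
  have "m' mod 8 = (m + 1 + (7 * m + 2)) mod 8" unfolding m'_def by (rule mod_add_right_eq)
  also have "m + 1 + (7 * m + 2) = 3 + 8 * m" by simp
  finally have m': "m < m'" "m' \<le> m + 8" "m' mod 8 = 3"
    using mod_less_divisor[of 8 "7 * m + 2"] by (auto simp: m'_def simp del: mod_less_divisor)
  obtain x y z :: int where xyz: "x\<^sup>2 + y\<^sup>2 + z\<^sup>2 = int m'"
  proof (rule sum_of_three_odd_squares)
    show "0 < int m'" using m'(1) by simp
    show "int m' mod 8 = 3" using m'(3) by presburger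
  qed
  define n' :: "3 \<Rightarrow> nat" where "n' = (\<lambda>j. if j = 1 then nat \<bar>x\<bar> else if j = 2 then nat \<bar>y\<bar> else nat \<bar>z\<bar>)"
  have "freq n' = real_of_int (x\<^sup>2 + y\<^sup>2 + z\<^sup>2)"
    by (simp add: freq_def sum_3 n'_def)
  then have fn': "freq n' = real m'" by (simp add: xyz)
  have "P (0 *\<^sub>R base) (eigf n 1) = eigf n 1" by (rule \<gamma>(2)) (use n r in simp)
  then have "P (q *\<^sub>R base) (eigf n 1) \<noteq> 0"
    using transfer[of n 1] eigf_nonzero[of n 1] by auto
  then have 1: "- \<gamma>' \<le> - 8 - real m" using \<gamma>'(3)[of 1 n] n r by fastforce
  have "m' \<notin> S" using max(2)[of m'] m'(1) by (auto simp: m_def)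
  then have "4 + \<gamma> < real m'" using fn' by (auto simp: S_def)
  then have "P (0 *\<^sub>R base) (eigf n' 2) = 0" by (intro \<gamma>(3)) (use fn' r in simp)
  then have "P (q *\<^sub>R base) (eigf n' 2) \<noteq> eigf n' 2"
    using transfer[of n' 2] eigf_nonzero[of n' 2] by auto
  then have "2 - real m' < - \<gamma>'" using \<gamma>'(2)[of 2 n'] fn' r by fastforce
  with 1 m'(2) show False by simp
qed

end

theorem proposition3p4:
  shows "\<exists>k a b :: real. k > 0 \<and> a > 0 \<and> b > 0 \<and> a \<ge> 1 + inverse b \<and> 1 + inverse b \<ge> b \<and>
    (\<forall>g \<Phi>. altered_reaction k a b g \<longrightarrow> phase_semiflow g \<Phi> \<longrightarrow>
      \<not> (\<exists>M. inertial_manifold \<Phi> M \<and> normally_hyperbolic \<Phi> M))"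
proof (rule exI[of _ 4], rule exI[of _ 2], rule exI[of _ 1], intro conjI allI impI notI)
  fix g \<Phi>
  assume g: "altered_reaction 4 2 1 g" and \<Phi>: "phase_semiflow g \<Phi>"
    and "\<exists>M. inertial_manifold \<Phi> M \<and> normally_hyperbolic \<Phi> M"
  then obtain M where M: "inertial_manifold \<Phi> M" "normally_hyperbolic \<Phi> M" by blast
  obtain L R where "L-lipschitz_on UNIV g" "0 < R" "2 \<le> R\<^sup>2" "\<And>v. norm v \<le> R \<Longrightarrow> g v = reaction 4 2 1 v"
    using g unfolding altered_reaction_def by auto
  then interpret altered_system g \<Phi> L R
    using \<Phi> by unfold_locales auto
  show False by (rule not_normally_hyperbolic[OF M])
qed simp_all

end
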